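(* Let $G$ be a hyperbolic group. Then the bounded submonoid membership problem $\mathbf{BSMP}(G)$ is in $\mathbf{P}$.
   Context: Fix a finite generating set $X$ of $G$ (the complexity of the problem does not depend on this choice up to polynomial-time equivalence). Elements of $G$ are given as words over $X\cup X^{-1}$; sizes of words are their lengths, and natural numbers $m$ are given in unary as $1^m$. The bounded submonoid membership problem $\mathbf{BSMP}(G)$: given $g_1,\ldots,g_k,g\in G$ and $1^m$, decide whether $g$ is equal in $G$ to a product $g_{i_1}\cdots g_{i_s}$ with $g_{i_1},\ldots,g_{i_s}\in\{g_1,\ldots,g_k\}$ and $s\le m$ (the empty product, $s=0$, being the identity). The elements $g_1,\ldots,g_k$ are part of the input; the group $G$ is fixed. *)

theory Defs
  imports "HOL-Algebra.Generated_Groups" "HOL-Computational_Algebra.Polynomial"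
begin

subsection \<open>Polynomial time\<close>

text \<open>
  Deterministic Turing machines with a fixed number of two-way infinite tapes.  States are
  the naturals below \<open>state_count M\<close>.  Tape 0 is the input tape (it may be written).  The tape
  alphabet is a finite set of symbols, containing the input symbols, the blank and possibly
  further work symbols.
\<close>

datatype 'a tape_symbol = Blank | Input 'a | Work nat

datatype move = Left | Stay | Right

record 'a tm =
  tape_count :: nat
  state_count :: nat
  tape_alphabet :: "'a tape_symbol set"
  start_state :: nat
  accept_state :: nat
  reject_state :: nat
  trans :: "nat \<Rightarrow> 'a tape_symbol list \<Rightarrow> nat \<times> ('a tape_symbol \<times> move) list"

definition wf_tm :: "'a set \<Rightarrow> 'a tm \<Rightarrow> bool" where
  "wf_tm \<Sigma> M \<longleftrightarrow>
     tape_count M \<ge> 1 \<and>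
     finite (tape_alphabet M) \<and> Blank \<in> tape_alphabet M \<and> Input ` \<Sigma> \<subseteq> tape_alphabet M \<and>
     start_state M < state_count M \<and>
     accept_state M < state_count M \<and>
     reject_state M < state_count M \<and>
     accept_state M \<noteq> reject_state M \<and>
     (\<forall>q < state_count M. \<forall>rs \<in> lists (tape_alphabet M). length rs = tape_count M \<longrightarrow>
        (case trans M q rs of (q', acts) \<Rightarrow>
           q' < state_count M \<and> length acts = tape_count M \<and>
           fst ` set acts \<subseteq> tape_alphabet M))"

text \<open>A tape together with its head position.\<close>

type_synonym 'a tape = "(int \<Rightarrow> 'a tape_symbol) \<times> int"

type_synonym 'a config = "nat \<times> 'a tape list"

definition scan :: "'a tape \<Rightarrow> 'a tape_symbol" where
  "scan tp = (fst tp) (snd tp)"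

fun move_head :: "move \<Rightarrow> int \<Rightarrow> int" where
  "move_head Left h = h - 1"
| "move_head Stay h = h"
| "move_head Right h = h + 1"

definition act :: "'a tape_symbol \<times> move \<Rightarrow> 'a tape \<Rightarrow> 'a tape" where
  "act a tp = ((fst tp)(snd tp := fst a), move_head (snd a) (snd tp))"

definition step :: "'a tm \<Rightarrow> 'a config \<Rightarrow> 'a config" where
  "step M c =
     (if fst c = accept_state M \<or> fst c = reject_state M then c
      else case trans M (fst c) (map scan (snd c)) of
        (q', acts) \<Rightarrow> (q', map2 act acts (snd c)))"

definition blank_tape :: "'a tape" where
  "blank_tape = ((\<lambda>i. Blank), 0)"

definition input_tape :: "'a list \<Rightarrow> 'a tape" where
  "input_tape w =
     ((\<lambda>i. if 0 \<le> i \<and> i < int (length w) then Input (w ! nat i) else Blank), 0)"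

definition start_config :: "'a tm \<Rightarrow> 'a list \<Rightarrow> 'a config" where
  "start_config M w =
     (start_state M, input_tape w # replicate (tape_count M - 1) blank_tape)"

definition decides_in_time ::
  "'a tm \<Rightarrow> 'a set \<Rightarrow> 'a list set \<Rightarrow> (nat \<Rightarrow> nat) \<Rightarrow> bool" where
  "decides_in_time M \<Sigma> L T \<longleftrightarrow>
     (\<forall>w \<in> lists \<Sigma>. \<exists>t \<le> T (length w).
        fst ((step M ^^ t) (start_config M w)) =
          (if w \<in> L then accept_state M else reject_state M))"

text \<open>The class \<open>P\<close> of languages over the alphabet \<open>\<Sigma>\<close>.\<close>

definition class_P :: "'a set \<Rightarrow> 'a list set set" where
  "class_P \<Sigma> =
     {L. L \<subseteq> lists \<Sigma> \<and>
         (\<exists>(M :: 'a tm) (p :: nat poly). wf_tm \<Sigma> M \<and> decides_in_time M \<Sigma> L (poly p))}"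

subsection \<open>Words and hyperbolic groups\<close>

definition sym_gens :: "('a, 'b) monoid_scheme \<Rightarrow> 'a set \<Rightarrow> 'a set" where
  "sym_gens G X = X \<union> m_inv G ` X"

definition word_eval :: "('a, 'b) monoid_scheme \<Rightarrow> 'a list \<Rightarrow> 'a" where
  "word_eval G w = foldr (\<otimes>\<^bsub>G\<^esub>) w \<one>\<^bsub>G\<^esub>"

definition finite_generating_set :: "('a, 'b) monoid_scheme \<Rightarrow> 'a set \<Rightarrow> bool" where
  "finite_generating_set G X \<longleftrightarrow> finite X \<and> X \<subseteq> carrier G \<and> generate G X = carrier G"

definition word_length :: "('a, 'b) monoid_scheme \<Rightarrow> 'a set \<Rightarrow> 'a \<Rightarrow> nat" where
  "word_length G X g = (LEAST n. \<exists>w \<in> lists (sym_gens G X). length w = n \<and> word_eval G w = g)"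

definition word_dist :: "('a, 'b) monoid_scheme \<Rightarrow> 'a set \<Rightarrow> 'a \<Rightarrow> 'a \<Rightarrow> real" where
  "word_dist G X g h = real (word_length G X (inv\<^bsub>G\<^esub> g \<otimes>\<^bsub>G\<^esub> h))"

definition gromov_product :: "('a \<Rightarrow> 'a \<Rightarrow> real) \<Rightarrow> 'a \<Rightarrow> 'a \<Rightarrow> 'a \<Rightarrow> real" where
  "gromov_product d w x y = (d x w + d y w - d x y) / 2"

text \<open>
  Gromov's definition of hyperbolicity of a metric space; it does not require the space to be
  geodesic, so it applies directly to a group with a word metric.
\<close>

definition gromov_hyperbolic :: "'a set \<Rightarrow> ('a \<Rightarrow> 'a \<Rightarrow> real) \<Rightarrow> bool" where
  "gromov_hyperbolic S d \<longleftrightarrow>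
     (\<exists>\<delta> \<ge> 0. \<forall>w \<in> S. \<forall>x \<in> S. \<forall>y \<in> S. \<forall>z \<in> S.
        gromov_product d w x z \<ge>
          min (gromov_product d w x y) (gromov_product d w y z) - \<delta>)"

definition hyperbolic_group :: "('a, 'b) monoid_scheme \<Rightarrow> bool" where
  "hyperbolic_group G \<longleftrightarrow>
     group G \<and>
     (\<exists>Y. finite_generating_set G Y \<and> gromov_hyperbolic (carrier G) (word_dist G Y))"

subsection \<open>The bounded submonoid membership problem\<close>

datatype 'a bsmp_symbol = Letter 'a | Separator | One

definition bsmp_alphabet :: "('a, 'b) monoid_scheme \<Rightarrow> 'a set \<Rightarrow> 'a bsmp_symbol set" where
  "bsmp_alphabet G X = Letter ` sym_gens G X \<union> {Separator, One}"

text \<open>The instance \<open>(g\<^sub>1, \<dots>, g\<^sub>k, g, 1\<^sup>m)\<close> is written \<open>g\<^sub>1 # \<dots> # g\<^sub>k # g # 1\<^sup>m\<close>.\<close>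

definition encode_word :: "'a list \<Rightarrow> 'a bsmp_symbol list" where
  "encode_word w = map Letter w @ [Separator]"

definition encode_bsmp :: "'a list list \<Rightarrow> 'a list \<Rightarrow> nat \<Rightarrow> 'a bsmp_symbol list" where
  "encode_bsmp gs g m = concat (map encode_word gs) @ encode_word g @ replicate m One"

definition bsmp_solvable ::
  "('a, 'b) monoid_scheme \<Rightarrow> 'a list list \<Rightarrow> 'a list \<Rightarrow> nat \<Rightarrow> bool" where
  "bsmp_solvable G gs g m \<longleftrightarrow>
     (\<exists>hs \<in> lists (word_eval G ` set gs). length hs \<le> m \<and>
        word_eval G g = foldr (\<otimes>\<^bsub>G\<^esub>) hs \<one>\<^bsub>G\<^esub>)"

definition BSMP :: "('a, 'b) monoid_scheme \<Rightarrow> 'a set \<Rightarrow> 'a bsmp_symbol list set" where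
  "BSMP G X =
     {encode_bsmp gs g m | gs g m.
        gs \<in> lists (lists (sym_gens G X)) \<and> g \<in> lists (sym_gens G X) \<and>
        bsmp_solvable G gs g m}"

lemma encode_word_append_eq_iff:
  "encode_word u @ s = encode_word v @ t \<longleftrightarrow> u = v \<and> s = t"
proof (induction u arbitrary: v)
  case Nil
  then show ?case by (cases v) (auto simp: encode_word_def)
next
  case (Cons a u)
  then show ?case by (cases v) (auto simp: encode_word_def)
qed

lemma encode_bsmp_inject:
  "encode_bsmp gs g m = encode_bsmp gs' g' m' \<longleftrightarrow> gs = gs' \<and> g = g' \<and> m = m'"
proof -
  have no_word: "replicate n One \<noteq> encode_word u @ s" for n u and s :: "'a bsmp_symbol list"
  proof
    assume "replicate n One = encode_word u @ s"
    then have "Separator \<in> set (replicate n (One :: 'a bsmp_symbol))"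
      by (simp add: encode_word_def)
    then show False by (simp split: if_splits)
  qed
  have inj: "concat (map encode_word us) @ replicate m One =
        concat (map encode_word vs) @ replicate m' One \<Longrightarrow> us = vs \<and> m = m'"
    for us vs :: "'a list list"
  proof (induction us arbitrary: vs)
    case Nil
    then show ?case
      by (cases vs) (auto simp: no_word dest: arg_cong[where f = length])
  next
    case (Cons u us)
    then show ?case
      by (cases vs) (auto simp: encode_word_append_eq_iff no_word[symmetric])
  qed
  show ?thesis
    using inj[of "gs @ [g]" "gs' @ [g']"] by (auto simp: encode_bsmp_def)
qed

end

theory Submission
  imports Defs
begin

text \<open>
  In a hyperbolic group every closed path of \<open>N\<close> steps has a triangulation whose diagonals have
  length \<open>O(log N)\<close>: by Gromov's inequality for polygons, the path from \<open>x\<close> to \<open>y\<close> passes within \<open>O(log N)\<close>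
  of the midpoint of a geodesic from \<open>x\<close> to \<open>y\<close>.  Hence a dynamic program in the style of Cocke, Younger and
  Kasami decides whether some product of at most \<open>m\<close> generators times the inverse of the target is trivial.
  Its facts \<open>(p, u, q)\<close> say that the element \<open>u\<close> labels a path from \<open>p\<close> to \<open>q\<close> in the graph of partially read
  products, where \<open>u\<close> is a word of logarithmic length, so that there are polynomially many.  Equality of such
  words is handled by the same saturation: since geodesics with close ends fellow-travel, equal words are connected
  by rewriting steps of bounded size through words that are not much longer.  Words are taken over the generating
  set for which the group is known to be hyperbolic, so its independence of the generating set is not needed.

  The Turing machine comes from structured programs on four stacks.  A program for a function replaces the
  encoded tree on top of stack 0 by its image and leaves everything below untouched; this makes the functions with
  polynomial-time programs closed under composition, pairing, case distinction and folds with polynomially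
  bounded intermediate results.
\<close>

section \<open>Structured stack programs and their compilation to Turing machines\<close>

text \<open>The products are exponentially many in \<open>m\<close>, so they have to be treated all
  at once. A product that hits the target closes up to a polygon in the Cayley graph, with
  polynomially many corners because \<open>m\<close> is unary. Halving a polygon costs one \<delta>
  per round, so the loss is logarithmic in the number of corners; the words of logarithmic length
  are exponentially many in a logarithm, hence polynomially many.

  A diagonal is a group element, but a fact carries a word, and different triangulations may label
  the same diagonal by different words. Finitely many relators of length at most
  \<open>\<kappa> + 1\<close> close this gap inside the same fixed point.

  The logarithm is never computed. The decider forms a power of the input length, whose exponent
  depends only on the group and the two generating sets, and lists words until their number passes
  this power. A finite table replaces the letters of the input by fixed words over the hyperbolic
  generating set, which stretches lengths by a constant factor.\<close>

type_synonym store = "nat \<Rightarrow> nat list"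

text \<open>A machine writes before it moves, so a push is split into \<open>Up\<close>, which moves
  to a fresh blank cell, and \<open>Write\<close>. Conditions and written symbols see only the tops
  of the stacks, which is what the heads scan.\<close>

datatype com =
    Skip
  | Halt bool
  | Up nat
  | Write nat "(nat \<Rightarrow> nat) \<Rightarrow> nat"
  | Pop nat
  | Seq com com  (infixr \<open>;;\<close> 60)
  | Cond "(nat \<Rightarrow> nat) \<Rightarrow> bool" com com
  | Loop "(nat \<Rightarrow> nat) \<Rightarrow> bool" com

definition top_sym :: "nat list \<Rightarrow> nat" where
  "top_sym xs = (case xs of [] \<Rightarrow> 0 | x # _ \<Rightarrow> x)"

definition tops :: "store \<Rightarrow> nat \<Rightarrow> nat" where
  "tops s i = top_sym (s i)"

lemma top_sym_simps [simp]: "top_sym [] = 0" "top_sym (x # xs) = x"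
  by (simp_all add: top_sym_def)

text \<open>The state of the control is the program that remains to be run. \<open>Halt\<close> and
  \<open>Skip\<close> are fixed points, and a sequence whose first part has become
  \<open>Skip\<close> spends one step on passing to the second.\<close>

fun ctrl :: "com \<Rightarrow> (nat \<Rightarrow> nat) \<Rightarrow> com" where
  "ctrl (Halt b) t = Halt b"
| "ctrl (c ;; d) t = (if c = Skip then d else ctrl c t ;; d)"
| "ctrl (Cond b c d) t = (if b t then c else d)"
| "ctrl (Loop b c) t = (if b t then c ;; Loop b c else Skip)"
| "ctrl _ t = Skip"

fun effect :: "com \<Rightarrow> store \<Rightarrow> store" where
  "effect (Up i) s = s(i := 0 # s i)"
| "effect (Write i h) s = s(i := h (tops s) # tl (s i))"
| "effect (Pop i) s = s(i := tl (s i))"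
| "effect (c ;; d) s = effect c s"
| "effect _ s = s"

definition sstep :: "com \<times> store \<Rightarrow> com \<times> store" where
  "sstep = (\<lambda>(c, s). (ctrl c (tops s), effect c s))"

text \<open>A finite set that contains the program with all its remainders and is closed under
  \<open>ctrl\<close>; it supplies the states of the machine.\<close>

fun conts :: "com \<Rightarrow> com set" where
  "conts (c ;; d) = (\<lambda>c'. c' ;; d) ` conts c \<union> conts d"
| "conts (Cond b c d) = insert (Cond b c d) (conts c \<union> conts d)"
| "conts (Loop b c) = {Loop b c, Skip} \<union> (\<lambda>c'. c' ;; Loop b c) ` conts c"
| "conts (Halt b) = {Halt b}"
| "conts c = {c, Skip}"

text \<open>Quantifying over all larger alphabets lets programs that are checked once for the
  symbols 0 to 3 run over the full input alphabet.\<close>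

definition bounded_symbol :: "nat \<Rightarrow> ((nat \<Rightarrow> nat) \<Rightarrow> nat) \<Rightarrow> bool" where
  "bounded_symbol b h \<longleftrightarrow> (\<forall>b' \<ge> b. \<forall>t. (\<forall>j. t j < b') \<longrightarrow> h t < b')"

text \<open>\<open>n\<close> bounds the stacks, \<open>b\<close> the symbols.\<close>

fun wf_com :: "nat \<Rightarrow> nat \<Rightarrow> com \<Rightarrow> bool" where
  "wf_com n b (Up i) \<longleftrightarrow> i < n"
| "wf_com n b (Write i h) \<longleftrightarrow> i < n \<and> bounded_symbol b h"
| "wf_com n b (Pop i) \<longleftrightarrow> i < n"
| "wf_com n b (c ;; d) \<longleftrightarrow> wf_com n b c \<and> wf_com n b d"
| "wf_com n b (Cond p c d) \<longleftrightarrow> wf_com n b c \<and> wf_com n b d"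
| "wf_com n b (Loop p c) \<longleftrightarrow> wf_com n b c"
| "wf_com n b c \<longleftrightarrow> True"

lemma finite_conts [simp]: "finite (conts c)"
  by (induction c) auto

lemma conts_self [simp]: "c \<in> conts c"
  by (induction c) auto

lemma ctrl_conts: "c' \<in> conts c \<Longrightarrow> ctrl c' t \<in> conts c"
  by (induction c arbitrary: c') (auto split: if_splits)

lemma wf_com_conts: "c' \<in> conts c \<Longrightarrow> wf_com n b c \<Longrightarrow> wf_com n b c'"
  by (induction c arbitrary: c') (auto simp del: conts_self)

lemma wf_com_mono: "wf_com n b c \<Longrightarrow> b \<le> b' \<Longrightarrow> wf_com n b' c"
  by (induction c) (auto simp: bounded_symbol_def)

section \<open>Stacks as tapes and the simulation by a Turing machine\<close>

definition tape_rep :: "(nat \<Rightarrow> 'x tape_symbol) \<Rightarrow> 'x tape \<Rightarrow> nat list \<Rightarrow> bool" where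
  "tape_rep \<kappa> tp xs \<longleftrightarrow> (\<forall>k. fst tp k =
     (if snd tp \<le> k \<and> nat (k - snd tp) < length xs then \<kappa> (xs ! nat (k - snd tp)) else Blank))"

lemma scan_tape_rep: "tape_rep \<kappa> tp xs \<Longrightarrow> \<kappa> 0 = Blank \<Longrightarrow> scan tp = \<kappa> (top_sym xs)"
  by (cases xs) (auto simp: tape_rep_def scan_def)

lemma tape_rep_Stay:
  assumes "tape_rep \<kappa> tp xs"
  shows "tape_rep \<kappa> (act (scan tp, Stay) tp) xs"
  using assms by (auto simp: tape_rep_def act_def scan_def)

text \<open>The cell left of the head is blank because the tape is blank outside the stack; this is
  why a pop has to erase.\<close>

lemma tape_rep_Up:
  assumes "tape_rep \<kappa> tp xs" "\<kappa> 0 = Blank"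
  shows "tape_rep \<kappa> (act (scan tp, Left) tp) (0 # xs)"
  unfolding tape_rep_def
proof
  fix k
  obtain f h where [simp]: "tp = (f, h)" by (cases tp)
  have f: "f k = (if h \<le> k \<and> nat (k - h) < length xs then \<kappa> (xs ! nat (k - h)) else Blank)" for k
    using assms(1) by (simp add: tape_rep_def)
  consider "k < h - 1" | "k = h - 1" | "h \<le> k" by linarith
  then show "fst (act (scan tp, Left) tp) k =
     (if snd (act (scan tp, Left) tp) \<le> k \<and> nat (k - snd (act (scan tp, Left) tp)) < length (0 # xs)
      then \<kappa> ((0 # xs) ! nat (k - snd (act (scan tp, Left) tp))) else Blank)"
  proof cases
    case 3
    then have "nat (k - (h - 1)) = Suc (nat (k - h))" by linarith
    with 3 f[of k] show ?thesis
      by (simp add: act_def scan_def)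
  qed (use f[of k] assms(2) in \<open>simp_all add: act_def scan_def\<close>)
qed

lemma tape_rep_Pop:
  assumes "tape_rep \<kappa> tp xs"
  shows "tape_rep \<kappa> (act (Blank, Right) tp) (tl xs)"
  unfolding tape_rep_def
proof
  fix k
  obtain f h where [simp]: "tp = (f, h)" by (cases tp)
  have f: "f k = (if h \<le> k \<and> nat (k - h) < length xs then \<kappa> (xs ! nat (k - h)) else Blank)" for k
    using assms(1) by (simp add: tape_rep_def)
  show "fst (act (Blank, Right) tp) k =
     (if snd (act (Blank, Right) tp) \<le> k \<and> nat (k - snd (act (Blank, Right) tp)) < length (tl xs)
      then \<kappa> ((tl xs) ! nat (k - snd (act (Blank, Right) tp))) else Blank)"
  proof (cases "h < k")
    case True
    then have "nat (k - h) = Suc (nat (k - (h + 1)))" by linarith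
    with True f[of k] show ?thesis
      by (cases xs) (simp_all add: act_def scan_def)
  qed (use f[of k] in \<open>auto simp: act_def scan_def\<close>)
qed

lemma tape_rep_Write:
  assumes "tape_rep \<kappa> tp xs" 
  shows "tape_rep \<kappa> (act (\<kappa> a, Stay) tp) (a # tl xs)"
  unfolding tape_rep_def
proof
  fix k
  obtain f h where [simp]: "tp = (f, h)" by (cases tp)
  have f: "f k = (if h \<le> k \<and> nat (k - h) < length xs then \<kappa> (xs ! nat (k - h)) else Blank)" for k
    using assms(1) by (simp add: tape_rep_def)
  show "fst (act (\<kappa> a, Stay) tp) k =
     (if snd (act (\<kappa> a, Stay) tp) \<le> k \<and> nat (k - snd (act (\<kappa> a, Stay) tp)) < length (a # tl xs)
      then \<kappa> ((a # tl xs) ! nat (k - snd (act (\<kappa> a, Stay) tp))) else Blank)"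
  proof (cases "h < k")
    case True
    then have "nat (k - h) = Suc (nat (k - (h + 1)))" by linarith
    with True f[of k] show ?thesis
      by (cases xs) (simp_all add: act_def scan_def)
  qed (use f[of k] in \<open>auto simp: act_def scan_def\<close>)
qed

fun tape_act :: "(nat \<Rightarrow> 'x tape_symbol) \<Rightarrow> com \<Rightarrow> (nat \<Rightarrow> nat) \<Rightarrow> nat \<Rightarrow> 'x tape_symbol \<times> move" where
  "tape_act \<kappa> (Up j) t i = (\<kappa> (t i), if i = j then Left else Stay)"
| "tape_act \<kappa> (Write j h) t i = (if i = j then \<kappa> (h t) else \<kappa> (t i), Stay)"
| "tape_act \<kappa> (Pop j) t i = (if i = j then (Blank, Right) else (\<kappa> (t i), Stay))"
| "tape_act \<kappa> (c ;; d) t i = tape_act \<kappa> c t i"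
| "tape_act \<kappa> c t i = (\<kappa> (t i), Stay)"

lemma tape_rep_tape_act:
  assumes "tape_rep \<kappa> tp (s i)" "\<kappa> 0 = Blank"
  shows "tape_rep \<kappa> (act (tape_act \<kappa> c (tops s) i) tp) (effect c s i)"
proof -
  have "scan tp = \<kappa> (tops s i)"
    using scan_tape_rep[OF assms] by (simp add: tops_def)
  with assms show ?thesis
    by (induction c)
      (auto simp: tape_rep_Pop tape_rep_Write dest: tape_rep_Up tape_rep_Stay)
qed

lemma in_set_tlD: "x \<in> set (tl xs) \<Longrightarrow> x \<in> set xs"
  by (cases xs) auto

lemma effect_bounded:
  assumes "wf_com n b c" "\<forall>i. set (s i) \<subseteq> {..<b}" "0 < b"
  shows "\<forall>i. set (effect c s i) \<subseteq> {..<b}"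
proof -
  have "tops s j < b" for j
    using assms(2,3) by (cases "s j") (auto simp: tops_def dest: spec[of _ j])
  then have "h (tops s) < b" if "bounded_symbol b h" for h
    using that by (simp add: bounded_symbol_def)
  with assms show ?thesis
    by (induction c) (auto dest: in_set_tlD)
qed

lemma effect_outside: "wf_com n b c \<Longrightarrow> n \<le> i \<Longrightarrow> effect c s i = s i"
  by (induction c) auto

lemma tape_act_alphabet:
  assumes "wf_com n b c" "\<And>j. t j < b" "\<kappa> 0 = Blank" "0 < b"
  shows "fst (tape_act \<kappa> c t i) \<in> \<kappa> ` {..<b}"
proof -
  have "h t < b" if "bounded_symbol b h" for h
    using that assms(2) by (simp add: bounded_symbol_def)
  moreover have "Blank \<in> \<kappa> ` {..<b}"
    using assms(3,4) by (metis imageI lessThan_iff)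
  ultimately show ?thesis
    using assms(1,2) by (induction c) auto
qed

definition start_store :: "(nat \<Rightarrow> 'x tape_symbol) \<Rightarrow> nat \<Rightarrow> 'x list \<Rightarrow> store" where
  "start_store \<kappa> b w = (\<lambda>i. if i = 0 then map (\<lambda>x. the_inv_into {..<b} \<kappa> (Input x)) w else [])"

text \<open>Stacks with index from \<open>n\<close> on have no tape; they count as empty, and the
  top of an empty stack is 0.\<close>

definition compile :: "(nat \<Rightarrow> 'x tape_symbol) \<Rightarrow> nat \<Rightarrow> nat \<Rightarrow> (com \<Rightarrow> nat) \<Rightarrow> com set \<Rightarrow> com \<Rightarrow> 'x tm" where
  "compile \<kappa> n b \<iota> Q c =
     \<lparr>tape_count = n, state_count = card Q, tape_alphabet = \<kappa> ` {..<b}, start_state = \<iota> c,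
      accept_state = \<iota> (Halt True), reject_state = \<iota> (Halt False),
      trans = (\<lambda>q rs.
        let d = the_inv_into Q \<iota> q;
            t = (\<lambda>i. if i < n then the_inv_into {..<b} \<kappa> (rs ! i) else 0)
        in (\<iota> (ctrl d t), map (tape_act \<kappa> d t) [0..<n]))\<rparr>"

locale compilation =
  fixes \<kappa> :: "nat \<Rightarrow> 'x tape_symbol" and n b :: nat and \<iota> :: "com \<Rightarrow> nat" and c :: com
    and Q :: "com set" and \<Sigma> :: "'x set"
  assumes Q_def: "Q = conts c \<union> {Halt True, Halt False}"
    and kappa0: "\<kappa> 0 = Blank" and b_pos: "0 < b" and n_pos: "0 < n"
    and inj_kappa: "inj_on \<kappa> {..<b}" and Sigma: "Input ` \<Sigma> \<subseteq> \<kappa> ` {..<b}"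
    and iota: "bij_betw \<iota> Q {..<card Q}" and wf: "wf_com n b c"
begin

abbreviation "M \<equiv> compile \<kappa> n b \<iota> Q c"

lemma inv_iota [simp]: "d \<in> Q \<Longrightarrow> the_inv_into Q \<iota> (\<iota> d) = d"
  using iota by (auto simp: bij_betw_def the_inv_into_f_f)

lemma iota_less [simp]: "d \<in> Q \<Longrightarrow> \<iota> d < card Q"
  using iota by (auto simp: bij_betw_def)

lemma ctrl_Q: "d \<in> Q \<Longrightarrow> ctrl d t \<in> Q"
  by (auto simp: Q_def ctrl_conts)

lemma wf_Q: "d \<in> Q \<Longrightarrow> wf_com n b d"
  using wf by (auto simp: Q_def intro: wf_com_conts)

lemma inv_kappa [simp]: "k < b \<Longrightarrow> the_inv_into {..<b} \<kappa> (\<kappa> k) = k"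
  using inj_kappa by (auto simp: the_inv_into_f_f)

lemma iota_eq: "d \<in> Q \<Longrightarrow> e \<in> Q \<Longrightarrow> \<iota> d = \<iota> e \<longleftrightarrow> d = e"
  by (metis inv_iota)

lemma Halt_Q [simp]: "Halt v \<in> Q"
  by (cases v) (auto simp: Q_def)

lemma c_Q [simp]: "c \<in> Q"
  by (auto simp: Q_def)

lemma wf_tm_compile: "wf_tm \<Sigma> M"
proof -
  have "case trans M q rs of (q', acts) \<Rightarrow>
           q' < state_count M \<and> length acts = tape_count M \<and> fst ` set acts \<subseteq> tape_alphabet M"
    if "q < state_count M" "rs \<in> lists (tape_alphabet M)" "length rs = tape_count M" for q rs
  proof -
    have "q \<in> \<iota> ` Q"
      using that(1) iota by (auto simp: compile_def bij_betw_def)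
    then obtain d where d: "d \<in> Q" "q = \<iota> d" by blast
    have rs: "rs ! i \<in> \<kappa> ` {..<b}" if "i < n" for i
      using \<open>rs \<in> _\<close> \<open>length rs = _\<close> that by (auto simp: compile_def in_lists_conv_set)
    let ?t = "\<lambda>i. if i < n then the_inv_into {..<b} \<kappa> (rs ! i) else 0"
    have t: "?t j < b" for j
      using rs[of j] b_pos by auto
    have "fst (tape_act \<kappa> d ?t i) \<in> \<kappa> ` {..<b}" for i
      using wf_Q[OF d(1)] t kappa0 b_pos by (rule tape_act_alphabet)
    with d show ?thesis
      using ctrl_Q[OF d(1)] by (simp add: compile_def Let_def image_subset_iff)
  qed
  moreover have "Blank \<in> \<kappa> ` {..<b}"
    using kappa0 b_pos by (metis imageI lessThan_iff)
  ultimately show ?thesis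
    using n_pos Sigma iota_eq[of "Halt True" "Halt False"] unfolding wf_tm_def
    by (auto simp: compile_def)
qed

definition sim :: "'x config \<Rightarrow> com \<times> store \<Rightarrow> bool" where
  "sim cf ds \<longleftrightarrow> fst ds \<in> Q \<and> fst cf = \<iota> (fst ds) \<and> length (snd cf) = n \<and>
     (\<forall>i < n. tape_rep \<kappa> (snd cf ! i) (snd ds i)) \<and>
     (\<forall>i \<ge> n. snd ds i = []) \<and> (\<forall>i. set (snd ds i) \<subseteq> {..<b})"

lemma sim_step:
  assumes "sim cf ds"
  shows "sim (step M cf) (sstep ds)"
proof -
  obtain q tps d s where eq [simp]: "cf = (q, tps)" "ds = (d, s)"
    by (cases cf, cases ds) auto
  have d: "d \<in> Q" and q: "q = \<iota> d" and len: "length tps = n"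
    and rep: "\<And>i. i < n \<Longrightarrow> tape_rep \<kappa> (tps ! i) (s i)"
    and out: "\<And>i. i \<ge> n \<Longrightarrow> s i = []" and bd: "\<And>i. set (s i) \<subseteq> {..<b}"
    using assms by (auto simp: sim_def)
  show ?thesis
  proof (cases "d = Halt True \<or> d = Halt False")
    case True
    then have "step M cf = cf" "sstep ds = ds"
      by (auto simp: step_def compile_def q sstep_def)
    with assms show ?thesis by simp
  next
    case False
    have t_lt: "tops s j < b" for j
      using bd[of j] b_pos by (cases "s j") (auto simp: tops_def)
    have t: "(\<lambda>i. if i < n then the_inv_into {..<b} \<kappa> (map scan tps ! i) else 0) = tops s"
    proof
      fix i
      show "(if i < n then the_inv_into {..<b} \<kappa> (map scan tps ! i) else 0) = tops s i"
        using scan_tape_rep[OF rep[of i] kappa0] t_lt[of i] out[of i] len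
        by (simp add: tops_def)
    qed
    have st: "step M cf = (\<iota> (ctrl d (tops s)), map2 act (map (tape_act \<kappa> d (tops s)) [0..<n]) tps)"
      using False d t by (simp add: step_def compile_def q iota_eq Let_def)
    have "tape_rep \<kappa> (map2 act (map (tape_act \<kappa> d (tops s)) [0..<n]) tps ! i) (effect d s i)"
      if "i < n" for i
      using tape_rep_tape_act[where s = s and i = i, OF rep[OF that] kappa0] that len by simp
    then show ?thesis
      using st d ctrl_Q len effect_bounded[OF wf_Q[OF d] _ b_pos, of s] bd
        effect_outside[OF wf_Q[OF d]] out
      by (simp add: sim_def sstep_def)
  qed
qed

lemma sim_start:
  assumes "w \<in> lists \<Sigma>"
  shows "sim (start_config M w) (c, start_store \<kappa> b w)"
proof -
  have "the_inv_into {..<b} \<kappa> (Input x) < b \<and> \<kappa> (the_inv_into {..<b} \<kappa> (Input x)) = Input x"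
    if "x \<in> \<Sigma>" for x
    using Sigma that by (auto simp: image_subset_iff)
  moreover have "x \<in> \<Sigma>" if "x \<in> set w" for x
    using that assms by auto
  ultimately have *: "set (map (\<lambda>x. the_inv_into {..<b} \<kappa> (Input x)) w) \<subseteq> {..<b}"
    "\<And>k. k < length w \<Longrightarrow> \<kappa> (the_inv_into {..<b} \<kappa> (Input (w ! k))) = Input (w ! k)"
    by auto
  have "tape_rep \<kappa> (snd (start_config M w) ! i) (start_store \<kappa> b w i)" if "i < n" for i
    using that *(2)
    by (cases i) (auto simp: start_config_def compile_def start_store_def tape_rep_def
        input_tape_def blank_tape_def nat_less_iff)
  then show ?thesis
    using *(1) n_pos
    by (auto simp: sim_def start_config_def compile_def start_store_def)
qed

lemma sim_funpow:
  "sim cf ds \<Longrightarrow> sim ((step M ^^ t) cf) ((sstep ^^ t) ds)"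
  by (induction t) (auto intro: sim_step)

lemma compile_halts:
  assumes "w \<in> lists \<Sigma>" "fst ((sstep ^^ t) (c, start_store \<kappa> b w)) = Halt v"
  shows "fst ((step M ^^ t) (start_config M w)) = (if v then accept_state M else reject_state M)"
  using sim_funpow[OF sim_start[OF assms(1)], of t] assms(2)
  by (simp add: sim_def compile_def)

end

text \<open>1 and 2 spell trees, 3 marks ends, and input letters start at 4, so that a letter is
  never confused with a blank or a marker.\<close>

definition sym_code :: "'x list \<Rightarrow> nat \<Rightarrow> 'x tape_symbol" where
  "sym_code as k = (if k = 0 then Blank else if k < 4 then Work k else Input (as ! (k - 4)))"

lemma class_P_I:
  fixes as :: "'x list" and p :: "nat poly"
  assumes "distinct as" "L \<subseteq> lists (set as)" "0 < n" "wf_com n (4 + length as) c"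
    and "\<And>js. set js \<subseteq> {..<length as} \<Longrightarrow>
      \<exists>t \<le> poly p (length js). fst ((sstep ^^ t) (c, (\<lambda>i. if i = 0 then map (\<lambda>j. j + 4) js else []))) =
        Halt (map (nth as) js \<in> L)"
  shows "L \<in> class_P (set as)"
proof -
  let ?b = "4 + length as"
  define Q where "Q = conts c \<union> {Halt True, Halt False}"
  have "finite Q" by (simp add: Q_def)
  then obtain \<iota> where iota: "bij_betw \<iota> Q {..<card Q}"
    using ex_bij_betw_finite_nat[of Q] by (auto simp: atLeast0LessThan)
  have inj: "inj_on (sym_code as) {..<?b}"
    using \<open>distinct as\<close> by (auto simp: inj_on_def sym_code_def nth_eq_iff_index_eq split: if_splits)
  have code: "sym_code as (j + 4) = Input (as ! j)" for j
    by (simp add: sym_code_def)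
  have "Input x \<in> sym_code as ` {..<?b}" if "x \<in> set as" for x
    using that code by (metis add.commute add_less_cancel_left imageI in_set_conv_nth lessThan_iff)
  then interpret compilation "sym_code as" n ?b \<iota> c Q "set as"
    using assms iota inj by unfold_locales (auto simp: Q_def sym_code_def)
  have "\<exists>t \<le> poly p (length w). fst ((step M ^^ t) (start_config M w)) =
      (if w \<in> L then accept_state M else reject_state M)" if w: "w \<in> lists (set as)" for w
  proof -
    have "\<forall>x \<in> set w. \<exists>j < length as. as ! j = x"
      using w by (auto simp: in_set_conv_nth dest!: subsetD)
    then obtain f where f: "\<And>x. x \<in> set w \<Longrightarrow> f x < length as \<and> as ! f x = x"
      by metis
    define js where "js = map f w"
    have js: "set js \<subseteq> {..<length as}" "map (nth as) js = w" "length js = length w"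
      using f by (auto simp: js_def intro: map_idI)
    have "the_inv_into {..<?b} (sym_code as) (Input x) = f x + 4" if "x \<in> set w" for x
      using inv_kappa[of "f x + 4"] f[OF that] by (simp add: code)
    then have "start_store (sym_code as) ?b w = (\<lambda>i. if i = 0 then map (\<lambda>j. j + 4) js else [])"
      by (auto simp: start_store_def js_def)
    with assms(5)[OF js(1)] compile_halts[OF w] js show ?thesis by metis
  qed
  then show ?thesis
    using wf_tm_compile \<open>L \<subseteq> _\<close> unfolding class_P_def decides_in_time_def by blast
qed

section \<open>Polynomial-time functions on encoded data\<close>

definition runs :: "com \<Rightarrow> store \<Rightarrow> nat \<Rightarrow> store \<Rightarrow> bool" where
  "runs c s T s' \<longleftrightarrow> (\<exists>t \<le> T. (sstep ^^ t) (c, s) = (Skip, s'))"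

lemma runs_mono: "runs c s T s' \<Longrightarrow> T \<le> T' \<Longrightarrow> runs c s T' s'"
  unfolding runs_def using le_trans by blast

lemma runs_step: "runs (ctrl c (tops s)) (effect c s) T s' \<Longrightarrow> runs c s (Suc T) s'"
  unfolding runs_def
  by (metis (no_types, lifting) Suc_le_mono case_prod_conv funpow_Suc_right o_apply sstep_def)

lemma runs_Skip: "runs Skip s T s"
  unfolding runs_def by (rule exI[of _ 0]) simp

text \<open>Stated for reaching \<open>d\<close> rather than the end of \<open>d\<close>, because
  the final program ends in \<open>Halt\<close> and not in \<open>Skip\<close>. The time may be less
  than \<open>t\<close>, as \<open>Skip\<close> repeats itself.\<close>

lemma Seq_reaches:
  "(sstep ^^ t) (c, s) = (Skip, s') \<Longrightarrow> \<exists>t' \<le> t + 1. (sstep ^^ t') (c ;; d, s) = (d, s')"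
proof (induction t arbitrary: c s)
  case 0
  then have "(sstep ^^ 1) (c ;; d, s) = (d, s')" by (simp add: sstep_def)
  then show ?case by (metis add_0 le_refl)
next
  case (Suc t)
  show ?case
  proof (cases "c = Skip")
    case True
    have "(sstep ^^ n) (Skip, s) = (Skip, s)" for n
      by (induction n) (auto simp: sstep_def)
    with Suc.prems True have "(sstep ^^ 1) (c ;; d, s) = (d, s')" by (simp add: sstep_def)
    then show ?thesis by (metis le_add2)
  next
    case False
    have "(sstep ^^ t) (ctrl c (tops s), effect c s) = (Skip, s')"
      using Suc.prems(1) by (simp add: funpow_swap1 sstep_def)
    from Suc.IH[OF this] obtain t' where t':
      "t' \<le> t + 1" "(sstep ^^ t') (ctrl c (tops s) ;; d, effect c s) = (d, s')" by blast
    have "(sstep ^^ Suc t') (c ;; d, s) = (d, s')"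
      using t'(2) False by (simp add: funpow_swap1 sstep_def)
    then show ?thesis using t'(1) by (metis Suc_eq_plus1 Suc_le_mono)
  qed
qed

lemma runs_Seq:
  assumes "runs c s T1 s1" "runs d s1 T2 s2"
  shows "runs (c ;; d) s (T1 + T2 + 1) s2"
proof -
  obtain t u where t: "t \<le> T1" "(sstep ^^ t) (c, s) = (Skip, s1)"
    and u: "u \<le> T2" "(sstep ^^ u) (d, s1) = (Skip, s2)"
    using assms by (auto simp: runs_def)
  obtain t' where t': "t' \<le> t + 1" "(sstep ^^ t') (c ;; d, s) = (d, s1)"
    using Seq_reaches[OF t(2)] by blast
  have "(sstep ^^ (u + t')) (c ;; d, s) = (Skip, s2)"
    by (simp add: funpow_add t' u)
  then show ?thesis
    using t t' u unfolding runs_def by (intro exI[of _ "u + t'"]) auto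
qed

lemma runs_Up: "runs (Up i) s 1 (s(i := 0 # s i))"
  using runs_step[of "Up i" s 0] runs_Skip by simp

lemma runs_Write: "runs (Write i h) s 1 (s(i := h (tops s) # tl (s i)))"
  using runs_step[of "Write i h" s 0] runs_Skip by simp

lemma runs_Pop: "runs (Pop i) s 1 (s(i := tl (s i)))"
  using runs_step[of "Pop i" s 0] runs_Skip by simp

lemma runs_Cond: "runs (if b (tops s) then c else d) s T s' \<Longrightarrow> runs (Cond b c d) s (Suc T) s'"
  using runs_step[of "Cond b c d" s T s'] by simp

lemma runs_Loop_stop: "\<not> b (tops s) \<Longrightarrow> runs (Loop b c) s 1 s"
  using runs_step[of "Loop b c" s 0 s] runs_Skip by simp

lemma runs_Loop_again:
  "b (tops s) \<Longrightarrow> runs c s T1 s1 \<Longrightarrow> runs (Loop b c) s1 T2 s2 \<Longrightarrow> runs (Loop b c) s (T1 + T2 + 2) s2"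
  using runs_step[of "Loop b c" s "T1 + T2 + 1"] runs_Seq[of c s T1 s1 "Loop b c" T2 s2] by simp

definition push :: "nat \<Rightarrow> nat \<Rightarrow> com" where
  "push i a = Up i ;; Write i (\<lambda>t. a)"

definition copy :: "nat \<Rightarrow> nat \<Rightarrow> com" where
  "copy i j = Up j ;; Write j (\<lambda>t. t i)"

lemma runs_push: "runs (push i a) s 3 (s(i := a # s i))"
  using runs_Seq[OF runs_Up[of i s] runs_Write[of i "\<lambda>t. a"]] by (simp add: push_def numeral_3_eq_3)

lemma runs_copy: "i \<noteq> j \<Longrightarrow> runs (copy i j) s 3 (s(j := top_sym (s i) # s j))"
  using runs_Seq[OF runs_Up[of j s] runs_Write[of j "\<lambda>t. t i"]]
  by (simp add: copy_def numeral_3_eq_3 tops_def)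

lemma runs_eq: "runs c s T u \<Longrightarrow> u = v \<Longrightarrow> T \<le> T' \<Longrightarrow> runs c s T' v"
  using runs_mono by auto

lemma wf_com_push [simp]: "i < n \<Longrightarrow> a < b \<Longrightarrow> wf_com n b (push i a)"
  by (auto simp: push_def bounded_symbol_def)

lemma wf_com_copy [simp]: "j < n \<Longrightarrow> wf_com n b (copy i j)"
  by (auto simp: copy_def bounded_symbol_def)

subsection \<open>Binary trees on stacks\<close>

datatype tree = Leaf | Node tree tree

text \<open>The symbol \<open>3\<close> does not occur in codes, so that it can mark the end of a tree moved to another stack.\<close>

primrec code :: "tree \<Rightarrow> nat list" where
  "code Leaf = [1]"
| "code (Node a b) = 2 # code a @ code b"

definition tsize :: "tree \<Rightarrow> nat" where
  "tsize t = length (code t)"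

lemma tsize_simps [simp]: "tsize Leaf = 1" "tsize (Node a b) = Suc (tsize a + tsize b)"
  by (auto simp: tsize_def)

lemma tsize_pos: "1 \<le> tsize t"
  by (induction t) auto

lemma set_code: "set (code t) \<subseteq> {1, 2}"
  by (induction t) auto

lemma code_neq3 [simp]: "3 \<notin> set (code t)"
  using set_code[of t] by auto

lemma code_append_inject: "code t @ xs = code u @ ys \<longleftrightarrow> t = u \<and> xs = ys"
  by (induction t arbitrary: u xs ys; case_tac u) auto

lemma code_inject [simp]: "code t = code u \<longleftrightarrow> t = u"
  using code_append_inject[of t "[]" u "[]"] by simp

text \<open>The tokens \<open>2\<close> on stack 3 count the trees still to be read.\<close>

definition transfer_loop :: "nat \<Rightarrow> nat \<Rightarrow> com" where
  "transfer_loop i j = Loop (\<lambda>t. t 3 = 2)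
     (Cond (\<lambda>t. t i = 2) (push 3 2) (Pop 3) ;; copy i j ;; Pop i)"

text \<open>The remaining run of the loop is a premise, in continuation style: for
  \<open>Node a b\<close> the same loop goes on with \<open>a\<close> and then with \<open>b\<close>
  and does not end in between. Every symbol costs at most 12 steps.\<close>

lemma runs_transfer_loop:
  assumes "i \<noteq> j" "i \<noteq> 3" "j \<noteq> 3" "s i = code t @ xs" "s 3 = 2 # ys"
    and "runs (transfer_loop i j) (s(i := xs, j := rev (code t) @ s j, 3 := ys)) T s'"
  shows "runs (transfer_loop i j) s (T + 12 * tsize t) s'"
  using assms(4-)
proof (induction t arbitrary: s xs ys T)
  case Leaf
  have "runs (Cond (\<lambda>t. t i = 2) (push 3 2) (Pop 3) ;; copy i j ;; Pop i) s 9
     (s(i := xs, j := 1 # s j, 3 := ys))"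
    apply (rule runs_eq)
      apply (rule runs_Seq)
       apply (rule runs_Cond)
       apply (simp add: tops_def Leaf)
       apply (rule runs_Pop)
      apply (rule runs_Seq)
       apply (rule runs_copy[OF \<open>i \<noteq> j\<close>])
      apply (rule runs_Pop)
    using assms(1-3) Leaf by (auto simp: fun_eq_iff)
  moreover have "runs (transfer_loop i j) (s(i := xs, j := 1 # s j, 3 := ys)) T s'"
    using Leaf.prems(3) by (simp del: fun_upd_apply)
  ultimately have "runs (transfer_loop i j) s (9 + T + 2) s'"
    unfolding transfer_loop_def by (intro runs_Loop_again) (use Leaf in \<open>simp_all add: tops_def\<close>)
  then show ?case by (auto elim: runs_mono)
next
  case (Node a b)
  let ?s = "s(i := code a @ code b @ xs, j := 2 # s j, 3 := 2 # 2 # ys)"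
  have body: "runs (Cond (\<lambda>t. t i = 2) (push 3 2) (Pop 3) ;; copy i j ;; Pop i) s 10 ?s"
    apply (rule runs_eq)
      apply (rule runs_Seq)
       apply (rule runs_Cond)
       apply (simp add: tops_def Node)
       apply (rule runs_push)
      apply (rule runs_Seq)
       apply (rule runs_copy[OF \<open>i \<noteq> j\<close>])
      apply (rule runs_Pop)
    using assms(1-3) Node.prems by (auto simp: fun_eq_iff)
  let ?s' = "s(i := code b @ xs, j := rev (code a) @ 2 # s j, 3 := 2 # ys)"
  have b_eq: "?s'(i := xs, j := rev (code b) @ ?s' j, 3 := ys) = s(i := xs, j := rev (code (Node a b)) @ s j, 3 := ys)"
    and a_eq: "?s(i := code b @ xs, j := rev (code a) @ ?s j, 3 := 2 # ys) = ?s'"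
    using assms(1-3) by (auto simp: fun_eq_iff)
  have rest: "runs (transfer_loop i j) ?s' (T + 12 * tsize b) s'"
    by (rule Node.IH(2)[where xs = xs and ys = ys], unfold b_eq, rule_tac [3] Node.prems(3))
      (use assms(1-3) in simp_all)
  have "runs (transfer_loop i j) ?s (T + 12 * tsize b + 12 * tsize a) s'"
    by (rule Node.IH(1)[where xs = "code b @ xs" and ys = "2 # ys"], unfold a_eq, rule_tac [3] rest)
      (use assms(1-3) in simp_all)
  with body have "runs (transfer_loop i j) s (10 + (T + 12 * tsize b + 12 * tsize a) + 2) s'"
    unfolding transfer_loop_def
    by (intro runs_Loop_again) (use Node in \<open>simp_all add: tops_def\<close>)
  then show ?case by (auto elim: runs_mono)
qed

text \<open>The \<open>3\<close> pushed on stack 3 stops the loop after exactly one tree, whatever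
  tokens lie below; the \<open>3\<close> on stack \<open>j\<close> lets \<open>unstash\<close> and
  \<open>clear\<close> find the end of the tree later.\<close>

definition stash :: "nat \<Rightarrow> nat \<Rightarrow> com" where
  "stash i j = push j 3 ;; push 3 3 ;; push 3 2 ;; transfer_loop i j ;; Pop 3"

lemma runs_stash:
  assumes "i \<noteq> j" "i \<noteq> 3" "j \<noteq> 3" "s i = code t @ xs"
  shows "runs (stash i j) s (30 * tsize t) (s(i := xs, j := rev (code t) @ 3 # s j))"
  unfolding stash_def
  apply (rule runs_eq)
    apply (rule runs_Seq, rule runs_push)
    apply (rule runs_Seq, rule runs_push)
    apply (rule runs_Seq, rule runs_push)
    apply (rule runs_Seq)
     apply (rule runs_transfer_loop[where xs = xs and t = t])
  using assms apply simp_all[5]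
     apply (unfold transfer_loop_def)
     apply (rule runs_Loop_stop)
  using assms apply (simp add: tops_def)
    apply (rule runs_Pop)
  using assms tsize_pos[of t] by (auto simp: fun_eq_iff)

definition unstash :: "nat \<Rightarrow> nat \<Rightarrow> com" where
  "unstash j i = Loop (\<lambda>t. t j \<noteq> 3) (copy j i ;; Pop j) ;; Pop j"

lemma runs_unstash:
  assumes "i \<noteq> j" "s j = xs @ 3 # ys" "3 \<notin> set xs"
  shows "runs (unstash j i) s (7 * length xs + 3) (s(i := rev xs @ s i, j := ys))"
proof -
  have loop: "runs (Loop (\<lambda>t. t j \<noteq> 3) (copy j i ;; Pop j)) s (7 * length xs + 1)
      (s(i := rev xs @ s i, j := 3 # ys))"
    using assms(2,3)
  proof (induction xs arbitrary: s)
    case Nil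
    have "runs (Loop (\<lambda>t. t j \<noteq> 3) (copy j i ;; Pop j)) s 1 s"
      by (rule runs_Loop_stop) (simp add: Nil tops_def)
    then show ?case
      using Nil \<open>i \<noteq> j\<close> by (auto elim!: runs_eq)
  next
    case (Cons x xs)
    have "runs (copy j i ;; Pop j) s 5 (s(i := x # s i, j := xs @ 3 # ys))"
      by (rule runs_eq, rule runs_Seq, rule runs_copy, use \<open>i \<noteq> j\<close> in simp, rule runs_Pop)
        (use \<open>i \<noteq> j\<close> Cons.prems in \<open>auto simp: fun_eq_iff\<close>)
    from runs_Loop_again[OF _ this Cons.IH] show ?case
      using Cons.prems \<open>i \<noteq> j\<close> by (auto simp: tops_def elim!: runs_eq)
  qed
  show ?thesis
    unfolding unstash_def
    by (rule runs_eq, rule runs_Seq, rule loop, rule runs_Pop) (use \<open>i \<noteq> j\<close> in \<open>auto simp: fun_eq_iff\<close>)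
qed

lemma runs_unstash_code:
  assumes "i \<noteq> j" "s j = rev (code t) @ 3 # ys"
  shows "runs (unstash j i) s (10 * tsize t) (s(i := code t @ s i, j := ys))"
  using tsize_pos[of t] assms
  by (intro runs_eq[OF runs_unstash[of i j s "rev (code t)" ys]]) (auto simp: tsize_def)

definition clear :: "nat \<Rightarrow> com" where
  "clear j = Loop (\<lambda>t. t j \<noteq> 3) (Pop j) ;; Pop j"

lemma runs_clear:
  assumes "s j = xs @ 3 # ys" "3 \<notin> set xs"
  shows "runs (clear j) s (3 * length xs + 3) (s(j := ys))"
proof -
  have loop: "runs (Loop (\<lambda>t. t j \<noteq> 3) (Pop j)) s (3 * length xs + 1) (s(j := 3 # ys))"
    using assms
  proof (induction xs arbitrary: s)
    case Nil
    have "runs (Loop (\<lambda>t. t j \<noteq> 3) (Pop j)) s 1 s"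
      by (rule runs_Loop_stop) (simp add: Nil tops_def)
    then show ?case
      using Nil by (auto elim!: runs_eq)
  next
    case (Cons x xs)
    from runs_Loop_again[OF _ runs_Pop[of j s] Cons.IH] show ?case
      using Cons.prems by (auto simp: tops_def elim!: runs_eq)
  qed
  show ?thesis
    unfolding clear_def
    by (rule runs_eq, rule runs_Seq, rule loop, rule runs_Pop) (auto simp: fun_eq_iff)
qed

definition drop_tree :: "nat \<Rightarrow> nat \<Rightarrow> com" where
  "drop_tree i j = stash i j ;; clear j"

lemma runs_drop_tree:
  assumes "i \<noteq> j" "i \<noteq> 3" "j \<noteq> 3" "s i = code t @ xs"
  shows "runs (drop_tree i j) s (40 * tsize t) (s(i := xs))"
  unfolding drop_tree_def
  apply (rule runs_eq, rule runs_Seq, rule runs_stash[where t = t and xs = xs])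
  using assms apply simp_all[4]
    apply (rule runs_clear[of _ _ "rev (code t)"])
  using assms tsize_pos[of t] by (auto simp: fun_eq_iff tsize_def[symmetric])

text \<open>Unloading stack 1 restores the order of the tree on both targets. To reach stack 0 in
  the right order the second copy must be reversed twice, hence the detour through stack 1.\<close>

definition dup :: com where
  "dup = stash 0 1 ;; push 2 3 ;; Loop (\<lambda>t. t 1 \<noteq> 3) (copy 1 0 ;; copy 1 2 ;; Pop 1) ;; Pop 1 ;;
     push 1 3 ;; unstash 2 1 ;; unstash 1 0"

lemma runs_dup:
  assumes "s 0 = code t @ xs"
  shows "runs dup s (100 * tsize t) (s(0 := code t @ code t @ xs))"
proof -
  have loop: "runs (Loop (\<lambda>t. t 1 \<noteq> 3) (copy 1 0 ;; copy 1 2 ;; Pop 1)) s (11 * length xs + 1)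
      (s(0 := rev xs @ s 0, 2 := rev xs @ s 2, 1 := 3 # ys))"
    if "s 1 = xs @ 3 # ys" "3 \<notin> set xs" for s xs ys
    using that
  proof (induction xs arbitrary: s)
    case Nil
    have "runs (Loop (\<lambda>t. t 1 \<noteq> 3) (copy 1 0 ;; copy 1 2 ;; Pop 1)) s 1 s"
      by (rule runs_Loop_stop) (use Nil in \<open>simp add: tops_def\<close>)
    then show ?case
      using Nil by (auto elim!: runs_eq)
  next
    case (Cons x xs)
    have "runs (copy 1 0 ;; copy 1 2 ;; Pop 1) s 9 (s(0 := x # s 0, 2 := x # s 2, 1 := xs @ 3 # ys))"
      by (rule runs_eq, rule runs_Seq, rule runs_copy, simp, rule runs_Seq, rule runs_copy, simp,
          rule runs_Pop) (use Cons.prems in \<open>auto simp: fun_eq_iff\<close>)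
    from runs_Loop_again[OF _ this Cons.IH] show ?case
      using Cons.prems by (auto simp: tops_def fun_upd_twist elim!: runs_eq)
  qed
  show ?thesis
    unfolding dup_def
    apply (rule runs_eq)
      apply (rule runs_Seq, rule runs_stash[of _ _ _ t xs], simp, simp, simp, rule assms)
      apply (rule runs_Seq, rule runs_push)
      apply (rule runs_Seq, rule loop[where xs = "rev (code t)" and ys = "s 1"], simp, simp)
      apply (rule runs_Seq, rule runs_Pop)
      apply (rule runs_Seq, rule runs_push)
      apply (rule runs_Seq, rule runs_unstash[of _ _ _ "code t" "s 2"], simp, simp, simp)
      apply (rule runs_unstash_code[of _ _ _ t "s 1"], simp, simp)
     apply (use assms in \<open>auto simp: fun_eq_iff\<close>)[1]
    using tsize_pos[of t] by (simp add: tsize_def)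
qed

lemma wf_com_programs [simp]:
  "i < 4 \<Longrightarrow> j < 4 \<Longrightarrow> wf_com 4 4 (transfer_loop i j)"
  "i < 4 \<Longrightarrow> j < 4 \<Longrightarrow> wf_com 4 4 (stash i j)"
  "i < 4 \<Longrightarrow> j < 4 \<Longrightarrow> wf_com 4 4 (unstash i j)"
  "j < 4 \<Longrightarrow> wf_com 4 4 (clear j)"
  "i < 4 \<Longrightarrow> j < 4 \<Longrightarrow> wf_com 4 4 (drop_tree i j)"
  "wf_com 4 4 dup"
  by (simp_all add: transfer_loop_def stash_def unstash_def clear_def drop_tree_def dup_def)

subsection \<open>Encodable types and polynomially bounded quantities\<close>

class enc =
  fixes enc :: "'a \<Rightarrow> tree"
  assumes enc_inject [simp]: "enc x = enc y \<longleftrightarrow> x = y"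

instantiation tree :: enc
begin
definition enc_tree :: "tree \<Rightarrow> tree" where [simp]: "enc_tree t = t"
instance by standard simp
end

instantiation unit :: enc
begin
definition enc_unit :: "unit \<Rightarrow> tree" where [simp]: "enc_unit t = Leaf"
instance by standard simp
end

instantiation bool :: enc
begin
definition enc_bool :: "bool \<Rightarrow> tree" where [simp]: "enc_bool b = (if b then Node Leaf Leaf else Leaf)"
instance by standard simp
end

instantiation nat :: enc
begin
primrec enc_nat :: "nat \<Rightarrow> tree" where
  "enc_nat 0 = Leaf"
| "enc_nat (Suc n) = Node Leaf (enc_nat n)"
instance
proof
  show "enc x = enc y \<longleftrightarrow> x = y" for x y :: nat
    by (induction x arbitrary: y; case_tac y) auto
qed
end

instantiation prod :: (enc, enc) enc
begin
definition enc_prod :: "'a \<times> 'b \<Rightarrow> tree" where "enc_prod p = Node (enc (fst p)) (enc (snd p))"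
instance by standard (auto simp: enc_prod_def prod_eq_iff)
end

lemma enc_Pair [simp]: "enc (x, y) = Node (enc x) (enc y)"
  by (simp add: enc_prod_def)

instantiation list :: (enc) enc
begin
primrec enc_list :: "'a list \<Rightarrow> tree" where
  "enc_list [] = Leaf"
| "enc_list (x # xs) = Node (enc x) (enc_list xs)"
instance
proof
  show "enc x = enc y \<longleftrightarrow> x = y" for x y :: "'a list"
    by (induction x arbitrary: y; case_tac y) auto
qed
end

definition sz :: "'a::enc \<Rightarrow> nat" where
  "sz x = tsize (enc x)"

lemma sz_simps [simp]:
  "sz (a, b) = Suc (sz a + sz b)" "sz [] = 1" "sz (x # xs) = Suc (sz x + sz xs)"
  "sz (0 :: nat) = 1" "sz (Suc n) = sz n + 2" "sz () = 1" "sz True = 3" "sz False = 1"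
  for a :: "'a::enc" and b :: "'b::enc"
  by (auto simp: sz_def)

lemma sz_pos: "1 \<le> sz x"
  using tsize_pos by (simp add: sz_def)

lemma sz_nat: "sz (n :: nat) = 2 * n + 1"
  by (induction n) auto

lemma sz_list: "sz xs = Suc (\<Sum>x\<leftarrow>xs. Suc (sz x))"
  by (induction xs) auto

lemma length_le_sz: "length xs \<le> sz xs"
  by (induction xs) auto

lemma sz_mem: "x \<in> set xs \<Longrightarrow> sz x < sz xs"
  by (induction xs) auto

text \<open>A single power suffices as a normal form for polynomial bounds: its base is at least 2,
  so constants and sums are absorbed by the exponent.\<close>

definition pbd :: "('a::enc \<Rightarrow> nat) \<Rightarrow> bool" where
  "pbd g \<longleftrightarrow> (\<exists>k. \<forall>x. g x \<le> (sz x + 2) ^ k)"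

lemma pbd_mono: "pbd g \<Longrightarrow> (\<And>x. f x \<le> g x) \<Longrightarrow> pbd f"
  unfolding pbd_def by (meson le_trans)

lemma pbd_const [intro]: "pbd (\<lambda>x. c)"
  unfolding pbd_def
proof (intro exI allI)
  fix x :: 'a
  have "c < 2 ^ c" by simp
  also have "\<dots> \<le> (sz x + 2) ^ c" by (intro power_mono) auto
  finally show "c \<le> (sz x + 2) ^ c" by simp
qed

lemma pbd_sz [intro]: "pbd sz"
  unfolding pbd_def by (rule exI[of _ 1]) simp

lemma pbd_mult [intro]: "pbd f \<Longrightarrow> pbd g \<Longrightarrow> pbd (\<lambda>x. f x * g x)"
  unfolding pbd_def by (metis mult_le_mono power_add)

lemma pbd_add [intro]:
  assumes "pbd f" "pbd g"
  shows "pbd (\<lambda>x. f x + g x)"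
proof -
  obtain k l where kl: "\<And>x. f x \<le> (sz x + 2) ^ k" "\<And>x. g x \<le> (sz x + 2) ^ l"
    using assms by (auto simp: pbd_def)
  have "f x + g x \<le> (sz x + 2) ^ Suc (k + l)" for x
  proof -
    let ?m = "sz x + 2"
    have "f x + g x \<le> ?m ^ k + ?m ^ l" using kl by (simp add: add_mono)
    also have "\<dots> \<le> ?m ^ (k + l) + ?m ^ (k + l)" by (intro add_mono power_increasing) auto
    also have "\<dots> = 2 * ?m ^ (k + l)" by simp
    also have "\<dots> \<le> ?m * ?m ^ (k + l)" by (intro mult_right_mono) auto
    finally show ?thesis by simp
  qed
  then show ?thesis unfolding pbd_def by blast
qed

lemma pbd_Suc [intro]: "pbd f \<Longrightarrow> pbd (\<lambda>x. Suc (f x))"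
  using pbd_add[of f "\<lambda>x. 1"] by auto

lemma pbd_power [intro]: "pbd f \<Longrightarrow> pbd (\<lambda>x. f x ^ k)"
  by (induction k) auto

lemma pbd_compose:
  assumes "pbd g" "pbd (\<lambda>x. sz (f x))"
  shows "pbd (\<lambda>x. g (f x))"
proof -
  obtain k where "\<And>x. g x \<le> (sz x + 2) ^ k"
    using assms by (auto simp: pbd_def)
  moreover have "pbd (\<lambda>x. (sz (f x) + 2) ^ k)" using assms by (intro pbd_power pbd_add) auto
  ultimately show ?thesis by (auto elim: pbd_mono)
qed

subsection \<open>Closure properties of polynomial time\<close>

text \<open>The other stacks and everything below the argument are restored, so a program can run
  while further data are parked on the stacks; composition, pairing and folding rest on
  this.\<close>

definition computes :: "com \<Rightarrow> ('a::enc \<Rightarrow> 'b::enc) \<Rightarrow> ('a \<Rightarrow> nat) \<Rightarrow> bool" where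
  "computes c f T \<longleftrightarrow> wf_com 4 4 c \<and>
     (\<forall>x s r. s 0 = code (enc x) @ r \<longrightarrow> runs c s (T x) (s(0 := code (enc (f x)) @ r)))"

text \<open>The size of the output belongs to the definition because the time of a composition is
  bounded through the intermediate result.\<close>

definition ptime :: "('a::enc \<Rightarrow> 'b::enc) \<Rightarrow> bool" where
  "ptime f \<longleftrightarrow> pbd (\<lambda>x. sz (f x)) \<and> (\<exists>c T. pbd T \<and> computes c f T)"

named_theorems ptime_intros

lemma ptime_pbd: "ptime f \<Longrightarrow> pbd (\<lambda>x. sz (f x))"
  by (simp add: ptime_def)

lemma ptimeE:
  assumes "ptime f"
  obtains c T where "pbd T" "computes c f T"
  using assms by (auto simp: ptime_def)

lemma computes_wf: "computes c f T \<Longrightarrow> wf_com 4 4 c"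
  by (simp add: computes_def)

lemma computesD:
  "computes c f T \<Longrightarrow> s 0 = code (enc x) @ r \<Longrightarrow> runs c s (T x) (s(0 := code (enc (f x)) @ r))"
  by (simp add: computes_def)

lemma computesI:
  assumes "wf_com 4 4 c"
    and "\<And>x s r. s 0 = code (enc x) @ r \<Longrightarrow> runs c s (T x) (s(0 := code (enc (f x)) @ r))"
  shows "computes c f T"
  using assms by (simp add: computes_def)

lemma ptimeI: "pbd (\<lambda>x. sz (f x)) \<Longrightarrow> pbd T \<Longrightarrow> computes c f T \<Longrightarrow> ptime f"
  by (auto simp: ptime_def)

lemma ptime_recode: "(\<And>x. enc (f x) = enc x) \<Longrightarrow> ptime f"
  by (rule ptimeI[of _ "\<lambda>x. 0" Skip])
    (auto simp: sz_def[of "f _"] sz_def[symmetric] intro!: computesI runs_eq[OF runs_Skip])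

lemma ptime_id [ptime_intros]: "ptime (\<lambda>x. x)"
  by (rule ptime_recode) simp

text \<open>Programs see only trees, so a program for \<open>F\<close> serves for every function
  that \<open>F\<close> represents; projections, tails and predecessors all come from the two
  subtree functions.\<close>

lemma ptime_transfer:
  fixes F :: "tree \<Rightarrow> tree" and f :: "'a::enc \<Rightarrow> 'b::enc"
  assumes "ptime F" "\<And>x. F (enc x) = enc (f x)"
  shows "ptime f"
proof -
  obtain c T where c: "pbd T" "computes c F T" using assms(1) by (rule ptimeE)
  have sz: "sz (enc x) = sz x" for x :: 'a by (simp add: sz_def)
  have "pbd (\<lambda>x::'a. sz (enc x))" by (simp add: sz pbd_sz)
  note enc = pbd_compose[OF _ this]
  show ?thesis
  proof (rule ptimeI)
    show "pbd (\<lambda>x::'a. T (enc x))" using enc[OF c(1)] .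
    show "pbd (\<lambda>x. sz (f x))"
      using enc[OF ptime_pbd[OF assms(1)]] by (simp add: assms(2) sz_def)
    show "computes c f (\<lambda>x. T (enc x))"
      using c(2) by (auto simp: computes_def assms(2)[symmetric])
  qed
qed

lemma ptime_comp:
  fixes f :: "'a::enc \<Rightarrow> 'b::enc" and g :: "'b \<Rightarrow> 'c::enc"
  assumes "ptime g" "ptime f"
  shows "ptime (\<lambda>x. g (f x))"
proof -
  obtain c T where c: "pbd T" "computes c f T" using assms(2) by (rule ptimeE)
  obtain d U where d: "pbd U" "computes d g U" using assms(1) by (rule ptimeE)
  show ?thesis
  proof (rule ptimeI)
    show "pbd (\<lambda>x. sz (g (f x)))"
      using pbd_compose[OF ptime_pbd[OF assms(1)] ptime_pbd[OF assms(2)]] .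
    show "pbd (\<lambda>x. T x + U (f x) + 1)"
      using pbd_compose[OF d(1) ptime_pbd[OF assms(2)]] c(1) by auto
    show "computes (c ;; d) (\<lambda>x. g (f x)) (\<lambda>x. T x + U (f x) + 1)"
    proof (rule computesI)
      fix x :: 'a and s :: store and r assume s: "s 0 = code (enc x) @ r"
      show "runs (c ;; d) s (T x + U (f x) + 1) (s(0 := code (enc (g (f x))) @ r))"
        by (rule runs_eq, rule runs_Seq, rule computesD[OF c(2), where x = x and r = r], rule s,
            rule computesD[OF d(2), where x = "f x" and r = r]) auto
    qed (simp add: computes_wf[OF c(2)] computes_wf[OF d(2)])
  qed
qed

lemma ptime_pair [ptime_intros]:
  fixes f :: "'a::enc \<Rightarrow> 'b::enc" and g :: "'a \<Rightarrow> 'c::enc"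
  assumes "ptime f" "ptime g"
  shows "ptime (\<lambda>x. (f x, g x))"
proof -
  obtain c T where c: "pbd T" "computes c f T" using assms(1) by (rule ptimeE)
  obtain d U where d: "pbd U" "computes d g U" using assms(2) by (rule ptimeE)
  note sizes = ptime_pbd[OF assms(1)] ptime_pbd[OF assms(2)]
  show ?thesis
  proof (rule ptimeI)
    show "pbd (\<lambda>x. sz (f x, g x))"
      using sizes by auto
    show "pbd (\<lambda>x. 100 * sz x + T x + 30 * sz (f x) + U x + 10 * sz (f x) + 10)"
      using sizes c(1) d(1) by (intro pbd_add pbd_mult pbd_const pbd_sz)
    show "computes (dup ;; c ;; stash 0 1 ;; d ;; unstash 1 0 ;; push 0 2) (\<lambda>x. (f x, g x))
        (\<lambda>x. 100 * sz x + T x + 30 * sz (f x) + U x + 10 * sz (f x) + 10)"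
    proof (rule computesI)
      fix x :: 'a and s :: store and r assume s: "s 0 = code (enc x) @ r"
      show "runs (dup ;; c ;; stash 0 1 ;; d ;; unstash 1 0 ;; push 0 2) s
          (100 * sz x + T x + 30 * sz (f x) + U x + 10 * sz (f x) + 10)
          (s(0 := code (enc (f x, g x)) @ r))"
        unfolding sz_def
        apply (rule runs_eq)
          apply (rule runs_Seq, rule runs_dup, rule s)
          apply (rule runs_Seq, rule computesD[OF c(2), where x = x and r = "code (enc x) @ r"], simp)
          apply (rule runs_Seq, rule runs_stash[where t = "enc (f x)" and xs = "code (enc x) @ r"],
              simp, simp, simp, simp)
          apply (rule runs_Seq, rule computesD[OF d(2), where x = x and r = r], simp)
          apply (rule runs_Seq, rule runs_unstash_code[where t = "enc (f x)" and ys = "s 1"], simp, simp)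
          apply (rule runs_push)
         apply (auto simp: fun_eq_iff)
        done
    qed (simp add: computes_wf[OF c(2)] computes_wf[OF d(2)])
  qed
qed

lemma ptime_const_tree: "ptime (\<lambda>x. t :: tree)"
proof (induction t)
  case Leaf
  show ?case
  proof (rule ptimeI)
    show "pbd (\<lambda>x::'a. 40 * sz x + 4)" by (intro pbd_add pbd_mult pbd_const pbd_sz)
    show "computes (drop_tree 0 1 ;; push 0 1) (\<lambda>x. Leaf) (\<lambda>x::'a. 40 * sz x + 4)"
    proof (rule computesI)
      fix x :: 'a and s :: store and r assume s: "s 0 = code (enc x) @ r"
      show "runs (drop_tree 0 1 ;; push 0 1) s (40 * sz x + 4) (s(0 := code (enc Leaf) @ r))"
        unfolding sz_def
        by (rule runs_eq, rule runs_Seq, rule runs_drop_tree[where t = "enc x" and xs = r], simp, simp, simp, rule s, rule runs_push) auto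
    qed auto
  qed auto
next
  case (Node a b)
  have "ptime (\<lambda>x::'a. (a, b))" using Node by (rule ptime_pair)
  from ptime_comp[OF ptime_recode this, of "\<lambda>(a, b). Node a b"] show ?case
    by auto
qed

lemma ptime_const [ptime_intros]: "ptime (\<lambda>x. c)"
  by (rule ptime_transfer[OF ptime_const_tree]) simp

definition left_subtree :: "tree \<Rightarrow> tree" where
  "left_subtree t = (case t of Leaf \<Rightarrow> Leaf | Node a b \<Rightarrow> a)"

definition right_subtree :: "tree \<Rightarrow> tree" where
  "right_subtree t = (case t of Leaf \<Rightarrow> Leaf | Node a b \<Rightarrow> b)"

lemma ptime_left_subtree: "ptime left_subtree"
proof (rule ptimeI)
  show "pbd (\<lambda>x. sz (left_subtree x))"
    by (rule pbd_mono[OF pbd_sz]) (auto simp: left_subtree_def sz_def split: tree.splits)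
  show "pbd (\<lambda>x::tree. 100 * sz x)" by auto
  let ?c = "Cond (\<lambda>t. t 0 = 2) (Pop 0 ;; stash 0 1 ;; drop_tree 0 1 ;; unstash 1 0) Skip"
  show "computes ?c left_subtree (\<lambda>x. 100 * sz x)"
  proof (rule computesI)
    fix x :: tree and s :: store and r assume s: "s 0 = code (enc x) @ r"
    show "runs ?c s (100 * sz x) (s(0 := code (enc (left_subtree x)) @ r))"
    proof (cases x)
      case Leaf
      then have "s(0 := code (enc (left_subtree x)) @ r) = s"
        using s by (auto simp: left_subtree_def)
      then show ?thesis
        using Leaf s by (intro runs_eq[OF runs_Cond]) (auto simp: tops_def sz_def intro: runs_Skip[of _ 0])
    next
      case (Node a b)
      have "runs (Pop 0 ;; stash 0 1 ;; drop_tree 0 1 ;; unstash 1 0) s (99 * sz x)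
          (s(0 := code (enc (left_subtree x)) @ r))"
        unfolding sz_def
        apply (rule runs_eq)
          apply (rule runs_Seq, rule runs_Pop)
          apply (rule runs_Seq, rule runs_stash[where t = a and xs = "code b @ r"], simp, simp, simp,
              simp add: s Node)
          apply (rule runs_Seq, rule runs_drop_tree[where t = b and xs = r], simp, simp, simp, simp)
          apply (rule runs_unstash_code[where t = a and ys = "s 1"], simp, simp)
        by (auto simp: fun_eq_iff Node left_subtree_def)
      then show ?thesis
        using Node s sz_pos[of x] by (intro runs_eq[OF runs_Cond[where s = s]]) (auto simp: tops_def)
    qed
  qed auto
qed

lemma ptime_right_subtree: "ptime right_subtree"
proof (rule ptimeI)
  show "pbd (\<lambda>x. sz (right_subtree x))"
    by (rule pbd_mono[OF pbd_sz]) (auto simp: right_subtree_def sz_def split: tree.splits)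
  show "pbd (\<lambda>x::tree. 100 * sz x)" by auto
  let ?c = "Cond (\<lambda>t. t 0 = 2) (Pop 0 ;; drop_tree 0 1) Skip"
  show "computes ?c right_subtree (\<lambda>x. 100 * sz x)"
  proof (rule computesI)
    fix x :: tree and s :: store and r assume s: "s 0 = code (enc x) @ r"
    show "runs ?c s (100 * sz x) (s(0 := code (enc (right_subtree x)) @ r))"
    proof (cases x)
      case Leaf
      then have "s(0 := code (enc (right_subtree x)) @ r) = s"
        using s by (auto simp: right_subtree_def)
      then show ?thesis
        using Leaf s by (intro runs_eq[OF runs_Cond]) (auto simp: tops_def sz_def intro: runs_Skip[of _ 0])
    next
      case (Node a b)
      have "runs (Pop 0 ;; drop_tree 0 1) s (99 * sz x) (s(0 := code (enc (right_subtree x)) @ r))"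
        unfolding sz_def
        apply (rule runs_eq)
          apply (rule runs_Seq, rule runs_Pop)
          apply (rule runs_drop_tree[where t = a and xs = "code b @ r"], simp, simp, simp,
              simp add: s Node)
        by (auto simp: fun_eq_iff Node right_subtree_def)
      then show ?thesis
        using Node s sz_pos[of x] by (intro runs_eq[OF runs_Cond[where s = s]]) (auto simp: tops_def)
    qed
  qed auto
qed

definition compare_loop :: com where
  "compare_loop = Loop (\<lambda>t. t 1 = t 2 \<and> t 1 \<noteq> 3) (Pop 1 ;; Pop 2)"

text \<open>The loop stops at the first difference or when both lists have reached their markers. As
  3 occurs in neither list, equal tops mean the latter. The remainders appear in the statement
  because they still have to be cleared.\<close>

lemma runs_compare_loop:
  assumes "s 1 = xs @ 3 # us" "s 2 = ys @ 3 # vs" "3 \<notin> set xs" "3 \<notin> set ys"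
  obtains xs' ys' where
    "runs compare_loop s (5 * length xs + 1) (s(1 := xs' @ 3 # us, 2 := ys' @ 3 # vs))"
    "3 \<notin> set xs'" "3 \<notin> set ys'" "length xs' \<le> length xs" "length ys' \<le> length ys"
    "top_sym (xs' @ 3 # us) = top_sym (ys' @ 3 # vs) \<longleftrightarrow> xs = ys"
proof -
  have "\<exists>xs' ys'. runs compare_loop s (5 * length xs + 1) (s(1 := xs' @ 3 # us, 2 := ys' @ 3 # vs)) \<and>
    3 \<notin> set xs' \<and> 3 \<notin> set ys' \<and> length xs' \<le> length xs \<and> length ys' \<le> length ys \<and>
    (top_sym (xs' @ 3 # us) = top_sym (ys' @ 3 # vs) \<longleftrightarrow> xs = ys)"
    using assms
  proof (induction xs arbitrary: ys s)
    case Nil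
    have "runs compare_loop s 1 s"
      unfolding compare_loop_def by (rule runs_Loop_stop) (use Nil(1) in \<open>simp add: tops_def\<close>)
    moreover have "s(1 := [] @ 3 # us, 2 := ys @ 3 # vs) = s"
      using Nil by (auto simp: fun_eq_iff)
    ultimately have "runs compare_loop s 1 (s(1 := [] @ 3 # us, 2 := ys @ 3 # vs))"
      by metis
    moreover have "top_sym ([] @ 3 # us) = top_sym (ys @ 3 # vs) \<longleftrightarrow> [] = ys"
      using Nil by (cases ys) auto
    ultimately show ?case
      using Nil by (rule_tac exI[of _ "[]"], rule_tac exI[of _ ys]) (simp del: fun_upd_apply)
  next
    case (Cons x xs)
    show ?case
    proof (cases "\<exists>ys'. ys = x # ys'")
      case True
      then obtain ys' where ys: "ys = x # ys'" by blast
      let ?s = "s(1 := xs @ 3 # us, 2 := ys' @ 3 # vs)"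
      have body: "runs (Pop 1 ;; Pop 2) s 3 ?s"
        by (rule runs_eq, rule runs_Seq, rule runs_Pop, rule runs_Pop) (use Cons.prems ys in \<open>auto simp: fun_eq_iff\<close>)
      obtain xs'' ys'' where IH:
        "runs compare_loop ?s (5 * length xs + 1) (?s(1 := xs'' @ 3 # us, 2 := ys'' @ 3 # vs))"
        "3 \<notin> set xs''" "3 \<notin> set ys''" "length xs'' \<le> length xs" "length ys'' \<le> length ys'"
        "top_sym (xs'' @ 3 # us) = top_sym (ys'' @ 3 # vs) \<longleftrightarrow> xs = ys'"
      proof -
        have "?s 1 = xs @ 3 # us" "?s 2 = ys' @ 3 # vs" "3 \<notin> set xs" "3 \<notin> set ys'"
          using Cons.prems ys by auto
        from Cons.IH[OF this] show ?thesis using that by blast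
      qed
      have "runs compare_loop s (3 + (5 * length xs + 1) + 2) (?s(1 := xs'' @ 3 # us, 2 := ys'' @ 3 # vs))"
        unfolding compare_loop_def
        by (rule runs_Loop_again[OF _ body IH(1)[unfolded compare_loop_def]])
          (use Cons.prems ys in \<open>auto simp: tops_def\<close>)
      moreover have "?s(1 := xs'' @ 3 # us, 2 := ys'' @ 3 # vs) = s(1 := xs'' @ 3 # us, 2 := ys'' @ 3 # vs)"
        by (auto simp: fun_eq_iff)
      ultimately show ?thesis
        using IH(2-) ys
        by (rule_tac exI[of _ xs''], rule_tac exI[of _ ys'']) (auto elim: runs_mono simp del: fun_upd_apply)
    next
      case False
      then have top: "top_sym (ys @ 3 # vs) \<noteq> x"
        using Cons.prems by (cases ys) auto
      have "runs compare_loop s 1 s"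
        unfolding compare_loop_def by (rule runs_Loop_stop) (use Cons.prems top in \<open>auto simp: tops_def\<close>)
      moreover have "s(1 := (x # xs) @ 3 # us, 2 := ys @ 3 # vs) = s"
        using Cons.prems by (auto simp: fun_eq_iff)
      ultimately show ?thesis
        using Cons.prems top False
        by (rule_tac exI[of _ "x # xs"], rule_tac exI[of _ ys])
          (auto elim: runs_mono simp del: fun_upd_apply)
    qed
  qed
  then show ?thesis using that by blast
qed

definition tree_eq :: "tree \<Rightarrow> tree" where
  "tree_eq t = (case t of Leaf \<Rightarrow> Leaf | Node a b \<Rightarrow> enc (a = b))"

lemma ptime_tree_eq: "ptime tree_eq"
proof (rule ptimeI)
  show "pbd (\<lambda>x. sz (tree_eq x))"
    by (rule pbd_mono[of "\<lambda>x. 3"]) (auto simp: tree_eq_def sz_def split: tree.splits)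
  show "pbd (\<lambda>x::tree. 200 * sz x)" by auto
  let ?pop = "clear 1 ;; clear 2"
  let ?body = "Pop 0 ;; stash 0 1 ;; stash 0 2 ;; compare_loop ;;
      Cond (\<lambda>t. t 1 = t 2) (?pop ;; push 0 1 ;; push 0 1 ;; push 0 2) (?pop ;; push 0 1)"
  let ?c = "Cond (\<lambda>t. t 0 = 2) ?body Skip"
  show "computes ?c tree_eq (\<lambda>x. 200 * sz x)"
  proof (rule computesI)
    fix x :: tree and s :: store and r assume s: "s 0 = code (enc x) @ r"
    show "runs ?c s (200 * sz x) (s(0 := code (enc (tree_eq x)) @ r))"
    proof (cases x)
      case Leaf
      then have "s(0 := code (enc (tree_eq x)) @ r) = s"
        using s by (auto simp: tree_eq_def)
      then show ?thesis
        using Leaf s by (intro runs_eq[OF runs_Cond]) (auto simp: tops_def sz_def intro: runs_Skip[of _ 0])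
    next
      case (Node a b)
      let ?s = "s(0 := r, 1 := rev (code a) @ 3 # s 1, 2 := rev (code b) @ 3 # s 2)"
      obtain xs ys where cmp:
        "runs compare_loop ?s (5 * length (rev (code a)) + 1) (?s(1 := xs @ 3 # s 1, 2 := ys @ 3 # s 2))"
        "3 \<notin> set xs" "3 \<notin> set ys" "length xs \<le> length (rev (code a))" "length ys \<le> length (rev (code b))"
        "top_sym (xs @ 3 # s 1) = top_sym (ys @ 3 # s 2) \<longleftrightarrow> rev (code a) = rev (code b)"
        by (rule runs_compare_loop[of ?s "rev (code a)" "s 1" "rev (code b)" "s 2"])
          (simp, simp, simp, simp, rule that)
      let ?s1 = "?s(1 := xs @ 3 # s 1, 2 := ys @ 3 # s 2)"
      have pop: "runs ?pop ?s1 (3 * length xs + 3 * length ys + 7) (s(0 := r))"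
        apply (rule runs_eq)
          apply (rule runs_Seq, rule runs_clear[of _ _ xs "s 1"], simp, rule cmp)
          apply (rule runs_clear[of _ _ ys "s 2"], simp, rule cmp)
        by (auto simp: fun_eq_iff)
      have fin: "runs (Cond (\<lambda>t. t 1 = t 2) (?pop ;; push 0 1 ;; push 0 1 ;; push 0 2) (?pop ;; push 0 1))
         ?s1 (3 * length xs + 3 * length ys + 20) (s(0 := code (enc (tree_eq x)) @ r))"
      proof (cases "a = b")
        case True
        show ?thesis
          apply (rule runs_eq, rule runs_Cond)
            apply (subst if_P)
          subgoal using True cmp(6) by (simp add: tops_def)
            apply (rule runs_Seq, rule pop)
            apply (rule runs_Seq, rule runs_push)
            apply (rule runs_Seq, rule runs_push, rule runs_push)
          using True by (auto simp: tree_eq_def Node)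
      next
        case False
        show ?thesis
          apply (rule runs_eq, rule runs_Cond)
            apply (subst if_not_P)
          subgoal using False cmp(6) by (simp add: tops_def)
            apply (rule runs_Seq, rule pop)
            apply (rule runs_push)
          using False by (auto simp: tree_eq_def Node)
      qed
      have "runs ?body s (199 * sz x) (s(0 := code (enc (tree_eq x)) @ r))"
        apply (rule runs_eq)
          apply (rule runs_Seq, rule runs_Pop)
          apply (rule runs_Seq, rule runs_stash[where t = a and xs = "code b @ r"], simp, simp, simp,
              simp add: s Node)
          apply (rule runs_Seq, rule runs_eq[where v = ?s],
              rule runs_stash[where t = b and xs = r], simp, simp, simp, simp)
          apply (simp add: fun_eq_iff)
          apply (rule order_refl)
          apply (rule runs_Seq, rule cmp, rule fin)
        using cmp(4,5) tsize_pos[of a] tsize_pos[of b] by (auto simp: Node sz_def tsize_def)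
      then show ?thesis
        using Node s sz_pos[of x] by (intro runs_eq[OF runs_Cond[where s = s]]) (auto simp: tops_def)
    qed
  qed (simp add: compare_loop_def)
qed

lemma ptime_comp2:
  assumes "ptime (\<lambda>p. h (fst p) (snd p))" "ptime f" "ptime g"
  shows "ptime (\<lambda>x. h (f x) (g x))"
  using ptime_comp[OF assms(1) ptime_pair[OF assms(2,3)]] by simp

lemma ptime_fst [ptime_intros]: "ptime f \<Longrightarrow> ptime (\<lambda>x. fst (f x))"
  by (rule ptime_comp[OF ptime_transfer[OF ptime_left_subtree]])
    (auto simp: left_subtree_def enc_prod_def)

lemma ptime_snd [ptime_intros]: "ptime f \<Longrightarrow> ptime (\<lambda>x. snd (f x))"
  by (rule ptime_comp[OF ptime_transfer[OF ptime_right_subtree]])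
    (auto simp: right_subtree_def enc_prod_def)

lemma ptime_tl [ptime_intros]:
  fixes f :: "'a::enc \<Rightarrow> 'b::enc list"
  shows "ptime f \<Longrightarrow> ptime (\<lambda>x. tl (f x))"
proof (rule ptime_comp[of tl, OF ptime_transfer[OF ptime_right_subtree]])
  show "right_subtree (enc xs) = enc (tl xs)" for xs :: "'b list"
    by (cases xs) (auto simp: right_subtree_def)
qed

lemma ptime_pred [ptime_intros]: "ptime f \<Longrightarrow> ptime (\<lambda>x. f x - Suc 0)"
proof (rule ptime_comp[of "\<lambda>n. n - Suc 0", OF ptime_transfer[OF ptime_right_subtree]])
  show "right_subtree (enc n) = enc (n - Suc 0)" for n
    by (cases n) (auto simp: right_subtree_def)
qed

lemma ptime_Cons [ptime_intros]: "ptime f \<Longrightarrow> ptime g \<Longrightarrow> ptime (\<lambda>x. f x # g x)"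
  by (rule ptime_comp2[of "(#)"]) (auto intro!: ptime_recode simp: enc_prod_def)

lemma ptime_Suc [ptime_intros]: "ptime f \<Longrightarrow> ptime (\<lambda>x. Suc (f x))"
  using ptime_comp2[of "\<lambda>(u::unit) n. Suc n", OF ptime_recode ptime_const]
  by (auto simp: enc_prod_def)

text \<open>A number and a list of that many units are the same tree, so counted iteration is an
  instance of folding over a list.\<close>

lemma enc_replicate_unit: "enc (replicate n ()) = enc n"
  by (induction n) auto

lemma ptime_replicate_unit [ptime_intros]: "ptime f \<Longrightarrow> ptime (\<lambda>x. replicate (f x) ())"
  by (rule ptime_comp[OF ptime_recode]) (simp add: enc_replicate_unit)

lemma ptime_eq [ptime_intros]: "ptime f \<Longrightarrow> ptime g \<Longrightarrow> ptime (\<lambda>x. f x = g x)"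
  by (rule ptime_comp2[of "(=)"], rule ptime_transfer[OF ptime_tree_eq])
    (auto simp: enc_prod_def tree_eq_def)

lemma ptime_If [ptime_intros]:
  fixes P :: "'a::enc \<Rightarrow> bool" and f g :: "'a \<Rightarrow> 'b::enc"
  assumes "ptime P" "ptime f" "ptime g"
  shows "ptime (\<lambda>x. if P x then f x else g x)"
proof -
  obtain b S where b: "pbd S" "computes b P S" using assms(1) by (rule ptimeE)
  obtain c T where c: "pbd T" "computes c f T" using assms(2) by (rule ptimeE)
  obtain d U where d: "pbd U" "computes d g U" using assms(3) by (rule ptimeE)
  note sizes = ptime_pbd[OF assms(2)] ptime_pbd[OF assms(3)]
  let ?T = "\<lambda>x. 100 * sz x + S x + T x + U x + 130"
  \<comment> \<open>The code of \<open>True\<close> starts with 2 and that of \<open>False\<close>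
    is the leaf 1, so the top symbol decides the branch.\<close>
  let ?c = "dup ;; b ;; Cond (\<lambda>t. t 0 = 2) (drop_tree 0 1 ;; c) (drop_tree 0 1 ;; d)"
  show ?thesis
  proof (rule ptimeI)
    show "pbd (\<lambda>x. sz (if P x then f x else g x))"
      by (rule pbd_mono[OF pbd_add[OF sizes]]) simp
    show "pbd ?T"
      using b(1) c(1) d(1) by (intro pbd_add pbd_mult pbd_const pbd_sz)
    show "computes ?c (\<lambda>x. if P x then f x else g x) ?T"
    proof (rule computesI)
      fix x :: 'a and s :: store and r assume s: "s 0 = code (enc x) @ r"
      let ?s = "s(0 := code (enc (P x)) @ code (enc x) @ r)"
      have cond: "runs (Cond (\<lambda>t. t 0 = 2) (drop_tree 0 1 ;; c) (drop_tree 0 1 ;; d)) ?s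
          (T x + U x + 125) (s(0 := code (enc (if P x then f x else g x)) @ r))"
      proof (cases "P x")
        case True
        have "runs (drop_tree 0 1 ;; c) ?s (T x + U x + 124) (s(0 := code (enc (f x)) @ r))"
          apply (rule runs_eq, rule runs_Seq)
             apply (rule runs_drop_tree[where t = "enc (P x)" and xs = "code (enc x) @ r"])
          apply (simp, simp, simp, simp)
            apply (rule computesD[OF c(2), where x = x and r = r])
          using True by auto
        then show ?thesis
          using True by (intro runs_eq[OF runs_Cond[where T = "T x + U x + 124"]]) (auto simp: tops_def)
      next
        case False
        have "runs (drop_tree 0 1 ;; d) ?s (T x + U x + 124) (s(0 := code (enc (g x)) @ r))"
          apply (rule runs_eq, rule runs_Seq)
             apply (rule runs_drop_tree[where t = "enc (P x)" and xs = "code (enc x) @ r"])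
          apply (simp, simp, simp, simp)
            apply (rule computesD[OF d(2), where x = x and r = r])
          using False by auto
        then show ?thesis
          using False by (intro runs_eq[OF runs_Cond[where T = "T x + U x + 124"]]) (auto simp: tops_def)
      qed
      show "runs ?c s (?T x) (s(0 := code (enc (if P x then f x else g x)) @ r))"
        unfolding sz_def
        apply (rule runs_eq)
          apply (rule runs_Seq, rule runs_dup, rule s)
          apply (rule runs_Seq, rule runs_eq[where v = ?s],
            rule computesD[OF b(2), where x = x and r = "code (enc x) @ r"], simp, simp, rule order_refl)
          apply (rule cond)
        by auto
    qed (simp add: computes_wf[OF b(2)] computes_wf[OF c(2)] computes_wf[OF d(2)])
  qed
qed

lemma ptime_not [ptime_intros]: "ptime P \<Longrightarrow> ptime (\<lambda>x. \<not> P x)"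
  using ptime_If[OF _ ptime_const[of False] ptime_const[of True], of P] by (simp add: if_bool_eq_conj)

lemma ptime_conj [ptime_intros]:
  assumes "ptime P" "ptime Q"
  shows "ptime (\<lambda>x. P x \<and> Q x)"
proof -
  have "(\<lambda>x. P x \<and> Q x) = (\<lambda>x. if P x then Q x else False)" by auto
  then show ?thesis by (simp only: ptime_If[OF assms ptime_const])
qed

lemma ptime_disj [ptime_intros]:
  assumes "ptime P" "ptime Q"
  shows "ptime (\<lambda>x. P x \<or> Q x)"
proof -
  have "(\<lambda>x. P x \<or> Q x) = (\<lambda>x. if P x then True else Q x)" by auto
  then show ?thesis by (simp only: ptime_If[OF assms(1) ptime_const assms(2)])
qed

subsection \<open>Folding over lists\<close>

text \<open>Stack 0 holds the list above the accumulator. With the tail parked on stack 2, the head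
  comes to lie directly above the accumulator, and a pushed 2 turns the two into the pair on which
  \<open>c\<close> runs.\<close>

definition fold_loop :: "com \<Rightarrow> com" where
  "fold_loop c = Loop (\<lambda>t. t 0 = 2)
     (Pop 0 ;; stash 0 1 ;; stash 0 2 ;; unstash 1 0 ;; push 0 2 ;; c ;; unstash 2 0)"

lemma runs_fold_loop:
  fixes g :: "'x::enc \<times> 'a::enc \<Rightarrow> 'a"
  assumes c: "computes c g T" and "sz xs \<le> A"
    and "\<And>ys x zs. xs = ys @ x # zs \<Longrightarrow> T (x, fold (\<lambda>x a. g (x, a)) ys a) \<le> B"
    and "s 0 = code (enc xs) @ code (enc a) @ r"
  shows "runs (fold_loop c) s (length xs * (80 * A + B + 20) + 1)
    (s(0 := 1 # code (enc (fold (\<lambda>x a. g (x, a)) xs a)) @ r))"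
  using assms(2-)
proof (induction xs arbitrary: a s)
  case Nil
  have "runs (fold_loop c) s 1 s"
    unfolding fold_loop_def by (rule runs_Loop_stop) (use Nil in \<open>simp add: tops_def\<close>)
  moreover have "s = s(0 := 1 # code (enc (fold (\<lambda>x a. g (x, a)) [] a)) @ r)"
    using Nil by auto
  ultimately show ?case by simp
next
  case (Cons x xs)
  let ?s = "s(0 := code (enc xs) @ code (enc (g (x, a))) @ r)"
  have T: "T (x, a) \<le> B" using Cons.prems(2)[of "[]" x xs] by simp
  have IH: "runs (fold_loop c) ?s (length xs * (80 * A + B + 20) + 1)
    (?s(0 := 1 # code (enc (fold (\<lambda>x a. g (x, a)) xs (g (x, a)))) @ r))"
    by (rule Cons.IH) (use Cons.prems(1) Cons.prems(2)[of "x # _"] in auto)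
  have body: "runs (Pop 0 ;; stash 0 1 ;; stash 0 2 ;; unstash 1 0 ;; push 0 2 ;; c ;; unstash 2 0)
      s (80 * A + B + 18) ?s"
    apply (rule runs_eq)
      apply (rule runs_Seq, rule runs_Pop)
      apply (rule runs_Seq, rule runs_stash[where t = "enc x" and xs = "code (enc xs) @ code (enc a) @ r"],
        simp, simp, simp, simp add: Cons.prems)
      apply (rule runs_Seq, rule runs_stash[where t = "enc xs" and xs = "code (enc a) @ r"],
        simp, simp, simp, simp)
      apply (rule runs_Seq, rule runs_unstash_code[where t = "enc x" and ys = "s 1"], simp, simp)
      apply (rule runs_Seq, rule runs_push)
      apply (rule runs_Seq, rule computesD[OF c, where x = "(x, a)" and r = r], simp)
      apply (rule runs_unstash_code[where t = "enc xs" and ys = "s 2"], simp, simp)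
     apply (auto simp: fun_eq_iff)[1]
    using Cons.prems(1) T by (simp add: sz_def)
  have "runs (fold_loop c) s (80 * A + B + 18 + (length xs * (80 * A + B + 20) + 1) + 2)
    (?s(0 := 1 # code (enc (fold (\<lambda>x a. g (x, a)) xs (g (x, a)))) @ r))"
    unfolding fold_loop_def
    by (rule runs_Loop_again[OF _ body IH[unfolded fold_loop_def]]) (use Cons.prems in \<open>simp add: tops_def\<close>)
  then show ?case
    by (rule runs_eq) (auto simp: algebra_simps)
qed

text \<open>Iterating a polynomial-time step may still double a value in every round; the bound
  \<open>S\<close> on all intermediate accumulators excludes this.\<close>

lemma ptime_fold:
  fixes L :: "'e::enc \<Rightarrow> 'x::enc list" and I :: "'e \<Rightarrow> 'a::enc"
  assumes L: "ptime L" and I: "ptime I" and f: "ptime (\<lambda>p. f (fst (snd p)) (fst p) (snd (snd p)))"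
    and S: "pbd S" "\<And>e ys zs. L e = ys @ zs \<Longrightarrow> sz (fold (f e) ys (I e)) \<le> S e"
  shows "ptime (\<lambda>e. fold (f e) (L e) (I e))"
proof -
  \<comment> \<open>\<open>e\<close> travels with the accumulator, since the loop body sees nothing
    but the pair on top of stack 0.\<close>
  define g where "g p = (fst (snd p), f (fst (snd p)) (fst p) (snd (snd p)))" for p :: "'x \<times> 'e \<times> 'a"
  have "ptime g"
    unfolding g_def by (intro ptime_intros f)
  then obtain c T where c: "pbd T" "computes c g T" by (rule ptimeE)
  then obtain k where k: "\<And>p. T p \<le> (sz p + 2) ^ k" unfolding pbd_def by blast
  have "ptime (\<lambda>e. (L e, e, I e))" by (intro ptime_intros L I)
  then obtain d U where d: "pbd U" "computes d (\<lambda>e. (L e, e, I e)) U" by (rule ptimeE)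
  have fold: "fold (\<lambda>x a. g (x, a)) xs (e, a) = (e, fold (f e) xs a)" for xs e a
    by (induction xs arbitrary: a) (auto simp: g_def)
  define B where "B e = (sz (L e) + sz e + S e + 4) ^ k" for e
  define V where "V e = U e + sz (L e) * (80 * sz (L e) + B e + 20) + 9" for e
  note sizes = ptime_pbd[OF L]
  have "pbd B" unfolding B_def by (intro pbd_power pbd_add pbd_const sizes S pbd_sz)
  then have V: "pbd V" unfolding V_def using sizes d(1) by (intro pbd_add pbd_mult pbd_const)
  let ?c = "d ;; Pop 0 ;; fold_loop c ;; Pop 0"
  have wf: "wf_com 4 4 ?c"
    using computes_wf[OF c(2)] computes_wf[OF d(2)] by (simp add: fold_loop_def)
  have comp: "computes ?c (\<lambda>e. (e, fold (f e) (L e) (I e))) V"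
  proof (rule computesI)
    fix e :: 'e and s :: store and r assume s: "s 0 = code (enc e) @ r"
    have B: "T (x, fold (\<lambda>x a. g (x, a)) ys (e, I e)) \<le> B e" if "L e = ys @ x # zs" for ys x zs
    proof -
      have "T (x, fold (\<lambda>x a. g (x, a)) ys (e, I e)) \<le> (sz (x, fold (\<lambda>x a. g (x, a)) ys (e, I e)) + 2) ^ k"
        by (rule k)
      also have "\<dots> \<le> B e"
        unfolding B_def fold using S(2)[OF that] sz_mem[of x "L e"] that
        by (intro power_mono) auto
      finally show ?thesis .
    qed
    show "runs ?c s (V e) (s(0 := code (enc (e, fold (f e) (L e) (I e))) @ r))"
      apply (rule runs_eq)
        apply (rule runs_Seq, rule computesD[OF d(2) , where x = e and r = r], rule s)
        apply (rule runs_Seq, rule runs_Pop)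
        apply (rule runs_Seq, rule runs_fold_loop[OF c(2) order_refl B, where xs = "L e" and r = r],
          assumption, simp)
        apply (rule runs_Pop)
       apply (auto simp: fold fun_eq_iff)[1]
      using mult_le_mono1[OF length_le_sz[of "L e"], of "80 * sz (L e) + B e + 20"]
      unfolding V_def by linarith
  qed (rule wf)
  have "ptime (\<lambda>e. (e, fold (f e) (L e) (I e)))"
  proof (rule ptimeI[OF _ V comp])
    have "sz (e, fold (f e) (L e) (I e)) \<le> sz e + S e + 1" for e
      using S(2)[of e "L e" "[]"] by simp
    then show "pbd (\<lambda>e. sz (e, fold (f e) (L e) (I e)))"
      by (rule pbd_mono[rotated]) (intro pbd_add pbd_const S pbd_sz)
  qed
  from ptime_snd[OF this] show ?thesis by simp
qed

subsection \<open>From polynomial-time functions to the class P\<close>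

primrec emit :: "nat list \<Rightarrow> com" where
  "emit [] = Skip"
| "emit (k # ks) = emit ks ;; push 0 k"

lemma runs_emit: "runs (emit ks) s (4 * length ks) (s(0 := ks @ s 0))"
proof (induction ks)
  case Nil
  show ?case unfolding emit.simps by (rule runs_eq[OF runs_Skip]) auto
next
  case (Cons k ks)
  show ?case
    unfolding emit.simps
    by (rule runs_eq, rule runs_Seq, rule Cons, rule runs_push) auto
qed

lemma wf_com_emit: "set ks \<subseteq> {..<b} \<Longrightarrow> 0 < n \<Longrightarrow> wf_com n b (emit ks)"
  by (induction ks) auto

primrec dispatch :: "(nat \<Rightarrow> nat list) \<Rightarrow> nat \<Rightarrow> com" where
  "dispatch e 0 = Skip"
| "dispatch e (Suc n) = Cond (\<lambda>t. t 1 = n + 4) (emit (e n)) (dispatch e n)"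

lemma runs_dispatch:
  assumes "top_sym (s 1) = j + 4" "j < n" "\<And>i. i < n \<Longrightarrow> length (e i) \<le> C"
  shows "runs (dispatch e n) s (n + 4 * C) (s(0 := e j @ s 0))"
  using assms(2,3)
proof (induction n)
  case (Suc n)
  show ?case
  proof (cases "j = n")
    case True
    have "runs (emit (e n)) s (4 * C) (s(0 := e j @ s 0))"
      using True Suc.prems(2)[of n] by (intro runs_eq[OF runs_emit]) auto
    then show ?thesis
      unfolding dispatch.simps using True assms(1)
      by (intro runs_eq[OF runs_Cond[where T = "4 * C"]]) (auto simp: tops_def simp del: fun_upd_apply)
  next
    case False
    then have "runs (dispatch e n) s (n + 4 * C) (s(0 := e j @ s 0))"
      using Suc.prems(1) by (intro Suc.IH Suc.prems(2)) linarith+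
    then show ?thesis
      unfolding dispatch.simps using False assms(1)
      by (intro runs_eq[OF runs_Cond[where T = "n + 4 * C"]]) (auto simp: tops_def simp del: fun_upd_apply)
  qed
qed simp

lemma wf_com_dispatch:
  "(\<And>i. i < m \<Longrightarrow> set (e i) \<subseteq> {..<b}) \<Longrightarrow> 0 < n \<Longrightarrow> wf_com n b (dispatch e m)"
  by (induction m) (auto intro: wf_com_emit)

text \<open>The code of a list ends in the leaf 1 and stacks grow at the top, so letters have to be
  emitted from the last to the first; the first loop reverses the input onto stack 1. Symbol 0
  signals an empty stack.\<close>

definition translate :: "(nat \<Rightarrow> nat list) \<Rightarrow> nat \<Rightarrow> com" where
  "translate e n = Loop (\<lambda>t. t 0 \<noteq> 0) (copy 0 1 ;; Pop 0) ;; push 0 1 ;;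
     Loop (\<lambda>t. t 1 \<noteq> 0) (dispatch e n ;; Pop 1)"

lemma runs_translate:
  assumes "set js \<subseteq> {..<n}" "\<And>i. i < n \<Longrightarrow> length (e i) \<le> C"
  shows "runs (translate e n) (\<lambda>i. if i = 0 then map (\<lambda>j. j + 4) js else [])
    ((n + 4 * C + 12) * length js + 10) ((\<lambda>i. [])(0 := concat (map e js) @ [1]))"
proof -
  have 1: "runs (Loop (\<lambda>t. t 0 \<noteq> 0) (copy 0 1 ;; Pop 0)) s (7 * length js + 1)
      (s(0 := [], 1 := map (\<lambda>j. j + 4) (rev js) @ s 1))" if "s 0 = map (\<lambda>j. j + 4) js" for s js
    using that
  proof (induction js arbitrary: s)
    case Nil
    have "s(0 := [], 1 := map (\<lambda>j. j + 4) (rev []) @ s 1) = s"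
      using Nil by (auto simp: fun_eq_iff)
    then show ?case
      using Nil runs_Loop_stop[of "\<lambda>t. t 0 \<noteq> 0" s] by (simp add: tops_def del: fun_upd_apply)
  next
    case (Cons j js)
    have "runs (copy 0 1 ;; Pop 0) s 5 (s(0 := map (\<lambda>j. j + 4) js, 1 := (j + 4) # s 1))"
      by (rule runs_eq, rule runs_Seq, rule runs_copy, simp, rule runs_Pop)
        (use Cons.prems in \<open>auto simp: fun_eq_iff\<close>)
    from runs_Loop_again[OF _ this Cons.IH] show ?case
      using Cons.prems by (auto simp: tops_def fun_eq_iff elim!: runs_eq)
  qed
  have 2: "runs (Loop (\<lambda>t. t 1 \<noteq> 0) (dispatch e n ;; Pop 1)) s ((n + 4 * C + 5) * length js + 1)
      (s(0 := concat (map e (rev js)) @ s 0, 1 := []))"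
    if "s 1 = map (\<lambda>j. j + 4) js" "set js \<subseteq> {..<n}" for s js
    using that
  proof (induction js arbitrary: s)
    case Nil
    have "s(0 := concat (map e (rev [])) @ s 0, 1 := []) = s"
      using Nil by (auto simp: fun_eq_iff)
    then show ?case
      using Nil runs_Loop_stop[of "\<lambda>t. t 1 \<noteq> 0" s] by (simp add: tops_def del: fun_upd_apply)
  next
    case (Cons j js)
    have "runs (dispatch e n ;; Pop 1) s (n + 4 * C + 2) (s(0 := e j @ s 0, 1 := map (\<lambda>j. j + 4) js))"
      by (rule runs_eq, rule runs_Seq, rule runs_dispatch[where C = C and j = j])
        (use Cons.prems assms(2) in \<open>auto simp: fun_eq_iff intro: runs_eq[OF runs_Pop]\<close>)
    from runs_Loop_again[OF _ this Cons.IH] show ?case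
      using Cons.prems by (auto simp: tops_def fun_eq_iff algebra_simps elim!: runs_eq)
  qed
  show ?thesis
    unfolding translate_def
    apply (rule runs_eq)
      apply (rule runs_Seq, rule 1[of _ js], simp)
      apply (rule runs_Seq, rule runs_push)
      apply (rule 2[of _ "rev js"])
    using assms(1) by (auto simp: fun_eq_iff rev_map algebra_simps)
qed

lemma code_enc_list: "code (enc xs) = concat (map (\<lambda>x. 2 # code (enc x)) xs) @ [1]"
  by (induction xs) auto

theorem ptime_class_P:
  fixes f :: "'b::enc list \<Rightarrow> bool" and T :: "'x \<Rightarrow> 'b"
  assumes "ptime f" "finite \<Sigma>" "L \<subseteq> lists \<Sigma>" "\<And>w. w \<in> lists \<Sigma> \<Longrightarrow> w \<in> L \<longleftrightarrow> f (map T w)"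
  shows "L \<in> class_P \<Sigma>"
proof -
  obtain as where as: "distinct as" "set as = \<Sigma>"
    using finite_distinct_list[OF \<open>finite \<Sigma>\<close>] by blast
  obtain c U where c: "pbd U" "computes c f U" using assms(1) by (rule ptimeE)
  then obtain k where k: "\<And>x. U x \<le> (sz x + 2) ^ k" unfolding pbd_def by blast
  define e where "e j = 2 # code (enc (T (as ! j)))" for j
  let ?n = "length as"
  let ?b = "4 + length as"
  define C where "C = (\<Sum>i<?n. length (e i))"
  have C: "length (e i) \<le> C" if "i < ?n" for i
    unfolding C_def using that by (intro member_le_sum) auto
  define prog where "prog = (translate e ?n ;; c) ;; Cond (\<lambda>t. t 0 = 2) (Halt True) (Halt False)"
  have "set (e i) \<subseteq> {..<?b}" for i
    using set_code[of "enc (T (as ! i))"] unfolding e_def by auto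
  then have "wf_com 4 ?b (translate e ?n)"
    by (simp add: translate_def wf_com_dispatch)
  then have wf: "wf_com 4 ?b prog"
    using wf_com_mono[OF computes_wf[OF c(2)], of ?b] by (simp add: prog_def)
  \<comment> \<open>A letter is emitted as at most \<open>C\<close> symbols, so an input of length x
    becomes a tree of size at most \<open>C * x + 1\<close>, and the first summand bounds the run of
    \<open>c\<close> on it. The second pays for the translation and the final branch.\<close>
  let ?p = "[:3, C:] ^ k + [:20, ?n + 4 * C + 12:]"
  show ?thesis
    unfolding as(2)[symmetric]
  proof (rule class_P_I[where p = ?p])
    fix js assume js: "set js \<subseteq> {..<?n}"
    define xs where "xs = map (\<lambda>j. T (as ! j)) js"
    let ?s = "\<lambda>i. if i = 0 then map (\<lambda>j. j + 4) js else []"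
    let ?s1 = "(\<lambda>i. [])(0 := code (enc (f xs)) @ []) :: store"
    have enc: "concat (map e js) @ [1] = code (enc xs) @ []"
      by (simp add: code_enc_list xs_def e_def[abs_def] comp_def)
    have "sz xs \<le> C * length js + 1"
    proof -
      have "length (concat (map e js)) \<le> C * length js"
        using js by (induction js) (auto intro!: add_mono C)
      then show ?thesis
        using arg_cong[OF enc, of length] by (simp add: sz_def tsize_def)
    qed
    then have U: "U xs \<le> (C * length js + 3) ^ k"
      using k[of xs] power_mono[of "sz xs + 2" "C * length js + 3" k] by linarith
    have run: "runs (translate e ?n ;; c) ?s ((?n + 4 * C + 12) * length js + 10 + U xs + 1) ?s1"
      apply (rule runs_eq)
        apply (rule runs_Seq, rule runs_translate[OF js C], assumption)
        apply (rule computesD[OF c(2), of _ xs "[]"])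
      using enc by auto
    obtain t where t: "t \<le> poly ?p (length js) - 3"
      "(sstep ^^ t) (translate e ?n ;; c, ?s) = (Skip, ?s1)"
    proof -
      have "(?n + 4 * C + 12) * length js + 10 + U xs + 1 \<le> poly ?p (length js) - 3"
        using U by (simp add: algebra_simps)
      then show ?thesis
        using that runs_mono[OF run] unfolding runs_def by blast
    qed
    obtain t' where t': "t' \<le> t + 1"
      "(sstep ^^ t') (prog, ?s) = (Cond (\<lambda>t. t 0 = 2) (Halt True) (Halt False), ?s1)"
      using Seq_reaches[OF t(2)] unfolding prog_def by blast
    have "fst ((sstep ^^ Suc t') (prog, ?s)) = Halt (f xs)"
      using t'(2) by (auto simp: sstep_def tops_def)
    moreover have "Suc t' \<le> poly ?p (length js)"
    proof -
      have "3 \<le> poly ?p (length js)" by simp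
      then show ?thesis using t(1) t'(1) by linarith
    qed
    moreover have "map (nth as) js \<in> L \<longleftrightarrow> f xs"
    proof -
      have "map (nth as) js \<in> lists \<Sigma>" using js as(2) by (fastforce simp: subset_eq)
      from assms(4)[OF this] show ?thesis by (simp add: xs_def comp_def)
    qed
    ultimately show "\<exists>t \<le> poly ?p (length js). fst ((sstep ^^ t) (prog, ?s)) = Halt (map (nth as) js \<in> L)"
      by (intro exI[of _ "Suc t'"]) simp
  qed (use as assms(3) wf in auto)
qed

subsection \<open>Derived closure properties\<close>

lemma sz_append: "Suc (sz (xs @ ys)) = sz xs + sz ys"
  by (induction xs) auto

lemma sz_rev [simp]: "sz (rev xs) = sz xs"
  by (simp add: sz_list rev_map[symmetric])

lemma ptime_rev [ptime_intros]:
  assumes "ptime L"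
  shows "ptime (\<lambda>e. rev (L e))"
proof -
  have "ptime (\<lambda>e. fold (\<lambda>x a. x # a) (L e) [])"
  proof (rule ptime_fold[where S = "\<lambda>e. sz (L e)"])
    fix e ys zs assume "L e = ys @ zs"
    then show "sz (fold (\<lambda>x a. x # a) ys []) \<le> sz (L e)"
      using sz_append[of ys zs] sz_pos[of zs] fun_cong[OF fold_Cons_rev[of ys], of "[]"] by (simp del: fold_Cons_rev) 
  qed (intro ptime_intros assms ptime_pbd)+
  then show ?thesis by (simp add: fold_Cons_rev)
qed

lemma ptime_append [ptime_intros]:
  assumes "ptime f" "ptime g"
  shows "ptime (\<lambda>e. f e @ g e)"
proof -
  have "ptime (\<lambda>e. fold (\<lambda>x a. x # a) (rev (f e)) (g e))"
  proof (rule ptime_fold[where S = "\<lambda>e. sz (f e) + sz (g e)"])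
    fix e ys zs assume "rev (f e) = ys @ zs"
    then have "sz (f e) = sz (ys @ zs)" by (metis sz_rev)
    then show "sz (fold (\<lambda>x a. x # a) ys (g e)) \<le> sz (f e) + sz (g e)"
      using sz_append[of ys zs] sz_append[of "rev ys" "g e"] sz_pos[of zs] fun_cong[OF fold_Cons_rev[of ys], of "g e"]
      by (simp del: fold_Cons_rev)
  qed (intro ptime_intros assms ptime_pbd pbd_add)+
  then show ?thesis by (simp add: fold_Cons_rev)
qed

lemma ptime_list_ex [ptime_intros]:
  assumes "ptime L" "ptime (\<lambda>p. P (fst p) (snd p))"
  shows "ptime (\<lambda>e. list_ex (P e) (L e))"
proof -
  have fold: "fold (\<lambda>x a. a \<or> Q x) xs b \<longleftrightarrow> b \<or> list_ex Q xs" for Q xs b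
    by (induction xs arbitrary: b) auto
  have "ptime (\<lambda>e. fold (\<lambda>x a. a \<or> P e x) (L e) False)"
  proof (rule ptime_fold[where S = "\<lambda>e. 3"])
    show "sz (fold (\<lambda>x a. a \<or> P e x) ys False) \<le> 3" for e ys
      by (cases "fold (\<lambda>x a. a \<or> P e x) ys False") auto
    show "ptime (\<lambda>p. snd (snd p) \<or> P (fst (snd p)) (fst p))"
      using ptime_comp[OF assms(2) ptime_pair[OF ptime_fst[OF ptime_snd[OF ptime_id]] ptime_fst[OF ptime_id]]]
      by (intro ptime_intros) simp
  qed (intro ptime_intros assms pbd_const)+
  then show ?thesis by (simp add: fold)
qed

lemma ptime_concat_map [ptime_intros]:
  fixes g :: "'e::enc \<Rightarrow> 'x::enc \<Rightarrow> 'y::enc list"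
  assumes L: "ptime L" and g: "ptime (\<lambda>p. g (fst p) (snd p))"
  shows "ptime (\<lambda>e. concat (map (g e) (L e)))"
proof -
  have fold: "fold (\<lambda>x a. h x @ a) xs b = concat (map h (rev xs)) @ b" for h :: "'x \<Rightarrow> 'y list" and xs b
    by (induction xs arbitrary: b) auto
  obtain k where k: "\<And>p. sz (g (fst p) (snd p)) \<le> (sz p + 2) ^ k"
    using ptime_pbd[OF g] unfolding pbd_def by blast
  have "ptime (\<lambda>e. fold (\<lambda>x a. g e x @ a) (rev (L e)) [])"
  proof (rule ptime_fold[where S = "\<lambda>e. sz (L e) * (sz e + sz (L e) + 3) ^ k + 1"])
    show "pbd (\<lambda>e. sz (L e) * (sz e + sz (L e) + 3) ^ k + 1)"
      by (intro pbd_add pbd_mult pbd_power pbd_const pbd_sz ptime_pbd L)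
    show "ptime (\<lambda>p. g (fst (snd p)) (fst p) @ snd (snd p))"
      using ptime_comp[OF g ptime_pair[OF ptime_fst[OF ptime_snd[OF ptime_id]] ptime_fst[OF ptime_id]]]
      by (intro ptime_intros) simp
    fix e ys zs assume L_eq: "rev (L e) = ys @ zs"
    let ?B = "(sz e + sz (L e) + 3) ^ k"
    have sub: "set ys \<subseteq> set (L e)" using arg_cong[OF L_eq, of set] by auto
    have "sz (concat (map (g e) us)) \<le> length us * ?B + 1" if "set us \<subseteq> set (L e)" for us
      using that
    proof (induction us)
      case (Cons u us)
      have "sz (g e u) \<le> (sz (e, u) + 2) ^ k" using k[of "(e, u)"] by simp
      also have "\<dots> \<le> ?B" using sz_mem[of u "L e"] Cons.prems by (intro power_mono) auto
      finally show ?case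
        using Cons sz_append[of "g e u" "concat (map (g e) us)"] by auto
    qed simp
    from this[of "rev ys"] sub have "sz (fold (\<lambda>x a. g e x @ a) ys []) \<le> length ys * ?B + 1"
      by (simp add: fold)
    also have "length ys \<le> sz (L e)"
      using length_le_sz[of "L e"] arg_cong[OF L_eq, of length] by simp
    finally show "sz (fold (\<lambda>x a. g e x @ a) ys []) \<le> sz (L e) * ?B + 1" by simp
  qed (intro ptime_intros L)+
  then show ?thesis by (simp add: fold)
qed

lemma ptime_map [ptime_intros]:
  assumes "ptime L" "ptime (\<lambda>p. g (fst p) (snd p))"
  shows "ptime (\<lambda>e. map (g e) (L e))"
proof -
  have "ptime (\<lambda>e. concat (map (\<lambda>x. [g e x]) (L e)))" by (intro ptime_intros assms)
  then show ?thesis by (simp add: concat_map_singleton)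
qed

lemma ptime_filter [ptime_intros]:
  assumes "ptime L" "ptime (\<lambda>p. P (fst p) (snd p))"
  shows "ptime (\<lambda>e. filter (P e) (L e))"
proof -
  have "filter Q xs = concat (map (\<lambda>x. if Q x then [x] else []) xs)" for Q and xs :: "'b list"
    by (induction xs) auto
  then show ?thesis by (simp only:) (intro ptime_intros assms)
qed

lemma ptime_mem [ptime_intros]:
  assumes "ptime f" "ptime L"
  shows "ptime (\<lambda>e. f e \<in> set (L e))"
proof -
  have "ptime (\<lambda>e. list_ex (\<lambda>x. x = f e) (L e))"
    by (intro ptime_intros assms(2) ptime_comp[OF assms(1) ptime_fst[OF ptime_id]])
  then show ?thesis by (simp add: list_ex_iff)
qed

definition hd_or :: "'a \<Rightarrow> 'a list \<Rightarrow> 'a" where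
  "hd_or d xs = (if xs = [] then d else hd xs)"

lemma ptime_hd_or [ptime_intros]: "ptime L \<Longrightarrow> ptime (\<lambda>e. hd_or d (L e))"
proof (rule ptime_comp[of "hd_or d"])
  have "ptime (\<lambda>t. if t = Leaf then enc d else left_subtree t)"
    by (intro ptime_intros ptime_left_subtree)
  then show "ptime (hd_or d)"
  proof (rule ptime_transfer)
    show "(if enc xs = Leaf then enc d else left_subtree (enc xs)) = enc (hd_or d xs)" for xs
      by (cases xs) (auto simp: hd_or_def left_subtree_def)
  qed
qed

lemma ptime_length [ptime_intros]:
  assumes "ptime L"
  shows "ptime (\<lambda>e. length (L e))"
proof -
  have fold: "fold (\<lambda>x. Suc) xs n = length xs + n" for xs :: "'b list" and n
    by (induction xs arbitrary: n) auto
  have "ptime (\<lambda>e. fold (\<lambda>x. Suc) (L e) 0)"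
  proof (rule ptime_fold[where S = "\<lambda>e. 2 * sz (L e) + 1"])
    show "sz (fold (\<lambda>x. Suc) ys 0) \<le> 2 * sz (L e) + 1" if "L e = ys @ zs" for e ys zs
      using length_le_sz[of "L e"] that by (simp add: fold sz_nat)
  qed (intro ptime_intros assms pbd_add pbd_mult pbd_const ptime_pbd)+
  then show ?thesis by (simp add: fold)
qed

lemma fold_unit: "fold (\<lambda>u. f) (replicate n ()) = f ^^ n"
  by (induction n) (auto simp: funpow_swap1)

lemma replicate_eq_appendD: "replicate n x = ys @ zs \<Longrightarrow> ys = replicate (length ys) x \<and> length ys \<le> n"
  by (metis append_eq_conv_conj length_append length_replicate le_add1 min.absorb1 take_replicate)

lemma ptime_funpow:
  fixes f :: "'e::enc \<Rightarrow> 'a::enc \<Rightarrow> 'a"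
  assumes "ptime n" "ptime I" "ptime (\<lambda>p. f (fst p) (snd p))"
    and "pbd S" "\<And>e i. i \<le> n e \<Longrightarrow> sz ((f e ^^ i) (I e)) \<le> S e"
  shows "ptime (\<lambda>e. (f e ^^ n e) (I e))"
proof -
  have "ptime (\<lambda>e. fold (\<lambda>u. f e) (replicate (n e) ()) (I e))"
  proof (rule ptime_fold[where S = S])
    show "ptime (\<lambda>p. f (fst (snd p)) (snd (snd p)))"
      by (rule ptime_comp[OF assms(3) ptime_snd[OF ptime_id]])
    show "sz (fold (\<lambda>u. f e) ys (I e)) \<le> S e" if "replicate (n e) () = ys @ zs" for e ys zs
      using assms(5) replicate_eq_appendD[OF that] fold_unit[of "f e" "length ys"] by metis
  qed (intro ptime_intros assms)+
  then show ?thesis by (simp add: fold_unit)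
qed

lemma ptime_add [ptime_intros]:
  assumes "ptime f" "ptime g"
  shows "ptime (\<lambda>e. f e + g e :: nat)"
proof -
  have pow: "(Suc ^^ n) m = n + m" for n m by (induction n) auto
  have "ptime (\<lambda>e. (Suc ^^ f e) (g e))"
    by (rule ptime_funpow[where S = "\<lambda>e. sz (f e) + sz (g e)"])
      (intro ptime_intros assms pbd_add ptime_pbd | simp add: pow sz_nat)+
  then show ?thesis by (simp add: pow)
qed

lemma ptime_mult [ptime_intros]:
  assumes "ptime f" "ptime g"
  shows "ptime (\<lambda>e. f e * g e :: nat)"
proof -
  have pow: "((+) k ^^ n) 0 = n * k" for n k :: nat by (induction n) auto
  have "ptime (\<lambda>e. ((+) (g e) ^^ f e) 0)"
  proof (rule ptime_funpow[where S = "\<lambda>e. 2 * (sz (f e) * sz (g e)) + 1"])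
    show "sz (((+) (g e) ^^ i) 0) \<le> 2 * (sz (f e) * sz (g e)) + 1" if "i \<le> f e" for e i
    proof -
      have "i * g e \<le> sz (f e) * sz (g e)" using that by (intro mult_mono) (auto simp: sz_nat)
      then show ?thesis by (simp add: pow sz_nat)
    qed
    show "ptime (\<lambda>p. g (fst p) + snd p)"
      by (intro ptime_intros ptime_comp[OF assms(2) ptime_fst[OF ptime_id]])
  qed (intro ptime_intros assms pbd_add pbd_mult pbd_const ptime_pbd)+
  then show ?thesis by (simp add: pow)
qed

lemma ptime_power [ptime_intros]: "ptime f \<Longrightarrow> ptime (\<lambda>e. f e ^ k :: nat)"
  by (induction k) (auto intro: ptime_intros)

lemma ptime_le [ptime_intros]:
  assumes "ptime f" "ptime g"
  shows "ptime (\<lambda>e. f e \<le> (g e :: nat))"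
proof -
  have pow: "((\<lambda>n. n - Suc 0) ^^ n) m = m - n" for n m by (induction n) auto
  have "ptime (\<lambda>e. ((\<lambda>n. n - Suc 0) ^^ g e) (f e))"
    by (rule ptime_funpow[where S = "\<lambda>e. sz (f e)"])
      (intro ptime_intros assms ptime_pbd | simp add: pow sz_nat)+
  then have "ptime (\<lambda>e. f e - g e = 0)"
    unfolding pow by (intro ptime_intros)
  then show ?thesis by simp
qed

section \<open>Hyperbolic groups\<close>

locale word_metric = group G for G (structure) +
  fixes Y :: "'a set"
  assumes Y: "finite_generating_set G Y"
begin

abbreviation "S \<equiv> sym_gens G Y"
abbreviation "ev \<equiv> word_eval G"
abbreviation "len \<equiv> word_length G Y"
abbreviation "d \<equiv> word_dist G Y"
abbreviation "gp \<equiv> gromov_product d"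

lemma S_closed: "S \<subseteq> carrier G"
  using Y by (auto simp: sym_gens_def finite_generating_set_def)

lemma S_inv: "x \<in> S \<Longrightarrow> inv x \<in> S"
  using Y by (auto simp: sym_gens_def finite_generating_set_def)

lemma finite_S: "finite S"
  using Y by (auto simp: sym_gens_def finite_generating_set_def)

lemma l_cancel: "x \<in> carrier G \<Longrightarrow> y \<in> carrier G \<Longrightarrow> z \<in> carrier G \<Longrightarrow> x \<otimes> y = x \<otimes> z \<longleftrightarrow> y = z"
  by (simp add: Units_eq)

lemma ev_Nil [simp]: "ev [] = \<one>"
  by (simp add: word_eval_def)

lemma ev_Cons [simp]: "ev (x # w) = x \<otimes> ev w"
  by (simp add: word_eval_def)

lemma ev_closed [simp, intro]: "set w \<subseteq> carrier G \<Longrightarrow> ev w \<in> carrier G"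
  by (induction w) auto

lemma ev_append: "set v \<subseteq> carrier G \<Longrightarrow> set w \<subseteq> carrier G \<Longrightarrow> ev (v @ w) = ev v \<otimes> ev w"
  by (induction v) (auto simp: m_assoc)

lemma ev_S [simp, intro]: "w \<in> lists S \<Longrightarrow> ev w \<in> carrier G"
  using S_closed by (intro ev_closed) auto

lemma ev_append_S: "v \<in> lists S \<Longrightarrow> w \<in> lists S \<Longrightarrow> ev (v @ w) = ev v \<otimes> ev w"
  using S_closed by (intro ev_append) auto

lemma ex_inverse_word:
  "w \<in> lists S \<Longrightarrow> \<exists>v \<in> lists S. length v = length w \<and> ev v = inv (ev w)"
proof (induction w)
  case (Cons x w)
  then obtain v where v: "v \<in> lists S" "length v = length w" "ev v = inv (ev w)" by auto
  have x: "x \<in> S" "x \<in> carrier G" "ev w \<in> carrier G" using Cons S_closed by auto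
  show ?case
    using v x S_inv by (intro bexI[of _ "v @ [inv x]"]) (auto simp: ev_append_S inv_mult_group)
qed auto

lemma ex_word:
  assumes "g \<in> carrier G"
  shows "\<exists>w \<in> lists S. ev w = g"
proof -
  have "g \<in> generate G Y" using assms Y by (simp add: finite_generating_set_def)
  then show ?thesis
  proof induction
    case one
    show ?case by (intro bexI[of _ "[]"]) auto
  next
    case (incl h)
    then show ?case using S_closed by (intro bexI[of _ "[h]"]) (auto simp: sym_gens_def)
  next
    case (inv h)
    then show ?case using S_closed by (intro bexI[of _ "[inv h]"]) (auto simp: sym_gens_def)
  next
    case (eng h1 h2)
    then obtain v w where "v \<in> lists S" "ev v = h1" "w \<in> lists S" "ev w = h2" by blast
    then show ?case by (intro bexI[of _ "v @ w"]) (auto simp: ev_append_S)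
  qed
qed

lemma len_le: "w \<in> lists S \<Longrightarrow> len (ev w) \<le> length w"
  unfolding word_length_def by (rule Least_le) auto

lemma ex_geodesic:
  assumes "g \<in> carrier G"
  obtains w where "w \<in> lists S" "length w = len g" "ev w = g"
proof -
  have "\<exists>n. \<exists>w \<in> lists S. length w = n \<and> ev w = g" using ex_word[OF assms] by blast
  from LeastI_ex[OF this] show ?thesis using that unfolding word_length_def by blast
qed

lemma len_one [simp]: "len \<one> = 0"
  using len_le[of "[]"] by simp

lemma len_mult:
  assumes "g \<in> carrier G" "h \<in> carrier G"
  shows "len (g \<otimes> h) \<le> len g + len h"
proof -
  obtain v where v: "v \<in> lists S" "length v = len g" "ev v = g" using ex_geodesic[OF assms(1)] .
  obtain w where w: "w \<in> lists S" "length w = len h" "ev w = h" using ex_geodesic[OF assms(2)] .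
  show ?thesis using len_le[of "v @ w"] v w by (auto simp: ev_append_S)
qed

lemma len_inv_le: "g \<in> carrier G \<Longrightarrow> len (inv g) \<le> len g"
  using ex_geodesic ex_inverse_word len_le by metis

lemma len_inv [simp]: "g \<in> carrier G \<Longrightarrow> len (inv g) = len g"
  using len_inv_le[of g] len_inv_le[of "inv g"] by simp

lemma d_self [simp]: "g \<in> carrier G \<Longrightarrow> d g g = 0"
  by (simp add: word_dist_def)

lemma d_sym: "g \<in> carrier G \<Longrightarrow> h \<in> carrier G \<Longrightarrow> d g h = d h g"
  using len_inv[of "inv g \<otimes> h"] by (simp add: word_dist_def inv_mult_group)

lemma d_triangle:
  assumes "g \<in> carrier G" "h \<in> carrier G" "k \<in> carrier G"
  shows "d g k \<le> d g h + d h k"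
proof -
  have "h \<otimes> (inv h \<otimes> k) = k" using assms by (simp add: m_assoc[symmetric])
  then have "inv g \<otimes> k = (inv g \<otimes> h) \<otimes> (inv h \<otimes> k)"
    using assms by (simp add: m_assoc)
  then show ?thesis
    using len_mult[of "inv g \<otimes> h" "inv h \<otimes> k"] assms unfolding word_dist_def
    by (metis inv_closed m_closed of_nat_add of_nat_mono)
qed

lemma d_left: "g \<in> carrier G \<Longrightarrow> h \<in> carrier G \<Longrightarrow> k \<in> carrier G \<Longrightarrow> d (g \<otimes> h) (g \<otimes> k) = d h k"
proof -
  assume c: "g \<in> carrier G" "h \<in> carrier G" "k \<in> carrier G"
  then have "inv g \<otimes> (g \<otimes> k) = k" by (simp add: m_assoc[symmetric])
  then show ?thesis using c by (simp add: word_dist_def inv_mult_group m_assoc)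
qed

definition geodesic :: "'a list \<Rightarrow> bool" where
  "geodesic w \<longleftrightarrow> w \<in> lists S \<and> length w = len (ev w)"

text \<open>A shorter word for one part would give a shorter word for the whole.\<close>

lemma geodesic_append:
  assumes "geodesic (v @ w)"
  shows "geodesic v" "geodesic w"
proof -
  have S: "v \<in> lists S" "w \<in> lists S" and l: "length v + length w = len (ev v \<otimes> ev w)"
    using assms by (auto simp: geodesic_def ev_append_S)
  then show "geodesic v" "geodesic w"
    using len_le[of v] len_le[of w] len_mult[of "ev v" "ev w"] by (auto simp: geodesic_def)
qed

lemma d_one: "g \<in> carrier G \<Longrightarrow> d g \<one> = len g" "g \<in> carrier G \<Longrightarrow> d \<one> g = len g"
  by (auto simp: word_dist_def)

lemma geodesic_d:
  assumes "geodesic w" "t \<le> length w"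
  shows "d (ev (take t w)) (ev w) = length w - t" "d (ev (take t w)) \<one> = t" "d (ev w) \<one> = length w"
proof -
  have w: "take t w @ drop t w = w" by simp
  have S: "take t w \<in> lists S" "drop t w \<in> lists S"
    using assms(1) by (auto simp: geodesic_def dest: in_set_takeD in_set_dropD)
  have g: "geodesic (take t w)" "geodesic (drop t w)"
    using geodesic_append[of "take t w" "drop t w"] assms(1) by simp_all
  have "ev w = ev (take t w) \<otimes> ev (drop t w)" using ev_append_S[OF S] by simp
  then have "inv (ev (take t w)) \<otimes> ev w = ev (drop t w)"
    using S by (simp add: m_assoc[symmetric])
  then show "d (ev (take t w)) (ev w) = length w - t"
    using g(2) assms(2) by (simp add: word_dist_def geodesic_def)
  show "d (ev (take t w)) \<one> = t" "d (ev w) \<one> = length w"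
    using g(1) assms S by (simp_all add: d_one geodesic_def)
qed

text \<open>Distances are integers, so the two halves of a geodesic may differ by one; rounding down
  puts the longer half next to \<open>y\<close>.\<close>

lemma ex_midpoint:
  assumes "x \<in> carrier G" "y \<in> carrier G"
  obtains w where "w \<in> carrier G" "2 * d x w \<le> d x y" "2 * d w y \<le> d x y + 1" "d x w + d w y = d x y"
    "2 * d x w \<ge> d x y - 1"
proof -
  obtain v where v: "v \<in> lists S" "length v = len (inv x \<otimes> y)" "ev v = inv x \<otimes> y"
    using ex_geodesic[of "inv x \<otimes> y"] assms by auto
  then have g: "geodesic v" by (simp add: geodesic_def)
  let ?t = "length v div 2"
  have t: "?t \<le> length v" by simp
  let ?m = "ev (take ?t v)"
  have m: "?m \<in> carrier G" using v(1) by (intro ev_S) (auto dest: in_set_takeD)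
  have y: "x \<otimes> ev v = y" using v assms by (simp add: m_assoc[symmetric])
  have dxy: "d x y = length v" using v by (simp add: word_dist_def)
  have 1: "d x (x \<otimes> ?m) = ?t"
    using geodesic_d(2)[OF g t] d_left[of x "\<one>" ?m] d_sym[of ?m "\<one>"] assms m by simp
  have 2: "d (x \<otimes> ?m) y = length v - ?t"
    using geodesic_d(1)[OF g t] d_left[of x ?m "ev v"] assms m v y by simp
  show ?thesis
    by (rule that[of "x \<otimes> ?m"]) (use 1 2 dxy assms m t in auto)
qed

end

section \<open>Polygons in a hyperbolic group\<close>

locale hyperbolic_word_metric = word_metric +
  fixes \<delta> :: real
  assumes delta_nonneg: "0 \<le> \<delta>"
    and hyp: "\<And>w x y z. w \<in> carrier G \<Longrightarrow> x \<in> carrier G \<Longrightarrow> y \<in> carrier G \<Longrightarrow> z \<in> carrier G \<Longrightarrow>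
      gp w x z \<ge> min (gp w x y) (gp w y z) - \<delta>"
begin

text \<open>Splitting at a middle corner applies the inequality once per level, so \<open>n\<close>
  levels lose \<open>\<delta> * n\<close> for up to \<open>2 ^ n\<close> edges. Splitting off one
  corner at a time would lose \<delta> for every edge.\<close>

lemma polygon_gromov_product:
  assumes "\<And>k. i \<le> k \<Longrightarrow> k \<le> j \<Longrightarrow> p k \<in> carrier G" "w \<in> carrier G" "i < j" "j - i \<le> 2 ^ n"
  shows "\<exists>k. i \<le> k \<and> k < j \<and> gp w (p i) (p j) \<ge> gp w (p k) (p (Suc k)) - \<delta> * n"
  using assms
proof (induction n arbitrary: i j)
  case 0
  then have "j = Suc i" by simp
  then show ?case by auto
next
  case (Suc n)
  show ?case
  proof (cases "j - i \<le> 2 ^ n")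
    case True
    then obtain k where k: "i \<le> k" "k < j" "gp w (p i) (p j) \<ge> gp w (p k) (p (Suc k)) - \<delta> * n"
      using Suc.IH[of i j] Suc.prems by auto
    moreover have "\<delta> * n \<le> \<delta> * Suc n" using delta_nonneg by (simp add: algebra_simps)
    ultimately show ?thesis by (intro exI[of _ k]) linarith
  next
    case False
    \<comment> \<open>The left part gets exactly \<open>2 ^ n\<close> edges, which leaves at most as
      many for the right part.\<close>
    let ?m = "i + 2 ^ n"
    have m: "i < ?m" "?m < j" "?m - i \<le> 2 ^ n" "j - ?m \<le> 2 ^ n" using False Suc.prems by auto
    obtain k where k: "i \<le> k" "k < ?m" "gp w (p i) (p ?m) \<ge> gp w (p k) (p (Suc k)) - \<delta> * n"
      using Suc.IH[of i ?m] Suc.prems m by auto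
    obtain l where l: "?m \<le> l" "l < j" "gp w (p ?m) (p j) \<ge> gp w (p l) (p (Suc l)) - \<delta> * n"
      using Suc.IH[of ?m j] Suc.prems m by auto
    have "gp w (p i) (p j) \<ge> min (gp w (p i) (p ?m)) (gp w (p ?m) (p j)) - \<delta>"
      using Suc.prems m by (intro hyp) auto
    then consider "gp w (p i) (p j) \<ge> gp w (p k) (p (Suc k)) - \<delta> * Suc n"
      | "gp w (p i) (p j) \<ge> gp w (p l) (p (Suc l)) - \<delta> * Suc n"
      using k(3) l(3) by (fastforce simp: algebra_simps min_def split: if_splits)
    then show ?thesis
    proof cases
      case 1
      then show ?thesis using k m by (intro exI[of _ k]) auto
    next
      case 2
      then show ?thesis using l m by (intro exI[of _ l]) auto
    qed
  qed
qed

text \<open>Apply the previous lemma at a midpoint \<open>w\<close> of the chord: the Gromov product of its ends is \<open>0\<close> there, so the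
  path comes close to \<open>w\<close>.\<close>

lemma interior_point:
  assumes p: "\<And>k. i \<le> k \<Longrightarrow> k \<le> j \<Longrightarrow> p k \<in> carrier G"
    and steps: "\<And>k. i \<le> k \<Longrightarrow> k < j \<Longrightarrow> d (p k) (p (Suc k)) \<le> 1"
    and j: "Suc i < j" "j - i \<le> 2 ^ n" and K: "d (p i) (p j) \<le> K" "real K > 2 * \<delta> * n + 3"
  shows "\<exists>k. i < k \<and> k < j \<and> d (p i) (p k) \<le> K \<and> d (p k) (p j) \<le> K"
proof (cases "d (p i) (p j) \<le> real K - 1")
  \<comment> \<open>With a unit to spare, the neighbour of \<open>p i\<close> on the path is already
    close enough to both ends.\<close>
  case True
  have "d (p (Suc i)) (p j) \<le> d (p (Suc i)) (p i) + d (p i) (p j)"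
    using j by (intro d_triangle p) auto
  also have "d (p (Suc i)) (p i) \<le> 1"
    using steps[of i] j d_sym[of "p i" "p (Suc i)"] p by simp
  finally have "d (p (Suc i)) (p j) \<le> K" using True by simp
  moreover have "0 \<le> 2 * \<delta> * n" using delta_nonneg by simp
  then have "d (p i) (p (Suc i)) \<le> K" using steps[of i] j K(2) by auto
  ultimately show ?thesis using j by (intro exI[of _ "Suc i"]) auto
next
  case False
  \<comment> \<open>Distances are integers, so one that is above \<open>K - 1\<close> and at most
    \<open>K\<close> equals \<open>K\<close>.\<close>
  then have D: "d (p i) (p j) = K" using K(1) by (auto simp: word_dist_def)
  have ij: "p i \<in> carrier G" "p j \<in> carrier G" using p j by auto
  obtain w where w: "w \<in> carrier G" "2 * d (p i) w \<le> d (p i) (p j)" "2 * d w (p j) \<le> d (p i) (p j) + 1"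
    "d (p i) w + d w (p j) = d (p i) (p j)" "2 * d (p i) w \<ge> d (p i) (p j) - 1"
    using ex_midpoint[OF ij] by metis
  have "gp w (p i) (p j) = 0"
    using w d_sym[OF w(1) ij(2)] by (simp add: gromov_product_def)
  then obtain k where k: "i \<le> k" "k < j" "gp w (p k) (p (Suc k)) \<le> \<delta> * n"
    using polygon_gromov_product[of i j p w n] p w j by force
  have pk: "p k \<in> carrier G" "p (Suc k) \<in> carrier G" using p k by auto
  have "d (p k) w \<le> d (p k) (p (Suc k)) + d (p (Suc k)) w"
    using pk w by (intro d_triangle)
  then have kw: "d (p k) w \<le> \<delta> * n + 1"
    using k steps[of k] by (simp add: gromov_product_def)
  \<comment> \<open>Otherwise \<open>p i\<close> would be within \<open>\<delta> * n + 1\<close> of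
    \<open>w\<close>, although its distance from \<open>w\<close> is at least
    \<open>(K - 1) / 2\<close>; the summand 3 in the bound on \<open>K\<close> is there to exclude
    this.\<close>
  have "k \<noteq> i"
  proof
    assume "k = i"
    then show False using kw w(5) D K(2) by simp
  qed
  moreover have "d (p i) (p k) \<le> d (p i) w + d w (p k)" "d (p k) (p j) \<le> d (p k) w + d w (p j)"
    using ij pk w by (auto intro!: d_triangle)
  then have "d (p i) (p k) \<le> K" "d (p k) (p j) \<le> K"
    using kw w D K(2) d_sym[OF w(1) pk(1)] by auto
  ultimately show ?thesis using k by (intro exI[of _ k]) auto
qed

section \<open>Fellow-travelling geodesics and rewriting between equal words\<close>

definition \<kappa> :: nat where
  "\<kappa> = nat \<lceil>4 * \<delta>\<rceil> + 2"

text \<open>Follow the chain from the prefix of \<open>u\<close> to \<open>u\<close>, to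
  \<open>v\<close>, and to the prefix of \<open>v\<close>: its Gromov products at the identity are
  \<open>t\<close>, at least \<open>t - 1 / 2\<close>, and \<open>t\<close>. Two uses of the
  inequality lose \<open>2 * \<delta>\<close>. Since both prefixes have distance \<open>t\<close>
  from the identity, they are at most \<open>1 + 4 * \<delta>\<close> apart, and \<kappa> rounds
  this up.\<close>

lemma fellow_travel:
  assumes "geodesic u" "geodesic v" "d (ev u) (ev v) \<le> 1" "t \<le> length u" "t \<le> length v"
  shows "d (ev (take t u)) (ev (take t v)) \<le> \<kappa>"
proof -
  have S: "take t u \<in> lists S" "take t v \<in> lists S" "u \<in> lists S" "v \<in> lists S"
    using assms by (auto simp: geodesic_def dest: in_set_takeD)
  then have c: "ev (take t u) \<in> carrier G" "ev (take t v) \<in> carrier G" "ev u \<in> carrier G" "ev v \<in> carrier G"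
    by blast+
  note gu = geodesic_d[OF assms(1,4)] and gv = geodesic_d[OF assms(2,5)]
  have 1: "gp \<one> (ev (take t u)) (ev u) = t"
    using gu assms(4) by (simp add: gromov_product_def of_nat_diff)
  have 2: "gp \<one> (ev u) (ev v) \<ge> t - 1 / 2"
    using gu gv assms(3-5) by (simp add: gromov_product_def)
  have 3: "gp \<one> (ev v) (ev (take t v)) = t"
    using gv assms(5) d_sym[OF c(2,4)] by (simp add: gromov_product_def of_nat_diff)
  have "gp \<one> (ev (take t u)) (ev v) \<ge> t - 1 / 2 - \<delta>"
    using hyp[of "\<one>" "ev (take t u)" "ev u" "ev v"] c 1 2 by auto
  then have "gp \<one> (ev (take t u)) (ev (take t v)) \<ge> t - 1 / 2 - 2 * \<delta>"
    using hyp[of "\<one>" "ev (take t u)" "ev v" "ev (take t v)"] c 3 delta_nonneg by auto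
  then have "d (ev (take t u)) (ev (take t v)) \<le> 1 + 4 * \<delta>"
    using gu(2) gv(2) by (simp add: gromov_product_def)
  also have "\<dots> \<le> \<kappa>" unfolding \<kappa>_def using real_nat_ceiling_ge[of "4 * \<delta>"] by linarith
  finally show ?thesis .
qed

text \<open>These are the cells between two fellow-travelling paths: each side consists of a
  connecting word of length at most \<kappa> and at most one letter, hence the bound
  \<open>\<kappa> + 1\<close>. The set is finite, so it can be built into the machine.\<close>

definition relators :: "('a list \<times> 'a list) set" where
  "relators = {(l, r). l \<in> lists S \<and> r \<in> lists S \<and> length l \<le> \<kappa> + 1 \<and> length r \<le> \<kappa> + 1 \<and> ev l = ev r}"

text \<open>The whole words are bounded too, so that a chain of steps never leaves the words that
  the algorithm enumerates.\<close>

definition rewrite :: "nat \<Rightarrow> ('a list \<times> 'a list) set" where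
  "rewrite n = {(x @ l @ y, x @ r @ y) | x l r y. (l, r) \<in> relators \<and> x \<in> lists S \<and> y \<in> lists S \<and>
     length (x @ l @ y) \<le> n \<and> length (x @ r @ y) \<le> n}"

lemma finite_relators: "finite relators"
proof -
  have "relators \<subseteq> {w. set w \<subseteq> S \<and> length w \<le> \<kappa> + 1} \<times> {w. set w \<subseteq> S \<and> length w \<le> \<kappa> + 1}"
    by (auto simp: relators_def)
  then show ?thesis
    by (rule finite_subset) (intro finite_cartesian_product finite_lists_length_le finite_S)
qed

lemma rewrite_mono: "m \<le> n \<Longrightarrow> rewrite m \<subseteq> rewrite n"
  unfolding rewrite_def by fastforce

lemma rewrite_sym: "(u, v) \<in> rewrite n \<Longrightarrow> (v, u) \<in> rewrite n"
  unfolding rewrite_def relators_def by fastforce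

lemma rewrite_snoc: "(u, v) \<in> rewrite n \<Longrightarrow> a \<in> S \<Longrightarrow> (u @ [a], v @ [a]) \<in> rewrite (Suc n)"
  unfolding rewrite_def
  by (clarsimp, rule_tac x = x in exI, rule_tac x = l in exI, rule_tac x = r in exI,
      rule_tac x = "y @ [a]" in exI) auto

lemma rewrites_snoc: "(u, v) \<in> (rewrite n)\<^sup>* \<Longrightarrow> a \<in> S \<Longrightarrow> (u @ [a], v @ [a]) \<in> (rewrite (Suc n))\<^sup>*"
  by (induction rule: rtrancl_induct) (auto intro: rtrancl.rtrancl_into_rtrancl rewrite_snoc)

text \<open>Sweep along the two words, joining corresponding points by geodesics of length at most \<open>\<kappa>\<close>.\<close>

lemma rewrites_fellow_travelling:
  assumes p: "p \<in> lists S" and v: "v \<in> lists S" and eq: "ev p = ev v" and l: "length v \<le> length p"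
    and close: "\<And>t. t \<le> length p \<Longrightarrow> d (ev (take t v)) (ev (take t p)) \<le> \<kappa>"
  shows "(p, v) \<in> (rewrite (length p + \<kappa>))\<^sup>*"
proof -
  have take_S: "take t w \<in> lists S" "drop t w \<in> lists S" if "w \<in> lists S" for t w
    using that by (auto dest: in_set_takeD in_set_dropD)
  \<comment> \<open>Connecting words are empty where the paths meet, so that the sweep starts with
    \<open>p\<close> itself and ends with \<open>v\<close> itself.\<close>
  have "\<exists>b. b \<in> lists S \<and> length b \<le> \<kappa> \<and> ev (take t v) \<otimes> ev b = ev (take t p) \<and>
      (ev (take t v) = ev (take t p) \<longrightarrow> b = [])" if "t \<le> length p" for t
  proof -
    have c: "ev (take t v) \<in> carrier G" "ev (take t p) \<in> carrier G" using take_S p v by blast+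
    obtain b where b: "b \<in> lists S" "length b = len (inv (ev (take t v)) \<otimes> ev (take t p))"
      "ev b = inv (ev (take t v)) \<otimes> ev (take t p)"
      using ex_geodesic[of "inv (ev (take t v)) \<otimes> ev (take t p)"] c by auto
    then show ?thesis
      using close[OF that] c by (intro exI[of _ b]) (auto simp: word_dist_def m_assoc[symmetric])
  qed
  then obtain b where b: "\<And>t. t \<le> length p \<Longrightarrow> b t \<in> lists S" "\<And>t. t \<le> length p \<Longrightarrow> length (b t) \<le> \<kappa>"
    "\<And>t. t \<le> length p \<Longrightarrow> ev (take t v) \<otimes> ev (b t) = ev (take t p)"
    "\<And>t. t \<le> length p \<Longrightarrow> ev (take t v) = ev (take t p) \<Longrightarrow> b t = []"
    by metis
  have "(p, take t v @ b t @ drop t p) \<in> (rewrite (length p + \<kappa>))\<^sup>*" if "t \<le> length p" for t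
    using that
  proof (induction t)
    case 0
    have "b 0 = []" using b(4)[of 0] by simp
    then show ?case by simp
  next
    case (Suc t)
    then have t: "t < length p" "t \<le> length p" by auto
    \<comment> \<open>Empty once \<open>v\<close> is exhausted, as \<open>v\<close> may be shorter
      than \<open>p\<close>.\<close>
    define c where "c = take 1 (drop t v)"
    have c: "take (Suc t) v = take t v @ c" unfolding c_def
      by (metis Suc_eq_plus1 take_add)
    have cS: "c \<in> lists S" "length c \<le> 1" unfolding c_def using v
      by (auto dest: in_set_takeD in_set_dropD)
    have p_t: "p ! t \<in> S" using p t by (auto simp: in_lists_conv_set)
    have car: "ev (take t v) \<in> carrier G" "ev (b t) \<in> carrier G" "ev c \<in> carrier G"
        "ev (b (Suc t)) \<in> carrier G" "p ! t \<in> carrier G"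
      using take_S[OF v] b(1)[OF t(2)] b(1)[OF Suc.prems] cS p_t S_closed by blast+
    have "ev (take t v) \<otimes> (ev (b t) \<otimes> p ! t) = ev (take (Suc t) p)"
      using b(3)[OF t(2)] car t take_S(1)[OF p, of t] p_t
      by (simp add: m_assoc[symmetric] take_Suc_conv_app_nth ev_append_S)
    also have "\<dots> = ev (take t v) \<otimes> (ev c \<otimes> ev (b (Suc t)))"
      using b(3)[OF Suc.prems] car take_S(1)[OF v, of t] cS by (simp add: c ev_append_S m_assoc)
    finally have "ev (b t @ [p ! t]) = ev (c @ b (Suc t))"
      using car b(1)[OF t(2)] b(1)[OF Suc.prems] p_t cS by (simp add: ev_append_S l_cancel)
    then have rel: "(b t @ [p ! t], c @ b (Suc t)) \<in> relators"
      unfolding relators_def using b(1,2)[OF t(2)] b(1,2)[OF Suc.prems] p_t cS by auto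
    have drop: "drop t p = p ! t # drop (Suc t) p" using t by (simp add: Cons_nth_drop_Suc)
    have lenv: "length (take t v) \<le> t" by simp
    have "(take t v @ (b t @ [p ! t]) @ drop (Suc t) p, take t v @ (c @ b (Suc t)) @ drop (Suc t) p)
      \<in> rewrite (length p + \<kappa>)"
      unfolding rewrite_def
      using rel take_S(1)[OF v, of t] take_S(2)[OF p, of "Suc t"] b(2)[OF t(2)] b(2)[OF Suc.prems] t cS lenv
      by (intro CollectI exI[of _ "take t v"] exI[of _ "b t @ [p ! t]"] exI[of _ "c @ b (Suc t)"]
          exI[of _ "drop (Suc t) p"]) auto
    with Suc.IH[OF t(2)] show ?case
      unfolding c drop by (auto intro: rtrancl.rtrancl_into_rtrancl)
  qed
  from this[of "length p"] have "(p, v @ b (length p)) \<in> (rewrite (length p + \<kappa>))\<^sup>*" using l by simp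
  moreover have "b (length p) = []" using b(4)[of "length p"] eq l by simp
  ultimately show ?thesis by simp
qed

text \<open>Letter by letter, the part already read is replaced by a geodesic \<open>w\<close>, and
  then \<open>w @ [a]\<close> is swept over to \<open>v\<close>. The bound grows by one with each
  appended letter, and the sweep stays below it because \<open>w\<close> is no longer than
  \<open>u\<close>.\<close>

lemma rewrites_geodesic:
  "u \<in> lists S \<Longrightarrow> geodesic v \<Longrightarrow> ev u = ev v \<Longrightarrow> (u, v) \<in> (rewrite (length u + \<kappa>))\<^sup>*"
proof (induction u arbitrary: v rule: rev_induct)
  case Nil
  then have "length v = 0" unfolding geodesic_def by (metis ev_Nil len_one)
  then show ?case by simp
next
  case (snoc a u)
  have a: "a \<in> S" "a \<in> carrier G" and u: "u \<in> lists S" "ev u \<in> carrier G" using snoc.prems S_closed by auto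
  obtain w where w: "w \<in> lists S" "length w = len (ev u)" "ev w = ev u" using ex_geodesic[OF u(2)] .
  then have gw: "geodesic w" by (simp add: geodesic_def)
  have v: "v \<in> lists S" "length v = len (ev v)" using snoc.prems(2) by (auto simp: geodesic_def)
  have ev_v: "ev v = ev w \<otimes> a" using snoc.prems(3) a u w by (simp add: ev_append_S)
  have wu: "length w \<le> length u" using len_le[OF u(1)] w by simp
  have 1: "(u @ [a], w @ [a]) \<in> (rewrite (length (u @ [a]) + \<kappa>))\<^sup>*"
    using rewrites_snoc[OF snoc.IH[OF u(1) gw w(3)[symmetric]] a(1)] by simp
  have vw: "length v \<le> Suc (length w)"
    using len_mult[of "ev w" a] len_le[of "[a]"] a u w v ev_v by simp
  have d1: "d (ev w) (ev v) \<le> 1"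
    using len_le[of "[a]"] a u w ev_v by (simp add: word_dist_def m_assoc[symmetric])
  have wv: "length w \<le> Suc (length v)"
  proof -
    have "d (ev w) \<one> \<le> d (ev w) (ev v) + d (ev v) \<one>" using u w v(1) by (intro d_triangle) auto
    then show ?thesis using d1 geodesic_d(3)[OF gw le_refl] geodesic_d(3)[OF snoc.prems(2) le_refl] by simp
  qed
  have "d (ev (take t v)) (ev (take t (w @ [a]))) \<le> \<kappa>" if t: "t \<le> length (w @ [a])" for t
  proof (cases "t \<le> length w \<and> t \<le> length v")
    case True
    moreover have "d (ev v) (ev w) \<le> 1" using d1 d_sym u w v(1) by simp
    ultimately show ?thesis using fellow_travel[OF snoc.prems(2) gw, of t] by simp
  next
    \<comment> \<open>Either \<open>t\<close> is the full length, where both words are complete and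
      equal in the group, or \<open>v\<close> has ended one letter before \<open>w\<close>.\<close>
    case False
    have vwa: "ev v = ev (w @ [a])" using ev_v a w by (simp add: ev_append_S)
    have 2: "2 \<le> \<kappa>" by (simp add: \<kappa>_def)
    show ?thesis
    proof (cases "t = length (w @ [a])")
      case True
      have "ev (w @ [a]) \<in> carrier G" using vwa v(1) by (metis ev_S)
      then show ?thesis using True vw vwa by simp
    next
      case neq: False
      then have t': "t = length w" "length v < t" using False neq t wv by auto
      then have "take t v = v" "take t (w @ [a]) = w" by auto
      then show ?thesis using d1 d_sym[of "ev w" "ev v"] u w v(1) 2 by auto
    qed
  qed
  then have "(w @ [a], v) \<in> (rewrite (length (w @ [a]) + \<kappa>))\<^sup>*"
    using w a v vw ev_v by (intro rewrites_fellow_travelling) (auto simp: ev_append_S)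
  moreover have "rewrite (length (w @ [a]) + \<kappa>) \<subseteq> rewrite (length (u @ [a]) + \<kappa>)"
    using wu by (intro rewrite_mono) auto
  ultimately show ?case
    using 1 by (meson rtrancl_mono rtrancl_trans subsetD)
qed

text \<open>Both words are rewritten to a common geodesic, and the second chain is reversed.\<close>

lemma rewrites_equal_words:
  assumes "u \<in> lists S" "v \<in> lists S" "ev u = ev v" "length u \<le> n" "length v \<le> n"
  shows "(u, v) \<in> (rewrite (n + \<kappa>))\<^sup>*"
proof -
  obtain w where w: "w \<in> lists S" "length w = len (ev u)" "ev w = ev u"
    using ex_geodesic[of "ev u"] assms(1) by auto
  then have g: "geodesic w" by (simp add: geodesic_def)
  have *: "(x, w) \<in> (rewrite (n + \<kappa>))\<^sup>*" if "x \<in> lists S" "ev x = ev w" "length x \<le> n" for x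
    using rewrites_geodesic[OF that(1) g that(2)] rtrancl_mono[OF rewrite_mono, of "length x + \<kappa>" "n + \<kappa>"] that(3)
    by auto
  have "sym (rewrite (n + \<kappa>))" by (auto intro: symI rewrite_sym)
  then have "(w, v) \<in> (rewrite (n + \<kappa>))\<^sup>*"
    using *[of v] assms w by (metis sym_rtrancl symD)
  with *[of u] assms w show ?thesis by (auto intro: rtrancl_trans)
qed

theorem derivation_complete:
  fixes D :: "nat \<Rightarrow> nat \<Rightarrow> 'a list \<Rightarrow> bool"
  assumes p: "\<And>i. i \<le> N \<Longrightarrow> p i \<in> carrier G" and N: "N \<le> 2 ^ n" and K: "real K > 2 * \<delta> * n + 3"
    and edge: "\<And>i. i < N \<Longrightarrow> \<exists>u \<in> lists S. length u \<le> 1 \<and> p i \<otimes> ev u = p (Suc i) \<and> D i (Suc i) u"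
    and join: "\<And>i j k u v. D i j u \<Longrightarrow> D j k v \<Longrightarrow> length u \<le> K \<Longrightarrow> length v \<le> K \<Longrightarrow> D i k (u @ v)"
    and rew: "\<And>i j u v. D i j u \<Longrightarrow> (u, v) \<in> rewrite (2 * K + \<kappa>) \<Longrightarrow> D i j v"
    and ij: "i < j" "j \<le> N" "d (p i) (p j) \<le> K"
    and u: "u \<in> lists S" "length u \<le> 2 * K" "p i \<otimes> ev u = p j"
  shows "D i j u"
  using ij u
proof (induction "j - i" arbitrary: i j u rule: less_induct)
  case less
  have rews: "D i j v" if "D i j u'" "(u', v) \<in> (rewrite (2 * K + \<kappa>))\<^sup>*" for u' v
    using that(2,1) by (induction rule: rtrancl_induct) (auto intro: rew)
  have pij: "p i \<in> carrier G" "p j \<in> carrier G" using p less.prems by auto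
  have K1: "1 \<le> K"
  proof -
    have "0 \<le> 2 * \<delta> * n" using delta_nonneg by simp
    then show ?thesis using K by linarith
  qed
  \<comment> \<open>A single derivable word for the chord suffices; rewriting reaches every other
    one up to length \<open>2 * K\<close>.\<close>
  have transport: "D i j u" if "D i j v" "v \<in> lists S" "length v \<le> 2 * K" "p i \<otimes> ev v = p j" for v
  proof -
    have "ev v = ev u"
      using that less.prems(4,6) pij by (metis ev_S l_cancel)
    then show ?thesis
      using rews[OF that(1) rewrites_equal_words[of v u "2 * K"]] that less.prems by auto
  qed
  show ?case
  proof (cases "j = Suc i")
    case True
    then obtain v where v: "v \<in> lists S" "length v \<le> 1" "p i \<otimes> ev v = p j" "D i j v"
      using edge[of i] less.prems by auto
    have "length v \<le> 2 * K" using v(2) K1 by linarith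
    then show ?thesis by (rule transport[OF v(4) v(1) _ v(3)])
  next
    case False
    have step: "d (p k) (p (Suc k)) \<le> 1" if kN: "k < N" for k
    proof -
      obtain v where v: "v \<in> lists S" "length v \<le> 1" "p k \<otimes> ev v = p (Suc k)"
        using edge[OF kN] by auto
      have "inv (p k) \<otimes> (p k \<otimes> ev v) = ev v"
        using p[of k] kN v(1) by (simp add: m_assoc[symmetric])
      then have "inv (p k) \<otimes> p (Suc k) = ev v" by (simp only: v(3))
      then show ?thesis using len_le[OF v(1)] v(2) by (simp add: word_dist_def)
    qed
    have "\<exists>k. i < k \<and> k < j \<and> d (p i) (p k) \<le> K \<and> d (p k) (p j) \<le> K"
      by (rule interior_point[where n = n]) (use False less.prems p step K N in auto)
    then obtain k where k: "i < k" "k < j" "d (p i) (p k) \<le> K" "d (p k) (p j) \<le> K" by blast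
    have pk: "p k \<in> carrier G" using p k less.prems by auto
    obtain v where v: "v \<in> lists S" "length v = len (inv (p i) \<otimes> p k)" "ev v = inv (p i) \<otimes> p k"
      using ex_geodesic[of "inv (p i) \<otimes> p k"] pij pk by auto
    obtain w where w: "w \<in> lists S" "length w = len (inv (p k) \<otimes> p j)" "ev w = inv (p k) \<otimes> p j"
      using ex_geodesic[of "inv (p k) \<otimes> p j"] pij pk by auto
    have lens: "length v \<le> K" "length w \<le> K" using v w k by (auto simp: word_dist_def)
    have ivk: "p i \<otimes> ev v = p k" "p k \<otimes> ev w = p j" using v w pij pk by (auto simp: m_assoc[symmetric])
    have "D i k v" by (rule less.hyps) (use k less.prems v(1) lens ivk in auto)
    moreover have "D k j w" by (rule less.hyps) (use k less.prems w(1) lens ivk in auto)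
    ultimately have "D i j (v @ w)" using join lens by blast
    moreover have "p i \<otimes> ev (v @ w) = p j"
      using v(1) w(1) ivk pij by (simp add: ev_append_S m_assoc[symmetric])
    ultimately show ?thesis
      using transport[of "v @ w"] v(1) w(1) lens by simp
  qed
qed

end

section \<open>The saturation algorithm\<close>

definition upto_list :: "nat \<Rightarrow> nat list" where
  "upto_list n = ((\<lambda>xs. length xs # xs) ^^ n) []"

lemma length_upto_list [simp]: "length (upto_list n) = n"
  by (induction n) (auto simp: upto_list_def)

lemma set_upto_list [simp]: "set (upto_list n) = {..<n}"
  using length_upto_list unfolding upto_list_def by (induction n) (auto simp: lessThan_Suc)

lemma ptime_upto_list [ptime_intros]:
  assumes "ptime n"
  shows "ptime (\<lambda>e. upto_list (n e))"
  unfolding upto_list_def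
proof (rule ptime_funpow[where S = "\<lambda>e. sz (n e) * (2 * sz (n e) + 2) + 1"])
  fix e i assume i: "i \<le> n e"
  have "sz (upto_list i) \<le> i * (2 * i + 2) + 1" for i
  proof (induction i)
    case (Suc i)
    have "upto_list (Suc i) = i # upto_list i"
      using length_upto_list[of i] by (simp add: upto_list_def)
    then show ?case using Suc by (simp add: sz_nat algebra_simps)
  qed (simp add: upto_list_def)
  from this[of i] have "sz (upto_list i) \<le> i * (2 * i + 2) + 1" .
  also have "\<dots> \<le> sz (n e) * (2 * sz (n e) + 2) + 1"
    using i by (intro add_mono mult_mono) (auto simp: sz_nat)
  finally show "sz (((\<lambda>xs. length xs # xs) ^^ i) []) \<le> sz (n e) * (2 * sz (n e) + 2) + 1"
    by (simp add: upto_list_def)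
qed (intro ptime_intros assms pbd_add pbd_mult pbd_const ptime_pbd)+

definition sufs :: "'a list \<Rightarrow> 'a list list" where
  "sufs xs = map (\<lambda>k. (tl ^^ k) xs) (upto_list (Suc (length xs)))"

lemma funpow_tl [simp]: "(tl ^^ k) xs = drop k xs"
  by (induction k) (auto simp: tl_drop drop_Suc)

lemma set_sufs: "set (sufs xs) = {t. \<exists>u. xs = u @ t}"
proof
  show "set (sufs xs) \<subseteq> {t. \<exists>u. xs = u @ t}"
    unfolding sufs_def by (auto, metis append_take_drop_id)
  show "{t. \<exists>u. xs = u @ t} \<subseteq> set (sufs xs)"
  proof safe
    fix t u assume "xs = u @ t"
    then show "t \<in> set (sufs (u @ t))"
      unfolding sufs_def by (simp add: image_iff) (rule bexI[of _ "length u"], auto)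
  qed
qed

lemma sz_drop: "sz (drop k xs) \<le> sz xs"
proof (induction xs arbitrary: k)
  case (Cons x xs)
  show ?case using Cons[of "k - 1"] by (cases k) auto
qed simp

lemma ptime_sufs [ptime_intros]:
  assumes "ptime f"
  shows "ptime (\<lambda>e. sufs (f e))"
proof -
  have "ptime (\<lambda>p. (tl ^^ snd p) (f (fst p)))"
  proof (rule ptime_funpow[where S = "\<lambda>p. sz (f (fst p))"])
    show "ptime (\<lambda>p. f (fst p))" by (rule ptime_comp[OF assms ptime_fst[OF ptime_id]])
    then show "pbd (\<lambda>p. sz (f (fst p)))" by (rule ptime_pbd)
  qed (intro ptime_intros | simp add: sz_drop)+
  then show ?thesis unfolding sufs_def by (intro ptime_intros assms)
qed

definition extend_words :: "'l list \<Rightarrow> 'l list list \<Rightarrow> 'l list list" where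
  "extend_words A W = [] # concat (map (\<lambda>a. map (Cons a) W) A)"

text \<open>All words whose length is below a bound that is logarithmic in \<open>B\<close>; the guard keeps the number of words
  linear in \<open>B\<close>.\<close>

definition words :: "'l list \<Rightarrow> nat \<Rightarrow> 'l list list" where
  "words A B = ((\<lambda>W. if length W \<le> B then extend_words A W else W) ^^ B) [[]]"

lemma length_extend_words: "length (extend_words A W) = Suc (length A * length W)"
  by (simp add: extend_words_def length_concat comp_def sum_list_triv)

lemma sz_word: "set w \<subseteq> set A \<Longrightarrow> sz w \<le> length w * sz A + 1"
proof (induction w)
  case (Cons a w)
  then show ?case using sz_mem[of a A] by auto
qed simp

lemma ptime_words [ptime_intros]:
  fixes A :: "'l::enc list"
  assumes "ptime B"
  shows "ptime (\<lambda>e. words A (B e))"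
  unfolding words_def
proof (rule ptime_funpow[where S = "\<lambda>e. (1 + length A * sz (B e)) * (sz (B e) * sz A + 2) + 1"])
  show "pbd (\<lambda>e. (1 + length A * sz (B e)) * (sz (B e) * sz A + 2) + 1)"
    by (intro pbd_add pbd_mult pbd_const ptime_pbd assms)
  show "ptime (\<lambda>p. if length (snd p) \<le> B (fst p) then extend_words A (snd p) else snd p)"
    unfolding extend_words_def
    by (intro ptime_intros ptime_comp[OF assms ptime_fst[OF ptime_id]])
  fix e i assume i: "i \<le> B e"
  define W where "W i = ((\<lambda>W. if length W \<le> B e then extend_words A W else W) ^^ i) [[]]" for i
  have len: "length (W i) \<le> 1 + length A * B e" for i
    by (induction i) (auto simp: W_def length_extend_words)
  have mem: "set w \<subseteq> set A \<and> length w \<le> i" if "w \<in> set (W i)" for w i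
    using that by (induction i arbitrary: w) (auto simp: W_def extend_words_def split: if_splits, force+)
  have "sz (W i) = Suc (\<Sum>w\<leftarrow>W i. Suc (sz w))" by (rule sz_list)
  also have "(\<Sum>w\<leftarrow>W i. Suc (sz w)) \<le> (\<Sum>w\<leftarrow>W i. B e * sz A + 2)"
  proof (rule sum_list_mono)
    fix w assume "w \<in> set (W i)"
    then have "sz w \<le> length w * sz A + 1" "length w \<le> B e"
      using mem[of w i] i sz_word[of w A] by auto
    then show "Suc (sz w) \<le> B e * sz A + 2"
      using mult_le_mono1[of "length w" "B e" "sz A"] by linarith
  qed
  also have "\<dots> = length (W i) * (B e * sz A + 2)" by (simp add: sum_list_triv)
  also have "\<dots> \<le> (1 + length A * sz (B e)) * (sz (B e) * sz A + 2)"
    using len[of i] by (intro mult_mono) (auto simp: sz_nat intro: le_trans)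
  finally show "sz (W i) \<le> (1 + length A * sz (B e)) * (sz (B e) * sz A + 2) + 1" by simp
qed (intro ptime_intros assms)+

lemma words_subset: "w \<in> set (words A B) \<Longrightarrow> set w \<subseteq> set A"
proof -
  have "w \<in> set (((\<lambda>W. if length W \<le> B then extend_words A W else W) ^^ i) [[]]) \<Longrightarrow> set w \<subseteq> set A" for w i
    by (induction i arbitrary: w) (fastforce simp: extend_words_def split: if_splits)+
  then show "w \<in> set (words A B) \<Longrightarrow> set w \<subseteq> set A" unfolding words_def .
qed

text \<open>Without the guard, round \<open>i\<close> yields all words of length at most
  \<open>i\<close> in a list of at most \<open>(length A + 2) ^ i\<close> entries, so the guard
  cannot stop the growth before round \<open>n\<close>. A base of at least 2 makes the argument work
  for alphabets with fewer than two letters as well.\<close>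

lemma words_complete:
  assumes "(length A + 2) ^ n \<le> B" "set w \<subseteq> set A" "length w \<le> n"
  shows "w \<in> set (words A B)"
proof -
  define F where "F i = (extend_words A ^^ i) [[]]" for i
  define W where "W i = ((\<lambda>W. if length W \<le> B then extend_words A W else W) ^^ i) [[]]" for i
  have F: "w \<in> set (F i)" if "set w \<subseteq> set A" "length w \<le> i" for w i
    using that
  proof (induction i arbitrary: w)
    case (Suc i w)
    show ?case by (cases w) (use Suc in \<open>auto simp: F_def extend_words_def\<close>)
  qed (simp add: F_def)
  have len: "length (F i) \<le> (length A + 2) ^ i" for i
  proof (induction i)
    case (Suc i)
    have "length (F (Suc i)) = Suc (length A * length (F i))" by (simp add: F_def length_extend_words)
    also have "\<dots> \<le> (length A + 2) ^ i + length A * (length A + 2) ^ i"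
      using mult_le_mono2[OF Suc, of "length A"] one_le_power[of "length A + 2" i] by linarith
    also have "\<dots> \<le> (length A + 2) ^ Suc i" by (simp add: algebra_simps)
    finally show ?case .
  qed (simp add: F_def)
  \<comment> \<open>The guarded list follows the unguarded one until the guard fails, and from then
    on it no longer changes.\<close>
  have "\<exists>i. W j = F i \<and> (i = j \<or> B < length (F i))" for j
  proof (induction j)
    case 0
    show ?case by (rule exI[of _ 0]) (simp add: W_def F_def)
  next
    case (Suc j)
    then obtain i where i: "W j = F i" "i = j \<or> B < length (F i)" by blast
    have "W (Suc j) = (if length (W j) \<le> B then extend_words A (W j) else W j)" by (simp add: W_def)
    then show ?case using i by (cases "length (F i) \<le> B") (auto simp: F_def intro: exI[of _ "Suc i"])
  qed
  then obtain i where i: "W B = F i" "i = B \<or> B < length (F i)" by blast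
  have "n \<le> i"
  proof (rule ccontr)
    assume "\<not> n \<le> i"
    have "i < (2::nat) ^ i" by simp
    also have "\<dots> \<le> (length A + 2) ^ i" by (intro power_mono) auto
    finally have "i < (length A + 2) ^ i" .
    moreover have "(length A + 2) ^ i < (length A + 2) ^ n"
      using \<open>\<not> n \<le> i\<close> by (intro power_strict_increasing) auto
    ultimately show False using i(2) len[of i] assms(1) by linarith
  qed
  then show ?thesis using F[of w i] assms i(1) by (auto simp: W_def words_def)
qed

text \<open>A vertex \<open>(t, r)\<close> stands for a generator of which the suffix \<open>t\<close> is still to be read, after which \<open>r - 1\<close>
  further generators and then the word \<open>gi\<close> for the inverse of the target may follow; \<open>r = 0\<close> means that
  \<open>gi\<close> itself is being read.\<close>

type_synonym 'l vertex = "'l list \<times> nat"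
type_synonym 'l fact = "'l vertex \<times> 'l list \<times> 'l vertex"

text \<open>Counter 0 is reserved for \<open>gi\<close>, so the start \<open>([], Suc m)\<close>
  leaves \<open>m\<close> counter values for generators. A walk may turn to \<open>gi\<close> at any
  positive counter, which accounts for products of fewer than \<open>m\<close> factors.\<close>

definition edge :: "'l list \<Rightarrow> 'l list list \<Rightarrow> 'l list \<Rightarrow> 'l vertex \<Rightarrow> 'l list \<Rightarrow> 'l vertex \<Rightarrow> bool" where
  "edge A gs gi p u q \<longleftrightarrow>
     list_ex (\<lambda>a. fst p = a # fst q \<and> u = [a] \<and> snd p = snd q) A \<or>
     (fst p = [] \<and> u = [] \<and>
       (fst q \<in> set gs \<and> snd p = Suc (snd q) \<and> snd q \<noteq> 0 \<or> fst q = gi \<and> snd p \<noteq> 0 \<and> snd q = 0))"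

definition join :: "'l fact list \<Rightarrow> 'l fact \<Rightarrow> bool" where
  "join F f \<longleftrightarrow> list_ex (\<lambda>f1. list_ex (\<lambda>f2. fst f1 = fst f \<and> snd (snd f1) = fst f2 \<and>
     snd (snd f2) = snd (snd f) \<and> fst (snd f) = fst (snd f1) @ fst (snd f2)) F) F"

definition rewrites_to :: "('l list \<times> 'l list) list \<Rightarrow> 'l list list \<Rightarrow> 'l list \<Rightarrow> 'l list \<Rightarrow> bool" where
  "rewrites_to R W u v \<longleftrightarrow> list_ex (\<lambda>x. list_ex (\<lambda>y. list_ex (\<lambda>lr.
     u = x @ fst lr @ y \<and> v = x @ snd lr @ y) R) W) W"

definition derives where
  "derives A R gs gi W F f \<longleftrightarrow> edge A gs gi (fst f) (fst (snd f)) (snd (snd f)) \<or> join F f \<or>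
     list_ex (\<lambda>f1. fst f1 = fst f \<and> snd (snd f1) = snd (snd f) \<and> rewrites_to R W (fst (snd f1)) (fst (snd f))) F"

definition vertices :: "'l list list \<Rightarrow> nat \<Rightarrow> 'l vertex list" where
  "vertices gs m = concat (map (\<lambda>t. map (\<lambda>r. (t, r)) (upto_list (m + 2))) (concat (map sufs gs)))"

definition all_facts :: "'l vertex list \<Rightarrow> 'l list list \<Rightarrow> 'l fact list" where
  "all_facts V W = concat (map (\<lambda>p. concat (map (\<lambda>u. map (\<lambda>q. (p, u, q)) V) W)) V)"

text \<open>Every round filters the fixed list \<open>U\<close>, so the intermediate results stay
  below the size of \<open>U\<close>, as iteration in polynomial time requires.\<close>

definition saturate :: "('f list \<Rightarrow> 'f \<Rightarrow> bool) \<Rightarrow> 'f list \<Rightarrow> 'f list" where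
  "saturate P U = ((\<lambda>F. filter (\<lambda>f. f \<in> set F \<or> P F f) U) ^^ length U) []"

text \<open>The tested fact says that some product, followed by the inverse of the target, spells
  the identity: its label is the empty word.\<close>

definition solve where
  "solve A R gs gi m B =
     ((([], Suc m), [], ([], 0)) \<in> set (saturate (derives A R gs gi (words A B))
       (all_facts (vertices (gi # gs) m) (words A B))))"

lemma sz_filter: "sz (filter P xs) \<le> sz xs"
  by (induction xs) auto

lemma ptime_saturate:
  fixes U :: "'e::enc \<Rightarrow> 'f::enc list"
  assumes U: "ptime U" and P: "ptime (\<lambda>p. P (fst (fst p)) (snd (fst p)) (snd p))"
  shows "ptime (\<lambda>e. saturate (P e) (U e))"
  unfolding saturate_def
proof (rule ptime_funpow[where S = "\<lambda>e. sz (U e)"])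
  have "ptime (\<lambda>p. filter (\<lambda>f. f \<in> set (snd p) \<or> P (fst p) (snd p) f) (U (fst p)))"
    by (intro ptime_intros P ptime_comp[OF U ptime_fst[OF ptime_id]])
  then show "ptime (\<lambda>p. filter (\<lambda>f. f \<in> set (snd p) \<or> P (fst p) (snd p) f) (U (fst p)))" .
  show "sz (((\<lambda>F. filter (\<lambda>f. f \<in> set F \<or> P e F f) (U e)) ^^ i) []) \<le> sz (U e)" for e i
    using sz_pos[of "U e"] by (cases i) (auto intro: sz_filter)
qed (intro ptime_intros ptime_pbd U)+

text \<open>The alphabet and the relators depend on the group only; they are constants of the
  program and not part of its input.\<close>

lemma ptime_solve:
  fixes A :: "'l::enc list"
  shows "ptime (\<lambda>e. solve A R (fst e) (fst (snd e)) (fst (snd (snd e))) (snd (snd (snd e))))"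
  unfolding solve_def derives_def edge_def join_def rewrites_to_def vertices_def all_facts_def
  by (intro ptime_intros ptime_saturate)

lemma saturate_induct:
  assumes "f \<in> set (saturate P U)"
    and "\<And>F f. f \<in> set U \<Longrightarrow> (\<And>g. g \<in> set F \<Longrightarrow> Q g) \<Longrightarrow> P F f \<Longrightarrow> Q f"
  shows "Q f"
proof -
  have "f \<in> set (((\<lambda>F. filter (\<lambda>f. f \<in> set F \<or> P F f) U) ^^ i) []) \<Longrightarrow> Q f" for i f
  proof (induction i arbitrary: f)
    case (Suc i)
    then show ?case using assms(2)[of f] by (auto simp del: funpow.simps simp: funpow.simps(2))
  qed simp
  then show ?thesis using assms(1) unfolding saturate_def by blast
qed

text \<open>As long as nothing is stable, each round adds a fact, and there are at most \<open>length U\<close> of them.\<close>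

lemma saturate_closed:
  assumes mono: "\<And>F F' f. P F f \<Longrightarrow> set F \<subseteq> set F' \<Longrightarrow> P F' f"
    and f: "f \<in> set U" "P (saturate P U) f"
  shows "f \<in> set (saturate P U)"
proof -
  define F where "F i = ((\<lambda>F. filter (\<lambda>f. f \<in> set F \<or> P F f) U) ^^ i) []" for i
  have F_Suc: "set (F (Suc i)) = {f \<in> set U. f \<in> set (F i) \<or> P (F i) f}" for i
    by (auto simp: F_def)
  have F_U: "set (F i) \<subseteq> set U" for i
    by (cases i) (auto simp: F_def)
  have sub: "set (F i) \<subseteq> set (F (Suc i))" for i
    using F_U[of i] by (auto simp: F_Suc)
  have "(\<exists>j \<le> i. set (F j) = set (F (Suc j))) \<or> i \<le> card (set (F i))" for i
  proof (induction i)
    case (Suc i)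
    show ?case
    proof (cases "\<exists>j \<le> Suc i. set (F j) = set (F (Suc j))")
      case False
      then have "i \<le> card (set (F i))" using Suc by (meson le_SucI)
      moreover have "set (F i) \<noteq> set (F (Suc i))" using False by (meson le_SucI order_refl)
      then have "set (F i) \<subset> set (F (Suc i))" using sub[of i] by blast
      then have "card (set (F i)) < card (set (F (Suc i)))" by (intro psubset_card_mono) auto
      ultimately show ?thesis by simp
    qed simp
  qed simp
  then consider j where "j \<le> length U" "set (F j) = set (F (Suc j))" | "length U \<le> card (set (F (length U)))"
    by blast
  then have "set (F (Suc (length U))) \<subseteq> set (F (length U))"
  proof cases
    case 1
    \<comment> \<open>Monotonicity in both directions shows that \<open>P\<close> depends only on
      the set of facts, so a round without new facts is followed by no other.\<close>
    have "set (F (j + k)) = set (F j)" for k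
    proof (induction k)
      case (Suc k)
      then have "set (F (Suc (j + k))) = set (F (Suc j))"
        using mono[of "F (j + k)" _ "F j"] mono[of "F j" _ "F (j + k)"] by (auto simp: F_Suc)
      then show ?case using 1 by simp
    qed simp
    from this[of "length U - j"] this[of "Suc (length U) - j"] show ?thesis using 1 by simp
  next
    case 2
    then have "card (set U) \<le> card (set (F (length U)))"
      using card_length[of U] by linarith
    then have "set (F (length U)) = set U"
      using F_U by (intro card_seteq) auto
    then show ?thesis using F_U by auto
  qed
  moreover have "saturate P U = F (length U)" by (simp add: saturate_def F_def)
  ultimately show ?thesis using f by (auto simp: F_Suc)
qed

text \<open>In the application \<open>n\<close> is the length of the input, \<open>c\<close> the
  stretching factor of its letters, \<open>a\<close> the number of generating letters, and
  \<open>k\<close> is \<kappa>. Both \<open>L\<close> and \<open>K\<close> can be chosen logarithmic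
  in \<open>n\<close>, so the words of length at most \<open>2 * K + k\<close> are polynomially
  many, with one exponent for all \<open>n\<close>.\<close>

lemma ex_parameters:
  fixes \<delta> :: real and a c k :: nat
  assumes "0 \<le> \<delta>"
  shows "\<exists>E. \<forall>n. \<exists>L K. (n + 1) * (c * n + 2) \<le> 2 ^ L \<and> real K > 2 * \<delta> * L + 3 \<and>
    (a + 2) ^ (2 * K + k) \<le> (n + 2) ^ E"
proof -
  define D where "D = nat \<lceil>2 * \<delta>\<rceil>"
  have D: "2 * \<delta> \<le> D" unfolding D_def using real_nat_ceiling_ge[of "2 * \<delta>"] .
  \<comment> \<open>With the choices of \<open>L\<close> and \<open>K\<close> below,
    \<open>2 * K + k\<close> equals \<open>4 * D * l + C\<close>; the factor 2 in \<open>E\<close>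
    comes from \<open>2 ^ l \<le> (n + 2) ^ 2\<close>.\<close>
  define C where "C = 2 * D * (c + 2) + 8 + k"
  define E where "E = 2 * ((a + 2) * (4 * D)) + (a + 2) * C"
  have "\<exists>L K. (n + 1) * (c * n + 2) \<le> 2 ^ L \<and> real K > 2 * \<delta> * L + 3 \<and> (a + 2) ^ (2 * K + k) \<le> (n + 2) ^ E" for n
  proof -
    \<comment> \<open>The binary logarithm of \<open>n + 2\<close>, rounded up.\<close>
    define l where "l = (LEAST l. n + 2 \<le> 2 ^ l)"
    have ex: "\<exists>l. n + 2 \<le> (2::nat) ^ l" by (metis less_exp less_imp_le)
    have l1: "n + 2 \<le> 2 ^ l" unfolding l_def using LeastI_ex[OF ex] .
    have "l \<noteq> 0" using l1 by (cases l) auto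
    then have "\<not> n + 2 \<le> 2 ^ (l - 1)" unfolding l_def by (intro not_less_Least) auto
    then have "2 ^ l \<le> 2 * (n + 2)" using \<open>l \<noteq> 0\<close> by (cases l) auto
    also have "\<dots> \<le> (n + 2) * (n + 2)" by (intro mult_right_mono) auto
    finally have l2: "2 ^ l \<le> (n + 2) ^ 2" by (simp add: power2_eq_square)
    define L where "L = 2 * l + (c + 2)"
    define K where "K = D * L + 4"
    have "(n + 1) * (c * n + 2) \<le> (n + 2) * ((c + 2) * (n + 2))"
      by (intro mult_mono) (auto simp: algebra_simps)
    also have "\<dots> \<le> 2 ^ l * (2 ^ (c + 2) * 2 ^ l)"
      by (intro mult_mono l1 less_imp_le[OF less_exp]) auto
    also have "\<dots> = 2 ^ L" proof -
      have "L = l + ((c + 2) + l)" by (simp add: L_def)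
      then show ?thesis by (simp only: power_add)
    qed
    finally have 1: "(n + 1) * (c * n + 2) \<le> 2 ^ L" .
    have "2 * \<delta> * L \<le> real D * L" using D by (intro mult_right_mono) auto
    then have 2: "real K > 2 * \<delta> * L + 3" by (simp add: K_def)
    have "(a + 2) ^ (2 * K + k) \<le> (2 ^ (a + 2)) ^ (2 * K + k)"
      by (intro power_mono less_imp_le[OF less_exp]) auto
    also have "\<dots> = (2 ^ l) ^ ((a + 2) * (4 * D)) * 2 ^ ((a + 2) * C)"
    proof -
      have "(a + 2) * (2 * K + k) = l * ((a + 2) * (4 * D)) + (a + 2) * C"
        by (simp add: K_def L_def C_def algebra_simps)
      then show ?thesis by (metis power_add power_mult)
    qed
    also have "\<dots> \<le> ((n + 2) ^ 2) ^ ((a + 2) * (4 * D)) * (n + 2) ^ ((a + 2) * C)"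
      by (intro mult_mono power_mono l2) auto
    also have "\<dots> = (n + 2) ^ E" by (simp only: E_def power_add power_mult)
    finally have 3: "(a + 2) ^ (2 * K + k) \<le> (n + 2) ^ E" .
    show ?thesis using 1 2 3 by blast
  qed
  then show ?thesis by blast
qed

section \<open>The graph of partially read products\<close>

lemma mem_vertices: "(t, r) \<in> set (vertices gs m) \<longleftrightarrow> (\<exists>g \<in> set gs. \<exists>u. g = u @ t) \<and> r \<le> Suc m"
  by (fastforce simp: vertices_def set_sufs less_Suc_eq_le)

lemma mem_all_facts: "(p, u, q) \<in> set (all_facts V W) \<longleftrightarrow> p \<in> set V \<and> u \<in> set W \<and> q \<in> set V"
  by (auto simp: all_facts_def)

lemma edge_cases:
  assumes "edge A gs gi p u q"
  obtains a t r where "a \<in> set A" "p = (a # t, r)" "u = [a]" "q = (t, r)"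
  | t r where "t \<in> set gs" "p = ([], Suc r)" "u = []" "q = (t, r)" "r \<noteq> 0"
  | r where "p = ([], r)" "u = []" "q = (gi, 0)" "r \<noteq> 0"
  using assms unfolding edge_def list_ex_iff by (cases p; cases q) auto

lemma edge_vertices:
  assumes "edge A gs gi p u q" "p \<in> set (vertices (gi # gs) m)"
  shows "q \<in> set (vertices (gi # gs) m)"
  using assms(1)
proof (cases rule: edge_cases)
  case (1 a t r)
  then obtain g v where "g \<in> set (gi # gs)" "g = v @ a # t" "r \<le> Suc m"
    using assms(2) by (auto simp: mem_vertices)
  moreover have "v @ a # t = (v @ [a]) @ t" by simp
  ultimately show ?thesis unfolding 1 mem_vertices by metis
next
  case (2 t r)
  moreover have "t = [] @ t" by simp
  ultimately show ?thesis using assms(2) unfolding 2 mem_vertices by fastforce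
next
  case (3 r)
  moreover have "gi = [] @ gi" by simp
  ultimately show ?thesis unfolding 3 mem_vertices by fastforce
qed

text \<open>An edge lowers the counter or, at the same counter, shortens the unread suffix. The
  weight \<open>l + 2\<close> exceeds the length of every word that can be started, so each edge
  lowers the value, which therefore bounds the length of a walk; at the start it is
  \<open>(m + 1) * (l + 2)\<close>.\<close>

definition potential :: "nat \<Rightarrow> 'l vertex \<Rightarrow> nat" where
  "potential l p = snd p * (l + 2) + length (fst p)"

lemma edge_potential:
  assumes "edge A gs gi p u q" "\<And>t. t \<in> set (gi # gs) \<Longrightarrow> length t \<le> l"
  shows "potential l q < potential l p"
  using assms(1)
proof (cases rule: edge_cases)
  case (2 t r)
  then show ?thesis using assms(2)[of t] by (simp add: potential_def)
next
  case (3 r)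
  then show ?thesis using assms(2)[of gi] by (cases r) (auto simp: potential_def)
qed (simp add: potential_def)

lemma derives_mono:
  assumes "derives A R gs gi W F f" "set F \<subseteq> set F'"
  shows "derives A R gs gi W F' f"
  using assms unfolding derives_def join_def list_ex_iff by blast

text \<open>Programs work on encodable data, which elements of \<open>G\<close> need not be; a
  generator is therefore represented by its position in \<open>letters\<close>.\<close>

locale hyperbolic_solver = hyperbolic_word_metric +
  fixes letters :: "'a list"
  assumes letters: "set letters = S" and distinct_letters: "distinct letters"
begin

definition val :: "nat \<Rightarrow> 'a" where
  "val i = letters ! i"

definition cd :: "'a \<Rightarrow> nat" where
  "cd x = (SOME i. i < length letters \<and> letters ! i = x)"

definition A :: "nat list" where
  "A = [0..<length letters]"

definition R :: "(nat list \<times> nat list) list" where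
  "R = (SOME R. set R = (\<lambda>(l, r). (map cd l, map cd r)) ` relators)"

abbreviation evn :: "nat list \<Rightarrow> 'a" where
  "evn w \<equiv> ev (map val w)"

lemma set_A [simp]: "set A = {..<length letters}"
  by (auto simp: A_def)

lemma cd:
  assumes "x \<in> S"
  shows "cd x \<in> set A \<and> val (cd x) = x"
proof -
  have "\<exists>i. i < length letters \<and> letters ! i = x"
    using assms letters by (auto simp: in_set_conv_nth)
  from someI_ex[OF this] show ?thesis by (simp add: cd_def val_def)
qed

lemma cd_val: "a \<in> set A \<Longrightarrow> cd (val a) = a"
  using distinct_letters by (auto simp: cd_def val_def nth_eq_iff_index_eq cong: conj_cong)

lemma val_S: "i \<in> set A \<Longrightarrow> val i \<in> S"
  unfolding letters[symmetric] by (simp add: val_def)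

lemma map_val_S: "w \<in> lists (set A) \<Longrightarrow> map val w \<in> lists S"
  using val_S by (induction w) simp_all

lemma map_cd: "w \<in> lists S \<Longrightarrow> map cd w \<in> lists (set A) \<and> map val (map cd w) = w"
  by (induction w) (simp_all add: cd del: set_A)

lemma evn_closed [simp, intro]: "w \<in> lists (set A) \<Longrightarrow> evn w \<in> carrier G"
  using map_val_S by blast

lemma evn_append: "v \<in> lists (set A) \<Longrightarrow> w \<in> lists (set A) \<Longrightarrow> evn (v @ w) = evn v \<otimes> evn w"
  using map_val_S ev_append_S by simp

lemma set_R: "set R = (\<lambda>(l, r). (map cd l, map cd r)) ` relators"
  unfolding R_def using finite_list[OF finite_imageI[OF finite_relators]] by (rule someI_ex)

lemma R_D:
  assumes "(l, r) \<in> set R"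
  shows "l \<in> lists (set A)" "r \<in> lists (set A)" "evn l = evn r"
proof -
  obtain u v where "(u, v) \<in> relators" "l = map cd u" "r = map cd v"
    using assms by (auto simp: set_R)
  then show "l \<in> lists (set A)" "r \<in> lists (set A)" "evn l = evn r"
    using map_cd[of u] map_cd[of v] unfolding relators_def by auto
qed

section \<open>Soundness and completeness of the saturation\<close>

inductive path :: "nat list list \<Rightarrow> nat list \<Rightarrow> nat vertex \<Rightarrow> 'a \<Rightarrow> nat vertex \<Rightarrow> bool" for gs gi where
  path_Nil: "path gs gi p \<one> p"
| path_Cons: "edge A gs gi p u q \<Longrightarrow> path gs gi q x r \<Longrightarrow> path gs gi p (evn u \<otimes> x) r"

lemma edge_word: "edge A gs gi p u q \<Longrightarrow> u \<in> lists (set A) \<and> length u \<le> 1"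
  by (erule edge_cases) auto

lemma path_closed: "path gs gi p x q \<Longrightarrow> x \<in> carrier G"
  by (induction rule: path.induct) (use edge_word in auto)

lemma path_edge: "edge A gs gi p u q \<Longrightarrow> path gs gi p (evn u) q"
  using path_Cons[OF _ path_Nil, of gs gi p u q] edge_word[of gs gi p u q] by auto

lemma path_trans: "path gs gi p x q \<Longrightarrow> path gs gi q y r \<Longrightarrow> path gs gi p (x \<otimes> y) r"
proof (induction rule: path.induct)
  case (path_Nil p)
  then show ?case using path_closed by fastforce
next
  case (path_Cons p u q x s)
  then have "path gs gi p (evn u \<otimes> (x \<otimes> y)) r"
    by (intro path.path_Cons) auto
  moreover have "evn u \<in> carrier G" "x \<in> carrier G" "y \<in> carrier G"
    using path_Cons edge_word path_closed by blast+
  ultimately show ?case by (simp add: m_assoc)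
qed

lemma path_word:
  assumes "t \<in> lists (set A)"
  shows "path gs gi (t, r) (evn t) ([], r)"
  using assms
proof (induction t rule: list.induct)
  case (Cons a t)
  then have "edge A gs gi (a # t, r) [a] (t, r)" by (auto simp: edge_def list_ex_iff simp del: set_A)
  moreover have "val a \<in> carrier G" using Cons.prems val_S[of a] S_closed by (auto simp del: set_A)
  ultimately show ?case using path.path_Cons[OF _ Cons.IH] Cons.prems by fastforce
qed (simp add: path_Nil)

lemma path_words:
  assumes "ws \<in> lists (set gs)" "length ws < r" "gs \<in> lists (lists (set A))" "gi \<in> lists (set A)"
  shows "path gs gi ([], r) (evn (concat ws) \<otimes> evn gi) ([], 0)"
  using assms(1,2)
proof (induction ws arbitrary: r rule: list.induct)
  case Nil
  then have "edge A gs gi ([], r) [] (gi, 0)" by (simp add: edge_def)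
  from path_Cons[OF this path_word[OF assms(4)]] show ?case using assms(4) by simp
next
  case (Cons w ws)
  then obtain r' where r': "r = Suc r'" "length ws < r'" by (cases r) auto
  have w: "w \<in> lists (set A)" and ws: "concat ws \<in> lists (set A)" "ws \<in> lists (set gs)"
    using Cons.prems(1) assms(3) by (auto simp del: set_A) (blast dest: subsetD)
  have "edge A gs gi ([], r) [] (w, r')" using r' Cons.prems by (auto simp: edge_def)
  from path_Cons[OF this path_trans[OF path_word[OF w] Cons.IH[OF ws(2) r'(2)]]]
  show ?case using w ws assms(4) by (simp add: evn_append m_assoc del: map_append set_A)
qed

text \<open>Strictly fewer than \<open>snd p\<close> generators follow, because counter 0 belongs to
  \<open>gi\<close>.\<close>

lemma path_sound:
  assumes "path gs gi p x q" "q = ([], 0)" "gs \<in> lists (lists (set A))" "gi \<in> lists (set A)"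
    "fst p \<in> lists (set A)"
  shows "if snd p = 0 then x = evn (fst p)
    else \<exists>ws \<in> lists (set gs). length ws < snd p \<and> x = evn (fst p) \<otimes> evn (concat ws) \<otimes> evn gi"
  using assms
proof (induction rule: path.induct)
  case (path_Nil p)
  then show ?case by simp
next
  case (path_Cons p u q x s)
  from path_Cons.hyps(1) show ?case
  proof (cases rule: edge_cases)
    case (1 a t r)
    then have t: "t \<in> lists (set A)" "val a \<in> carrier G" "evn t \<in> carrier G"
      using path_Cons.prems val_S S_closed by (auto simp del: set_A)
    have c: "evn (concat ws) \<in> carrier G" "evn gi \<in> carrier G" if "ws \<in> lists (set gs)" for ws
      using that path_Cons.prems(2,3) by (auto simp del: set_A intro!: evn_closed) (blast dest: subsetD)
    show ?thesis
    proof (cases "r = 0")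
      case True
      then show ?thesis using path_Cons.IH path_Cons.prems 1 t by simp
    next
      case False
      then obtain ws where ws: "ws \<in> lists (set gs)" "length ws < r"
        "x = evn t \<otimes> evn (concat ws) \<otimes> evn gi"
        using path_Cons.IH path_Cons.prems 1 t(1) by auto
      then have "evn u \<otimes> x = evn (fst p) \<otimes> evn (concat ws) \<otimes> evn gi"
        using 1 t c[OF ws(1)] by (simp add: m_assoc)
      then show ?thesis using ws False 1 by auto
    qed
  next
    case (2 t r)
    then have t: "t \<in> lists (set A)" using path_Cons.prems by auto
    obtain ws where ws: "ws \<in> lists (set gs)" "length ws < r" "x = evn t \<otimes> evn (concat ws) \<otimes> evn gi"
      using path_Cons.IH path_Cons.prems 2 t by auto
    have c: "concat ws \<in> lists (set A)"
      using ws(1) path_Cons.prems(2) by (auto simp del: set_A) (blast dest: subsetD)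
    have "evn u \<otimes> x = evn (fst p) \<otimes> evn (concat (t # ws)) \<otimes> evn gi"
      using 2 t c ws(3) path_Cons.prems(3) by (simp add: evn_append m_assoc del: map_append set_A)
    then show ?thesis using ws 2 by (auto intro!: bexI[of _ "t # ws"])
  next
    case (3 r)
    then have "x = evn gi" using path_Cons.IH path_Cons.prems by simp
    then show ?thesis using 3 evn_closed[OF path_Cons.prems(3)] by (auto intro!: bexI[of _ "[]"])
  qed
qed

text \<open>Every rule preserves the claim that a fact labels a path: joins concatenate paths, and
  the relators hold in \<open>G\<close>, so rewriting keeps the value of the label.\<close>

lemma solve_sound:
  assumes "solve A R gs gi m B" "gs \<in> lists (lists (set A))" "gi \<in> lists (set A)"
  shows "\<exists>ws \<in> lists (set gs). length ws \<le> m \<and> evn (concat ws) \<otimes> evn gi = \<one>"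
proof -
  let ?W = "words A B"
  let ?U = "all_facts (vertices (gi # gs) m) ?W"
  let ?Q = "\<lambda>f. fst (snd f) \<in> lists (set A) \<and> path gs gi (fst f) (evn (fst (snd f))) (snd (snd f))"
  have "?Q (([], Suc m), [], ([], 0))"
    using assms(1)[unfolded solve_def]
  proof (rule saturate_induct)
    fix F f assume f: "f \<in> set ?U" and F: "\<And>g. g \<in> set F \<Longrightarrow> ?Q g"
      and d: "derives A R gs gi ?W F f"
    obtain p u q where f_eq: "f = (p, u, q)" by (cases f) auto
    have u: "u \<in> lists (set A)"
      using f f_eq words_subset[of u A B] by (auto simp: mem_all_facts simp del: set_A)
    consider "edge A gs gi p u q" | "join F f"
      | u' where "(p, u', q) \<in> set F" "rewrites_to R ?W u' u"
      using d f_eq by (auto simp: derives_def list_ex_iff)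
    then have "path gs gi p (evn u) q"
    proof cases
      case 1
      then show ?thesis by (rule path_edge)
    next
      case 2
      then obtain v w r where vw: "(p, v, r) \<in> set F" "(r, w, q) \<in> set F" "u = v @ w"
        using f_eq by (auto simp: join_def list_ex_iff)
      have "evn u = evn v \<otimes> evn w"
        using F[OF vw(1)] F[OF vw(2)] vw(3) evn_append[of v w] by simp
      then show ?thesis
        using F[OF vw(1)] F[OF vw(2)] path_trans[of gs gi p "evn v" r "evn w" q] by simp
    next
      case 3
      then obtain x y l r where xy: "(l, r) \<in> set R" "u' = x @ l @ y" "u = x @ r @ y"
        by (auto simp: rewrites_to_def list_ex_iff)
      have *: "x \<in> lists (set A)" "y \<in> lists (set A)"
        using u xy(3) by auto
      have "evn u' = evn u"
        using * R_D[OF xy(1)] xy(2,3) by (simp add: evn_append del: map_append set_A)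
      then show ?thesis using F[OF 3(1)] by simp
    qed
    then show "?Q f" using f_eq u by simp
  qed
  then have "path gs gi ([], Suc m) \<one> ([], 0)" by simp
  from path_sound[OF this refl assms(2,3)] obtain ws where ws:
    "ws \<in> lists (set gs)" "length ws < Suc m" "\<one> = \<one> \<otimes> evn (concat ws) \<otimes> evn gi"
    by auto
  have "concat ws \<in> lists (set A)"
    using ws(1) assms(2) by (auto simp del: set_A) (blast dest: subsetD)
  then have "\<one> \<otimes> evn (concat ws) = evn (concat ws)" by (intro l_one evn_closed)
  with ws show ?thesis by (metis less_Suc_eq_le)
qed

text \<open>Two sequences in parallel: \<open>v\<close> runs through the graph, while
  \<open>P\<close> collects the partial products, which are the corners of the polygon in the
  group.\<close>

definition walk where
  "walk gs gi V p x q N v P \<longleftrightarrow> v 0 = p \<and> v N = q \<and> P 0 = \<one> \<and> P N = x \<and>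
    (\<forall>i \<le> N. v i \<in> V \<and> P i \<in> carrier G) \<and>
    (\<forall>i < N. \<exists>u. edge A gs gi (v i) u (v (Suc i)) \<and> P (Suc i) = P i \<otimes> evn u)"

lemma path_walk:
  assumes "path gs gi p x q" "\<And>t. t \<in> set (gi # gs) \<Longrightarrow> length t \<le> l" "p \<in> set (vertices (gi # gs) m)"
  shows "\<exists>N v P. walk gs gi (set (vertices (gi # gs) m)) p x q N v P \<and> N \<le> potential l p"
  using assms(1,3)
proof (induction rule: path.induct)
    case (path_Nil p)
    then show ?case by (intro exI[of _ "0::nat"] exI[of _ "\<lambda>i. p"] exI[of _ "\<lambda>i. \<one>"]) (auto simp: walk_def)
  next
    case (path_Cons p u q x r)
    obtain N v P where "walk gs gi (set (vertices (gi # gs) m)) q x r N v P" "N \<le> potential l q"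
      using path_Cons.IH[OF edge_vertices[OF path_Cons.hyps(1) path_Cons.prems]] by blast
    then have IH: "v 0 = q" "v N = r" "P 0 = \<one>" "P N = x" "N \<le> potential l q"
      "\<And>i. i \<le> N \<Longrightarrow> v i \<in> set (vertices (gi # gs) m) \<and> P i \<in> carrier G"
      "\<And>i. i < N \<Longrightarrow> \<exists>u. edge A gs gi (v i) u (v (Suc i)) \<and> P (Suc i) = P i \<otimes> evn u"
      unfolding walk_def by blast+
    have eu: "evn u \<in> carrier G" using edge_word[OF path_Cons.hyps(1)] by blast
    define v' where "v' = case_nat p v"
    define P' where "P' = case_nat \<one> (\<lambda>i. evn u \<otimes> P i)"
    have "\<exists>u. edge A gs gi (v' i) u (v' (Suc i)) \<and> P' (Suc i) = P' i \<otimes> evn u" if iN: "i < Suc N" for i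
    proof (cases i)
      case 0
      then show ?thesis using path_Cons.hyps(1) IH(1,3) eu by (auto simp: v'_def P'_def)
    next
      case (Suc j)
      then obtain w where w: "edge A gs gi (v j) w (v (Suc j))" "P (Suc j) = P j \<otimes> evn w"
        using IH(7)[of j] iN by auto
      moreover have "P j \<in> carrier G" "evn w \<in> carrier G"
        using IH(6)[of j] Suc iN edge_word[OF w(1)] by auto
      ultimately show ?thesis using Suc eu by (auto simp: v'_def P'_def m_assoc intro!: exI[of _ w])
    qed
    moreover have "v' i \<in> set (vertices (gi # gs) m) \<and> P' i \<in> carrier G" if "i \<le> Suc N" for i
      using IH(6)[of "i - 1"] that path_Cons.prems eu by (cases i) (auto simp: v'_def P'_def)
    moreover have "Suc N \<le> potential l p"
      using IH(5) edge_potential[OF path_Cons.hyps(1) assms(2)] by fastforce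
    ultimately show ?case
      using IH(1-4) by (intro exI[of _ "Suc N"] exI[of _ v'] exI[of _ P']) (auto simp: walk_def v'_def P'_def)
qed

text \<open>The polygon is closed, so the chord of its whole boundary has length 0 and is labelled
  by the empty word, which is the fact that \<open>solve\<close> tests. The saturated list satisfies
  the rules for \<open>D\<close> in \<open>derivation_complete\<close> because all words of length
  at most \<open>2 * K + \<kappa>\<close> are listed.\<close>

lemma solve_complete:
  assumes gs: "gs \<in> lists (lists (set A))" "gi \<in> lists (set A)"
    and l: "\<And>t. t \<in> set (gi # gs) \<Longrightarrow> length t \<le> l"
    and ws: "ws \<in> lists (set gs)" "length ws \<le> m" "evn (concat ws) \<otimes> evn gi = \<one>"
    and L: "(m + 1) * (l + 2) \<le> 2 ^ n" and K: "real K > 2 * \<delta> * n + 3"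
    and B: "(length letters + 2) ^ (2 * K + \<kappa>) \<le> B"
  shows "solve A R gs gi m B"
proof -
  let ?W = "words A B"
  let ?V = "vertices (gi # gs) m"
  define F where "F = saturate (derives A R gs gi ?W) (all_facts ?V ?W)"
  have W: "w \<in> set ?W" if "w \<in> lists (set A)" "length w \<le> 2 * K + \<kappa>" for w
    using words_complete[of A "2 * K + \<kappa>" B w] that B by (auto simp: A_def)
  have closed: "f \<in> set F" if "f \<in> set (all_facts ?V ?W)" "derives A R gs gi ?W F f" for f
    unfolding F_def by (rule saturate_closed) (use that derives_mono F_def in blast)+
  have start: "([], Suc m) \<in> set ?V" by (auto simp: mem_vertices)
  have path: "path gs gi ([], Suc m) \<one> ([], 0)"
    using path_words[OF ws(1) _ gs, of "Suc m"] ws by simp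
  have "\<exists>N v P. walk gs gi (set ?V) ([], Suc m) \<one> ([], 0) N v P \<and> N \<le> potential l ([] :: nat list, Suc m)"
    by (rule path_walk[OF path _ start]) (rule l)
  then obtain N v P where w: "walk gs gi (set ?V) ([], Suc m) \<one> ([], 0) N v P" and N: "N \<le> potential l ([] :: nat list, Suc m)"
    by blast
  then have v: "v 0 = ([], Suc m)" "v N = ([], 0)" "P 0 = \<one>" "P N = \<one>"
    and vP: "\<And>i. i \<le> N \<Longrightarrow> v i \<in> set ?V \<and> P i \<in> carrier G"
    and edges: "\<And>i. i < N \<Longrightarrow> \<exists>u. edge A gs gi (v i) u (v (Suc i)) \<and> P (Suc i) = P i \<otimes> evn u"
    unfolding walk_def by blast+
  define D where "D i j u \<longleftrightarrow> i \<le> N \<and> j \<le> N \<and> u \<in> lists S \<and> (v i, map cd u, v j) \<in> set F" for i j u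
  have D_I: "D i j u" if "i \<le> N" "j \<le> N" "u \<in> lists S" "length u \<le> 2 * K + \<kappa>"
    "derives A R gs gi ?W F (v i, map cd u, v j)" for i j u
    unfolding D_def using that vP map_cd[of u] W[of "map cd u"]
    by (auto intro!: closed simp: mem_all_facts simp del: set_A)
  have "0 \<le> 2 * \<delta> * n" using delta_nonneg by simp
  then have K1: "1 \<le> K" using K by linarith
  have "0 < N" using v by (cases N) auto
  have "D 0 N []"
  proof (rule derivation_complete[where p = P and N = N and n = n and K = K])
    show "N \<le> 2 ^ n" using N L by (simp add: potential_def)
  next
    fix i assume i: "i < N"
    then obtain u where u: "edge A gs gi (v i) u (v (Suc i))" "P (Suc i) = P i \<otimes> evn u" using edges by blast
    note uw = edge_word[OF u(1)]
    have "map cd (map val u) = u"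
      using uw cd_val by (auto intro!: map_idI simp del: set_A)
    then have "D i (Suc i) (map val u)"
      using i uw u K1 by (intro D_I map_val_S) (auto simp: derives_def)
    then show "\<exists>u\<in>lists S. length u \<le> 1 \<and> P i \<otimes> ev u = P (Suc i) \<and> D i (Suc i) u"
      using u uw map_val_S by (intro bexI[of _ "map val u"]) auto
  next
    fix i j k u w assume D: "D i j u" "D j k w" and len: "length u \<le> K" "length w \<le> K"
    have "join F (v i, map cd (u @ w), v k)"
      using D unfolding join_def list_ex_iff D_def
      by (intro bexI[of _ "(v i, map cd u, v j)"] bexI[of _ "(v j, map cd w, v k)"]) auto
    then show "D i k (u @ w)"
      using D len by (intro D_I) (auto simp: D_def derives_def)
  next
    fix i j u w assume D: "D i j u" and "(u, w) \<in> rewrite (2 * K + \<kappa>)"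
    then obtain x l r y where uw: "u = x @ l @ y" "w = x @ r @ y" "(l, r) \<in> relators"
      "x \<in> lists S" "y \<in> lists S" "length (x @ l @ y) \<le> 2 * K + \<kappa>" "length (x @ r @ y) \<le> 2 * K + \<kappa>"
      unfolding rewrite_def by blast
    have "(map cd l, map cd r) \<in> set R" using uw(3) by (auto simp: set_R)
    moreover have "map cd x \<in> set ?W" "map cd y \<in> set ?W"
      by (rule W; use uw map_cd in simp)+
    ultimately have "rewrites_to R ?W (map cd u) (map cd w)"
      unfolding rewrites_to_def list_ex_iff uw
      by (intro bexI[of _ "map cd x" "set ?W"] bexI[of _ "map cd y" "set ?W"]
          bexI[of _ "(map cd l, map cd r)"]) auto
    then have "derives A R gs gi ?W F (v i, map cd w, v j)"
      using D by (auto simp: derives_def list_ex_iff D_def intro!: bexI[of _ "(v i, map cd u, v j)"])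
    moreover have "w \<in> lists S" using uw by (auto simp: relators_def)
    ultimately show "D i j w" using D uw by (intro D_I) (auto simp: D_def)
  qed (use vP \<open>0 < N\<close> v K in auto)
  then show ?thesis using v by (simp add: D_def F_def solve_def)
qed

end

subsection \<open>Reading the input\<close>

text \<open>A letter comes with the codes of a word for it and of a word for its inverse.  The input is read from right to
  left, so that the target is the first word to be completed and each letter belongs to the head of the list.\<close>

definition parse_step ::
  "nat \<times> nat list \<times> nat list \<Rightarrow> bool \<times> nat \<times> (nat list \<times> nat list) list \<Rightarrow> bool \<times> nat \<times> (nat list \<times> nat list) list"
where
  "parse_step x st =
    (if fst x = 0 then
       (if snd (snd st) = [] then (False, 0, [])
        else (fst st, fst (snd st),
          (fst (snd x) @ fst (hd_or ([], []) (snd (snd st))), snd (hd_or ([], []) (snd (snd st))) @ snd (snd x)) #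
            tl (snd (snd st))))
     else if fst x = 1 then (fst st, fst (snd st), ([], []) # snd (snd st))
     else if snd (snd st) = [] then (fst st, Suc (fst (snd st)), [])
     else (False, 0, []))"

definition parse :: "(nat \<times> nat list \<times> nat list) list \<Rightarrow> bool \<times> nat \<times> (nat list \<times> nat list) list" where
  "parse xs = foldr parse_step xs (True, 0, [])"

lemma sz_bool: "1 \<le> sz b" "sz b \<le> 3" for b :: bool
  by (cases b; simp)+

text \<open>Growth is additive, so a fold over the whole input stays linear in its size.\<close>

lemma sz_parse_step: "sz (parse_step x st) \<le> sz st + sz x"
proof -
  obtain c u v where x: "x = (c, u, v)" by (cases x) auto
  obtain b m ws where st: "st = (b, m, ws)" by (cases st) auto
  have 0: "sz (False, 0 :: nat, [] :: (nat list \<times> nat list) list) \<le> sz st + sz x"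
    using sz_bool[of b] sz_pos[of m] sz_pos[of ws] sz_pos[of x] by (simp add: st)
  show ?thesis
  proof (cases ws)
    case Nil
    then show ?thesis
      using 0 sz_pos[of u] sz_pos[of v] sz_nat[of c] by (auto simp: parse_step_def st x)
  next
    case (Cons w ws')
    obtain y z where "w = (y, z)" by (cases w) auto
    then show ?thesis
      using 0 Cons sz_append[of u y] sz_append[of z v] sz_nat[of c] sz_pos[of u] sz_pos[of v]
      by (auto simp: parse_step_def st x hd_or_def)
  qed
qed

lemma sz_fold_parse_step: "sz (fold parse_step xs st) \<le> sz st + sz xs"
proof (induction xs arbitrary: st)
  case (Cons x xs)
  show ?case using Cons[of "parse_step x st"] sz_parse_step[of x st] by simp
qed simp

lemma ptime_parse: "ptime parse"
proof -
  have "ptime (\<lambda>xs. fold parse_step (rev xs) (True, 0, []))"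
  proof (rule ptime_fold[where S = "\<lambda>xs. 7 + sz xs"])
    show "sz (fold parse_step ys (True, 0, [])) \<le> 7 + sz xs" if "rev xs = ys @ zs" for xs ys zs
    proof -
      have "sz xs = sz (ys @ zs)" using that by (metis sz_rev)
      then show ?thesis
        using sz_fold_parse_step[of ys "(True, 0, [])"] sz_append[of ys zs] sz_pos[of zs] by simp
    qed
    show "ptime (\<lambda>p. parse_step (fst p) (snd (snd p)))"
      unfolding parse_step_def by (intro ptime_intros)
  qed (intro ptime_intros pbd_add pbd_const pbd_sz)+
  then show ?thesis by (simp add: parse_def[abs_def] foldr_conv_fold)
qed

text \<open>Reversing brings the target to the front, of which only the inverse is used; the order
  of the generators does not affect the set of their products. The power of the input length becomes
  the bound for \<open>words\<close>.\<close>

definition decide where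
  "decide A R E xs \<longleftrightarrow> fst (parse xs) \<and> snd (snd (parse xs)) \<noteq> [] \<and>
     solve A R (map fst (tl (rev (snd (snd (parse xs)))))) (snd (hd_or ([], []) (rev (snd (snd (parse xs))))))
       (fst (snd (parse xs))) ((length xs + 2) ^ E)"

lemma ptime_decide: "ptime (decide A R E)"
proof -
  have "ptime (\<lambda>xs. (map fst (tl (rev (snd (snd (parse xs))))), snd (hd_or ([], []) (rev (snd (snd (parse xs))))),
       fst (snd (parse xs)), (length xs + 2) ^ E))"
    by (intro ptime_intros ptime_parse)
  from ptime_comp[OF ptime_solve[of A R] this] show ?thesis
    unfolding decide_def[abs_def] by (intro ptime_intros ptime_parse) simp
qed

section \<open>Translation of instances into words over the hyperbolic generating set\<close>

context hyperbolic_solver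
begin

text \<open>Any word for the element will do: the function is applied to the finitely many input
  letters and their inverses, so the choice becomes a finite table and stretches lengths by a
  bounded factor.\<close>

definition nword :: "'a \<Rightarrow> nat list" where
  "nword g = map cd (SOME w. w \<in> lists S \<and> ev w = g)"

lemma nword: "g \<in> carrier G \<Longrightarrow> nword g \<in> lists (set A) \<and> evn (nword g) = g"
  using someI_ex[of "\<lambda>w. w \<in> lists S \<and> ev w = g"] ex_word[of g] map_cd unfolding nword_def
  by (metis (mono_tags, lifting))

fun symbol_code :: "'a bsmp_symbol \<Rightarrow> nat \<times> nat list \<times> nat list" where
  "symbol_code (Letter x) = (0, nword x, nword (inv x))"
| "symbol_code Separator = (1, [], [])"
| "symbol_code One = (2, [], [])"

definition nwords :: "'a list \<Rightarrow> nat list \<times> nat list" where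
  "nwords w = (concat (map nword w), concat (map (\<lambda>x. nword (inv x)) (rev w)))"

lemma nwords:
  assumes "w \<in> lists (carrier G)"
  shows "fst (nwords w) \<in> lists (set A) \<and> evn (fst (nwords w)) = ev w \<and>
    snd (nwords w) \<in> lists (set A) \<and> evn (snd (nwords w)) = inv (ev w)"
  using assms
proof (induction w rule: list.induct)
  case (Cons x w)
  then have x: "x \<in> carrier G" "ev w \<in> carrier G" by auto
  have IH: "fst (nwords w) \<in> lists (set A)" "evn (fst (nwords w)) = ev w"
    "snd (nwords w) \<in> lists (set A)" "evn (snd (nwords w)) = inv (ev w)"
    using Cons by auto
  have "nwords (x # w) = (nword x @ fst (nwords w), snd (nwords w) @ nword (inv x))"
    by (simp add: nwords_def)
  then show ?case
    using IH x nword[of x] nword[of "inv x"]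
    by (simp add: evn_append inv_mult_group del: set_A map_append)
qed (simp add: nwords_def)

lemma length_nwords:
  assumes "\<And>x. x \<in> set w \<Longrightarrow> length (nword x) \<le> c \<and> length (nword (inv x)) \<le> c"
  shows "length (fst (nwords w)) \<le> c * length w \<and> length (snd (nwords w)) \<le> c * length w"
  using assms
proof (induction w)
  case (Cons x w)
  then have "length (nword x) \<le> c" "length (nword (inv x)) \<le> c"
    "length (fst (nwords w)) \<le> c * length w" "length (snd (nwords w)) \<le> c * length w"
    by simp_all
  then show ?case by (simp add: nwords_def)
qed (simp add: nwords_def)

lemma parse_words:
  "parse (map symbol_code (concat (map encode_word us) @ replicate m One)) = (True, m, map nwords us)"
proof -
  have ones: "parse (map symbol_code (replicate m One)) = (True, m, [])"
    by (induction m) (auto simp: parse_def parse_step_def)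
  have word: "parse (map symbol_code (encode_word u @ s)) = (b, k, nwords u # ws)"
    if "parse (map symbol_code s) = (b, k, ws)" for u s b k ws
    using that
    by (induction u) (auto simp: parse_def parse_step_def encode_word_def nwords_def hd_or_def)
  show ?thesis
  proof (induction us)
    case (Cons u us)
    show ?case using word[OF Cons.IH, of u] by (simp del: map_append)
  qed (use ones in \<open>simp del: map_replicate\<close>)
qed

text \<open>Read from the right, the only errors are a letter with no separator after it and a
  \<open>One\<close> before a separator; either clears the flag for good. The list \<open>us\<close>
  may be empty here; the presence of a target is tested in \<open>decide\<close>.\<close>

lemma parse_sound:
  "fst (parse (map symbol_code s)) \<Longrightarrow> \<exists>us m. s = concat (map encode_word us) @ replicate m One"
proof (induction s)
  case Nil
  show ?case by (intro exI[of _ "[]"] exI[of _ 0]) simp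
next
  case (Cons x s)
  have parse_Cons: "parse (map symbol_code (x # s)) = parse_step (symbol_code x) (parse (map symbol_code s))"
    by (simp add: parse_def)
  have "fst (parse (map symbol_code s))"
    using Cons.prems unfolding parse_Cons by (auto simp: parse_step_def split: if_splits)
  then obtain us m where s: "s = concat (map encode_word us) @ replicate m One" using Cons.IH by blast
  then have p: "parse (map symbol_code s) = (True, m, map nwords us)" using parse_words by simp
  show ?case
  proof (cases x)
    case (Letter a)
    then obtain u us' where us: "us = u # us'"
      using Cons.prems unfolding parse_Cons p by (cases us) (auto simp: parse_step_def)
    have "x # s = concat (map encode_word ((a # u) # us')) @ replicate m One"
      by (simp add: s us Letter encode_word_def)
    then show ?thesis by blast
  next
    case Separator
    then have "x # s = concat (map encode_word ([] # us)) @ replicate m One"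
      by (simp add: s encode_word_def)
    then show ?thesis by blast
  next
    case One
    then have "us = []"
      using Cons.prems unfolding parse_Cons p by (cases us) (auto simp: parse_step_def)
    then have "x # s = concat (map encode_word []) @ replicate (Suc m) One"
      using One s by simp
    then show ?thesis by blast
  qed
qed

lemma ev_concat: "ws \<in> lists (lists (set A)) \<Longrightarrow> evn (concat ws) = ev (map evn ws)"
proof (induction ws rule: list.induct)
  case (Cons w ws)
  then have "concat ws \<in> lists (set A)" by (auto simp del: set_A) (blast dest: subsetD)
  with Cons show ?case by (simp add: evn_append del: set_A map_append)
qed simp

text \<open>Moving the target to the other side turns the question into one about trivial products,
  as \<open>solve\<close> expects. Only the set of \<open>gs'\<close> is prescribed, because
  \<open>decide\<close> reverses the list of generators.\<close>

lemma solvable_iff_words: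
  assumes gs: "gs \<in> lists (lists (carrier G))" and g: "g \<in> lists (carrier G)"
    and gs': "set gs' = set (map (fst \<circ> nwords) gs)"
  shows "bsmp_solvable G gs g m \<longleftrightarrow>
    (\<exists>ws \<in> lists (set gs'). length ws \<le> m \<and> evn (concat ws) \<otimes> evn (snd (nwords g)) = \<one>)"
proof -
  have gs'_D: "\<exists>u \<in> set gs. v = fst (nwords u) \<and> v \<in> lists (set A) \<and> evn v = ev u" if v: "v \<in> set gs'" for v
  proof -
    obtain u where u: "u \<in> set gs" "v = fst (nwords u)" using v gs' by auto
    then have "u \<in> lists (carrier G)" using gs by auto
    then show ?thesis using nwords u by blast
  qed
  then have gs'_A: "gs' \<in> lists (lists (set A))" by blast
  have g_eq: "evn (snd (nwords g)) = inv (ev g)" "ev g \<in> carrier G" using nwords[OF g] g by auto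
  have key: "evn (concat ws) \<otimes> evn (snd (nwords g)) = \<one> \<longleftrightarrow> ev g = ev (map evn ws)"
    "evn ` set ws \<subseteq> ev ` set gs" if ws: "ws \<in> lists (set gs')" for ws
  proof -
    have ws_A: "ws \<in> lists (lists (set A))" using ws gs'_A by (meson in_lists_conv_set)
    then have "evn v \<in> carrier G" if "v \<in> set ws" for v
      using that by (meson evn_closed in_lists_conv_set)
    then have "ev (map evn ws) \<in> carrier G" by (intro ev_closed) auto
    then show "evn (concat ws) \<otimes> evn (snd (nwords g)) = \<one> \<longleftrightarrow> ev g = ev (map evn ws)"
      using right_cancel[of "inv (ev g)" "ev (map evn ws)" "ev g"] g_eq(2)
      unfolding ev_concat[OF ws_A] g_eq(1) by (metis inv_closed r_inv)
    show "evn ` set ws \<subseteq> ev ` set gs"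
      using ws gs'_D by (fastforce simp del: set_A)
  qed
  show ?thesis
  proof
    assume "bsmp_solvable G gs g m"
    then obtain hs where hs: "hs \<in> lists (ev ` set gs)" "length hs \<le> m" "ev g = ev hs"
      by (auto simp: bsmp_solvable_def word_eval_def)
    have "\<exists>w \<in> set gs'. evn w = h" if h: "h \<in> set hs" for h
    proof -
      obtain u where u: "u \<in> set gs" "h = ev u" using hs(1) h by auto
      then have "fst (nwords u) \<in> set gs'" "evn (fst (nwords u)) = h"
        using gs gs' nwords[of u] by auto
      then show ?thesis by blast
    qed
    then obtain f where f: "\<And>h. h \<in> set hs \<Longrightarrow> f h \<in> set gs' \<and> evn (f h) = h" by metis
    have "map evn (map f hs) = hs" using f by (auto intro!: map_idI)
    moreover have "map f hs \<in> lists (set gs')" using f by auto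
    ultimately show "\<exists>ws \<in> lists (set gs'). length ws \<le> m \<and> evn (concat ws) \<otimes> evn (snd (nwords g)) = \<one>"
      using hs key(1)[of "map f hs"] by (intro bexI[of _ "map f hs"]) auto
  next
    assume "\<exists>ws \<in> lists (set gs'). length ws \<le> m \<and> evn (concat ws) \<otimes> evn (snd (nwords g)) = \<one>"
    then obtain ws where ws: "ws \<in> lists (set gs')" "length ws \<le> m" "ev g = ev (map evn ws)"
      using key(1) by blast
    then show "bsmp_solvable G gs g m"
      unfolding bsmp_solvable_def
      using key(2)[OF ws(1)] by (intro bexI[of _ "map evn ws"]) (auto simp: word_eval_def)
  qed
qed

lemma BSMP_iff_decide:
  assumes X: "finite_generating_set G X"
  shows "\<exists>E. \<forall>w \<in> lists (bsmp_alphabet G X). w \<in> BSMP G X \<longleftrightarrow> decide A R E (map symbol_code w)"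
proof -
  let ?SX = "sym_gens G X"
  have SX: "finite ?SX" "?SX \<subseteq> carrier G"
    using X by (auto simp: finite_generating_set_def sym_gens_def)
  \<comment> \<open>A sum over the finite alphabet serves as a common bound for all letters and
    their inverses.\<close>
  define c where "c = (\<Sum>x\<in>?SX. length (nword x) + length (nword (inv x)))"
  have c: "length (nword x) \<le> c \<and> length (nword (inv x)) \<le> c" if "x \<in> ?SX" for x
    using member_le_sum[of x ?SX "\<lambda>x. length (nword x) + length (nword (inv x))"] that SX(1)
    unfolding c_def by auto
  \<comment> \<open>\<open>E\<close> is the same for all inputs and enters the program;
    \<open>L\<close> and \<open>K\<close> vary with the input and occur only in the proof of
    completeness.\<close>
  obtain E where E: "\<And>n. \<exists>L K. (n + 1) * (c * n + 2) \<le> 2 ^ L \<and> real K > 2 * \<delta> * L + 3 \<and>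
      (length letters + 2) ^ (2 * K + \<kappa>) \<le> (n + 2) ^ E"
    using ex_parameters[OF delta_nonneg, of c "length letters" \<kappa>] by blast
  have "w \<in> BSMP G X \<longleftrightarrow> decide A R E (map symbol_code w)" if w: "w \<in> lists (bsmp_alphabet G X)" for w
  proof (cases "\<exists>gs g m. w = encode_bsmp gs g m")
    case True
    then obtain gs g m where enc: "w = encode_bsmp gs g m" by blast
    have "x \<in> ?SX" if "u \<in> set (g # gs)" "x \<in> set u" for u x
    proof -
      have "Letter x \<in> set w" using that by (auto simp: enc encode_bsmp_def encode_word_def)
      then have "Letter x \<in> bsmp_alphabet G X" using w by auto
      then show ?thesis by (auto simp: bsmp_alphabet_def)
    qed
    then have gsg: "gs \<in> lists (lists ?SX)" "g \<in> lists ?SX" by auto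
    then have carrier: "gs \<in> lists (lists (carrier G))" "g \<in> lists (carrier G)" using SX(2) by auto
    let ?gs = "map fst (rev (map nwords gs))" and ?gi = "snd (nwords g)"
    have parse: "parse (map symbol_code w) = (True, m, map nwords (gs @ [g]))"
      using parse_words[of "gs @ [g]" m] by (simp add: enc encode_bsmp_def)
    have B: "w \<in> BSMP G X \<longleftrightarrow> bsmp_solvable G gs g m"
      using gsg enc by (auto simp: BSMP_def encode_bsmp_inject)
    have D: "decide A R E (map symbol_code w) \<longleftrightarrow> solve A R ?gs ?gi m ((length w + 2) ^ E)"
      by (simp add: decide_def parse hd_or_def)
    have "fst (nwords u) \<in> lists (set A)" if "u \<in> set gs" for u
      using nwords carrier(1) that by (meson in_lists_conv_set)
    then have "set ?gs \<subseteq> lists (set A)" unfolding set_map set_rev by blast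
    then have A: "?gs \<in> lists (lists (set A))" "?gi \<in> lists (set A)"
      using nwords[OF carrier(2)] by (auto simp only: lists_eq_set mem_Collect_eq)
    have sol: "bsmp_solvable G gs g m \<longleftrightarrow>
      (\<exists>ws \<in> lists (set ?gs). length ws \<le> m \<and> evn (concat ws) \<otimes> evn ?gi = \<one>)"
      by (rule solvable_iff_words[OF carrier]) auto
    have "bsmp_solvable G gs g m \<Longrightarrow> solve A R ?gs ?gi m ((length w + 2) ^ E)"
    proof -
      assume "bsmp_solvable G gs g m"
      then obtain ws where ws: "ws \<in> lists (set ?gs)" "length ws \<le> m" "evn (concat ws) \<otimes> evn ?gi = \<one>"
        using sol by blast
      obtain L K where LK: "(length w + 1) * (c * length w + 2) \<le> 2 ^ L" "real K > 2 * \<delta> * L + 3"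
        "(length letters + 2) ^ (2 * K + \<kappa>) \<le> (length w + 2) ^ E"
        using E by blast
      have len: "length u \<le> length w" if "u \<in> set (g # gs)" for u
      proof -
        have "length u \<le> length (concat (map encode_word (gs @ [g])))"
          using that member_le_sum_list[of "length (encode_word u)" "map (length \<circ> encode_word) (gs @ [g])"]
          by (auto simp: length_concat encode_word_def comp_def)
        then show ?thesis by (simp add: enc encode_bsmp_def)
      qed
      have "length t \<le> c * length w" if t: "t \<in> set (?gi # ?gs)" for t
      proof -
        obtain u where u: "u \<in> set (g # gs)" "t = fst (nwords u) \<or> t = snd (nwords u)"
          using t unfolding list.set set_map set_rev by blast
        have "x \<in> ?SX" if "x \<in> set u" for x using u gsg that by auto
        then have "length t \<le> c * length u" using length_nwords[of u c] c u(2) by auto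
        then show ?thesis using mult_le_mono2[OF len[OF u(1)], of c] by linarith
      qed
      moreover have "m \<le> length w" by (simp add: enc encode_bsmp_def)
      then have "(m + 1) * (c * length w + 2) \<le> 2 ^ L"
        using mult_le_mono1[of "m + 1" "length w + 1" "c * length w + 2"] LK(1) by linarith
      ultimately show ?thesis
        by (intro solve_complete[OF A _ ws _ LK(2,3)])
    qed
    moreover have "solve A R ?gs ?gi m ((length w + 2) ^ E) \<Longrightarrow> bsmp_solvable G gs g m"
      using solve_sound[OF _ A] sol by blast
    ultimately show ?thesis using B D by blast
  next
    case False
    then have "w \<notin> BSMP G X" by (auto simp: BSMP_def)
    moreover have "\<not> decide A R E (map symbol_code w)"
    proof
      assume dec: "decide A R E (map symbol_code w)"
      then obtain us m where us: "w = concat (map encode_word us) @ replicate m One"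
        using parse_sound[of w] by (auto simp: decide_def)
      have "us \<noteq> []" using dec unfolding decide_def us parse_words by auto
      then obtain vs v where "us = vs @ [v]" by (cases us rule: rev_cases) auto
      then have "w = encode_bsmp vs v m" by (simp add: us encode_bsmp_def)
      with False show False by blast
    qed
    ultimately show ?thesis by blast
  qed
  then show ?thesis by blast
qed

end

theorem theorem5p11:
  fixes G :: "('a, 'b) monoid_scheme" and X :: "'a set"
  assumes "hyperbolic_group G"
    and "finite_generating_set G X"
  shows "BSMP G X \<in> class_P (bsmp_alphabet G X)"
proof -
  obtain Y \<delta> where G: "group G" and Y: "finite_generating_set G Y" and \<delta>: "0 \<le> \<delta>"
    "\<And>w x y z. w \<in> carrier G \<Longrightarrow> x \<in> carrier G \<Longrightarrow> y \<in> carrier G \<Longrightarrow> z \<in> carrier G \<Longrightarrow>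
      gromov_product (word_dist G Y) w x z \<ge>
        min (gromov_product (word_dist G Y) w x y) (gromov_product (word_dist G Y) w y z) - \<delta>"
    using assms(1) unfolding hyperbolic_group_def gromov_hyperbolic_def by blast
  have "finite (sym_gens G Y)" using Y by (auto simp: sym_gens_def finite_generating_set_def)
  then obtain letters where letters: "set letters = sym_gens G Y" "distinct letters"
    using finite_distinct_list by blast
  interpret hyperbolic_solver G Y \<delta> letters
    by (intro hyperbolic_solver.intro hyperbolic_word_metric.intro word_metric.intro G
        word_metric_axioms.intro Y hyperbolic_word_metric_axioms.intro \<delta> hyperbolic_solver_axioms.intro letters)
  obtain E where E: "\<forall>w \<in> lists (bsmp_alphabet G X). w \<in> BSMP G X \<longleftrightarrow> decide A R E (map symbol_code w)"
    using BSMP_iff_decide[OF assms(2)] by blast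
  show ?thesis
  proof (rule ptime_class_P[OF ptime_decide, where T = symbol_code])
    show "finite (bsmp_alphabet G X)"
      using assms(2) by (auto simp: bsmp_alphabet_def sym_gens_def finite_generating_set_def)
    show "BSMP G X \<subseteq> lists (bsmp_alphabet G X)"
      by (auto simp: BSMP_def encode_bsmp_def encode_word_def bsmp_alphabet_def split: if_splits) blast+
  qed (use E in blast)
qed

end
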